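(* Let $Y$ be any $GL$-stable subset of $\mathbf{Hilb}_{p(t)}^{n}$ and $r$ be the Gotzmann number of the Hilbert polynomial $p(t)$. If $J\subseteq S$ is a saturated monomial ideal defining a point of $Y$, then for every $m\ge r$ $$J_m\prec\!\!\prec(\mathbf G_Y)_m.$$
   Context: $K$ is an infinite field, $S=K[x_0,\dots,x_n]$ with the standard grading, $S_m$ is its degree $m$ component, a term is a monic monomial, $\prec$ is a term order on $S$ with $x_0\prec\dots\prec x_n$. $\mathbf{Hilb}_{p(t)}^{n}$ is the Hilbert scheme of closed subschemes of $\mathbb P^n_K$ with Hilbert polynomial $p(t)$; the Gotzmann number $r$ of $p(t)$ is the smallest integer such that the saturated ideals of all such subschemes are $r$-regular. For $m\ge r$ and $q=\binom{n+m}{n}-p(m)$, $\mathbf{Hilb}_{p(t)}^{n}$ is regarded as a closed subscheme of the Grassmannian $\mathbf{Gr}_{S_m}^{q}$ of $q$-dimensional subspaces of $S_m$ by sending a subscheme with saturated ideal $I$ to $I_m$; the Grassmannian is embedded in $\mathbb P(\wedge^qS_m)$ by Plücker. $\mathbf T_{S_m}^{q}$ is the set of $\tau_1\wedge\dots\wedge\tau_q$ with $\tau_i$ terms in $S_m$, $\tau_1\succ\dots\succ\tau_q$, totally ordered by: $\tau_1\wedge\dots\wedge\tau_q\prec\sigma_1\wedge\dots\wedge\sigma_q$ iff for some $j$, $\tau_i=\sigma_i$ for $i<j$ and $\tau_j\prec\sigma_j$. For $L=\tau_1\wedge\dots\wedge\tau_q$, $U_L\subseteq\mathbf{Gr}_{S_m}^{q}$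 is the open set where the Plücker coordinate $\Delta_L$ is invertible, $\mathrm{vs}(L)=\langle\tau_1,\dots,\tau_q\rangle$. $\mathrm{GL}=\mathrm{GL}_K(n+1)$ acts on $S$ by $g(f)=f(\sum_j g_{0j}x_j,\dots,\sum_j g_{nj}x_j)$ and correspondingly on $\mathbf{Gr}_{S_m}^{q}$; $\mathcal O(Y)=\{g(V):V\in Y,\ g\in\mathrm{GL}\}$; $\mathbf{gin}(Y):=\max_\prec\{L\in\mathbf T_{S_m}^{q}:U_L\cap\mathcal O(Y)\ne\emptyset\}$. A $GL$-stable subset is a non-empty closed irreducible subset of $\mathbf{Hilb}_{p(t)}^{n}$ stable under $\mathrm{GL}$. The double-generic initial ideal of such $Y$ is $\mathbf G_Y:=(I_{\mathrm{vs}(\mathbf{gin}(Y))})^{\mathrm{sat}}$, where $I_V$ is the ideal of $S$ generated by $V\subseteq S_m$ and sat denotes saturation with respect to $(x_0,\dots,x_n)$; it does not depend on $m\ge r$. For subspaces $V,V'$ of $S_m$ spanned by sets $A,B$ of $q$ terms each, $V\prec\!\!\prec V'$ means there is a bijection $\omega:A\to B$ with $a\preceq\omega(a)$ for every $a\in A$. *)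

theory Defs
  imports
    "HOL-Library.Poly_Mapping"
    "HOL-Computational_Algebra.Polynomial"
    "Jordan_Normal_Form.Determinant"
begin

text \<open>
  Points. \<open>'a\<close> is a field and \<open>K\<close> (a subset of \<open>'a\<close>) an infinite subfield. The points of the
  Grassmannian and of the Hilbert scheme are taken with values in \<open>'a\<close>, while the Zariski topology
  is the one defined by equations over \<open>K\<close> and the group is \<open>GL\<close> over \<open>K\<close>. This is exactly the
  topology induced by the canonical map from the \<open>'a\<close>-valued points to the underlying space of the
  scheme over \<open>K\<close>. Taking \<open>K = UNIV\<close> gives the \<open>K\<close>-rational points, i.e. the subschemes of
  projective space over \<open>K\<close>; taking for \<open>'a\<close> an algebraic closure of \<open>K\<close> gives the closed points
  of the Hilbert scheme over \<open>K\<close> and hence all closed irreducible subsets of that scheme.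
\<close>

definition subfield_set :: "'a::field set \<Rightarrow> bool" where
  "subfield_set K \<longleftrightarrow> 0 \<in> K \<and> 1 \<in> K
     \<and> (\<forall>a\<in>K. \<forall>b\<in>K. a + b \<in> K \<and> a * b \<in> K)
     \<and> (\<forall>a\<in>K. - a \<in> K \<and> inverse a \<in> K)"

section \<open>Polynomials and terms\<close>

text \<open>
  Polynomials in variables indexed by \<open>'v\<close>: finitely supported functions from exponent
  vectors to coefficients. The ring \<open>S\<close> in \<open>x_0, ..., x_n\<close> uses \<open>'v = nat\<close> and the indices
  \<open>\<le> n\<close>; a term is identified with its exponent vector.
\<close>

type_synonym 'v expo = "'v \<Rightarrow>\<^sub>0 nat"
type_synonym ('v, 'a) mpoly = "('v \<Rightarrow>\<^sub>0 nat) \<Rightarrow>\<^sub>0 'a"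
type_synonym pterm = "nat expo"
type_synonym 'a spoly = "(nat, 'a) mpoly"

definition expo_deg :: "'v expo \<Rightarrow> nat" where
  "expo_deg t = (\<Sum>i\<in>Poly_Mapping.keys t. Poly_Mapping.lookup t i)"

definition insertion ::
  "('a::zero \<Rightarrow> 'b::comm_ring_1) \<Rightarrow> ('v \<Rightarrow> 'b) \<Rightarrow> ('v, 'a) mpoly \<Rightarrow> 'b" where
  "insertion c x f = (\<Sum>e\<in>Poly_Mapping.keys f. c (Poly_Mapping.lookup f e)
      * (\<Prod>v\<in>Poly_Mapping.keys e. x v ^ Poly_Mapping.lookup e v))"

definition const :: "'a::zero \<Rightarrow> 'a spoly" where
  "const a = Poly_Mapping.single 0 a"

definition of_term :: "pterm \<Rightarrow> 'a::{zero,one} spoly" where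
  "of_term t = Poly_Mapping.single t 1"

definition var :: "nat \<Rightarrow> 'a::{zero,one} spoly" where
  "var i = of_term (Poly_Mapping.single i 1)"

definition terms :: "nat \<Rightarrow> pterm set" where
  "terms n = {t. Poly_Mapping.keys t \<subseteq> {..n}}"

definition terms_deg :: "nat \<Rightarrow> nat \<Rightarrow> pterm set" where
  "terms_deg n m = {t \<in> terms n. expo_deg t = m}"

text \<open>The ring \<open>S\<close> and its graded pieces \<open>S_m\<close>.\<close>

definition polys :: "nat \<Rightarrow> 'a::zero spoly set" where
  "polys n = {f. Poly_Mapping.keys f \<subseteq> terms n}"

definition forms :: "nat \<Rightarrow> nat \<Rightarrow> 'a::zero spoly set" where
  "forms n m = {f. Poly_Mapping.keys f \<subseteq> terms_deg n m}"

definition hom_comp :: "nat \<Rightarrow> 'a::comm_monoid_add spoly \<Rightarrow> 'a spoly" where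
  "hom_comp m f = (\<Sum>t | t \<in> Poly_Mapping.keys f \<and> expo_deg t = m.
      Poly_Mapping.single t (Poly_Mapping.lookup f t))"

global_interpretation mp: vector_space "\<lambda>(c::'a::field) (f::'a spoly). const c * f"
  defines mp_span = mp.span and mp_dim = mp.dim and mp_subspace = mp.subspace
    and mp_dependent = mp.dependent
proof unfold_locales
  show "const a * (f + g) = const a * f + const a * g" for a :: 'a and f g :: "'a spoly"
    by (rule distrib_left)
  show "const (a + b) * f = const a * f + const b * f" for a b :: 'a and f :: "'a spoly"
    by (simp only: const_def Poly_Mapping.single_add distrib_right)
  show "const a * (const b * f) = const (a * b) * f" for a b :: 'a and f :: "'a spoly"
    by (simp add: const_def Poly_Mapping.mult_single flip: mult.assoc)
  show "const 1 * f = f" for f :: "'a spoly"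
    by (simp add: const_def)
qed

text \<open>
  Term orders with \<open>x_0 \<prec> ... \<prec> x_n\<close>. The well-order property is a consequence (Dickson).
\<close>

definition term_order :: "nat \<Rightarrow> (pterm \<Rightarrow> pterm \<Rightarrow> bool) \<Rightarrow> bool" where
  "term_order n prec \<longleftrightarrow>
     (\<forall>s\<in>terms n. \<not> prec s s)
   \<and> (\<forall>s\<in>terms n. \<forall>t\<in>terms n. \<forall>u\<in>terms n. prec s t \<longrightarrow> prec t u \<longrightarrow> prec s u)
   \<and> (\<forall>s\<in>terms n. \<forall>t\<in>terms n. s \<noteq> t \<longrightarrow> prec s t \<or> prec t s)
   \<and> (\<forall>s\<in>terms n. \<forall>t\<in>terms n. \<forall>u\<in>terms n. prec s t \<longrightarrow> prec (s + u) (t + u))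
   \<and> (\<forall>t\<in>terms n. t \<noteq> 0 \<longrightarrow> prec 0 t)
   \<and> (\<forall>i j. i < j \<longrightarrow> j \<le> n \<longrightarrow>
        prec (Poly_Mapping.single i 1) (Poly_Mapping.single j 1))"

section \<open>Ideals\<close>

definition poly_ideal :: "nat \<Rightarrow> 'a::comm_ring_1 spoly set \<Rightarrow> bool" where
  "poly_ideal n I \<longleftrightarrow> I \<subseteq> polys n \<and> 0 \<in> I
     \<and> (\<forall>f\<in>I. \<forall>g\<in>I. f + g \<in> I) \<and> (\<forall>h\<in>polys n. \<forall>f\<in>I. h * f \<in> I)"

definition homogeneous_ideal :: "nat \<Rightarrow> 'a::comm_ring_1 spoly set \<Rightarrow> bool" where
  "homogeneous_ideal n I \<longleftrightarrow> poly_ideal n I \<and> (\<forall>f\<in>I. \<forall>m. hom_comp m f \<in> I)"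

definition ideal_gen :: "nat \<Rightarrow> 'a::comm_ring_1 spoly set \<Rightarrow> 'a spoly set" where
  "ideal_gen n B = \<Inter>{I. poly_ideal n I \<and> B \<subseteq> I}"

definition monomial_ideal :: "nat \<Rightarrow> 'a::comm_ring_1 spoly set \<Rightarrow> bool" where
  "monomial_ideal n I \<longleftrightarrow> (\<exists>A\<subseteq>terms n. I = ideal_gen n (of_term ` A))"

text \<open>
  The saturation \<open>I : (x_0, ..., x_n)^\<infinity>\<close>; the power \<open>(x_0, ..., x_n)^k\<close> is generated by \<open>S_k\<close>.
\<close>

definition saturation :: "nat \<Rightarrow> 'a::comm_ring_1 spoly set \<Rightarrow> 'a spoly set" where
  "saturation n I = {f \<in> polys n. \<exists>k. \<forall>g\<in>forms n k. g * f \<in> I}"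

definition saturated :: "nat \<Rightarrow> 'a::comm_ring_1 spoly set \<Rightarrow> bool" where
  "saturated n I \<longleftrightarrow> saturation n I = I"

definition graded_part :: "nat \<Rightarrow> nat \<Rightarrow> 'a::zero spoly set \<Rightarrow> 'a spoly set" where
  "graded_part n m I = I \<inter> forms n m"

section \<open>Castelnuovo-Mumford regularity\<close>

text \<open>
  \<open>min_free_resolution n I c e D\<close>: a minimal graded free resolution
  \<open>0 \<rightarrow> F_n \<rightarrow> ... \<rightarrow> F_1 \<rightarrow> F_0 \<rightarrow> I \<rightarrow> 0\<close> where \<open>F_i\<close> is the sum of the \<open>S(- e i j)\<close> with \<open>j < c i\<close>.
  The matrix \<open>D i\<close> is the map from \<open>F_i\<close> to \<open>F_(i-1)\<close>, and \<open>D 0\<close> is the map from \<open>F_0\<close> to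
  \<open>S\<close> with image \<open>I\<close>. The maps are homogeneous of degree 0, and minimal means that the entries of
  \<open>D i\<close> with \<open>i > 0\<close> have no constant term. The length bound is the one in Hilbert's syzygy theorem.
\<close>

definition free_module :: "nat \<Rightarrow> nat \<Rightarrow> 'a::zero spoly vec set" where
  "free_module n c = {v \<in> carrier_vec c. \<forall>i<c. v $ i \<in> polys n}"

definition min_free_resolution ::
  "nat \<Rightarrow> 'a::comm_ring_1 spoly set \<Rightarrow> (nat \<Rightarrow> nat) \<Rightarrow> (nat \<Rightarrow> nat \<Rightarrow> nat)
    \<Rightarrow> (nat \<Rightarrow> 'a spoly mat) \<Rightarrow> bool" where
  "min_free_resolution n I c e D \<longleftrightarrow>
     D 0 \<in> carrier_mat 1 (c 0)
   \<and> (\<forall>j<c 0. D 0 $$ (0, j) \<in> forms n (e 0 j))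
   \<and> (\<forall>i. D (Suc i) \<in> carrier_mat (c i) (c (Suc i)))
   \<and> (\<forall>i. \<forall>k<c i. \<forall>j<c (Suc i).
        (if e i k \<le> e (Suc i) j then D (Suc i) $$ (k, j) \<in> forms n (e (Suc i) j - e i k)
         else D (Suc i) $$ (k, j) = 0)
        \<and> Poly_Mapping.lookup (D (Suc i) $$ (k, j)) 0 = 0)
   \<and> (\<lambda>v. D 0 *\<^sub>v v) ` free_module n (c 0) = (\<lambda>f. vec 1 (\<lambda>_. f)) ` I
   \<and> (\<forall>i. (\<lambda>v. D (Suc i) *\<^sub>v v) ` free_module n (c (Suc i))
        = {w \<in> free_module n (c i). D i *\<^sub>v w = 0\<^sub>v (dim_row (D i))})
   \<and> (\<forall>i>n. c i = 0)"

definition regular :: "nat \<Rightarrow> nat \<Rightarrow> 'a::comm_ring_1 spoly set \<Rightarrow> bool" where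
  "regular n m I \<longleftrightarrow>
     (\<exists>c e D. min_free_resolution n I c e D \<and> (\<forall>i. \<forall>j<c i. e i j \<le> m + i))"

section \<open>The Hilbert scheme\<close>

definition has_hilbert_poly :: "nat \<Rightarrow> 'a::field spoly set \<Rightarrow> rat poly \<Rightarrow> bool" where
  "has_hilbert_poly n I p \<longleftrightarrow>
     (\<forall>\<^sub>F t in sequentially.
        rat_of_nat (mp_dim (forms n t :: 'a spoly set)) - rat_of_nat (mp_dim (graded_part n t I))
          = poly p (rat_of_nat t))"

text \<open>
  The points of \<open>Hilb\<close>: closed subschemes of projective \<open>n\<close>-space with Hilbert polynomial \<open>p\<close>,
  represented by their saturated homogeneous ideals.
\<close>

definition hilb :: "nat \<Rightarrow> rat poly \<Rightarrow> 'a::field spoly set set" where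
  "hilb n p = {I. homogeneous_ideal n I \<and> saturated n I \<and> has_hilbert_poly n I p}"

text \<open>
  A relation rather than a function, so that no junk value arises when there is no smallest
  \<open>r\<close>. The type argument names the field over which subschemes are taken; the Gotzmann number of
  \<open>p\<close> does not depend on it.
\<close>

definition gotzmann_number :: "'a::field itself \<Rightarrow> nat \<Rightarrow> rat poly \<Rightarrow> nat \<Rightarrow> bool" where
  "gotzmann_number T n p r \<longleftrightarrow>
     (\<forall>I\<in>(hilb n p :: 'a spoly set set). regular n r I)
   \<and> (\<forall>s. (\<forall>I\<in>(hilb n p :: 'a spoly set set). regular n s I) \<longrightarrow> r \<le> s)"

text \<open>\<open>q = binomial(n+m, n) - p(m)\<close>, a natural number for \<open>m \<ge> r\<close> if \<open>hilb n p\<close> is non-empty.\<close>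

definition hilb_q :: "nat \<Rightarrow> rat poly \<Rightarrow> nat \<Rightarrow> nat" where
  "hilb_q n p m = nat \<lfloor>rat_of_nat ((n + m) choose n) - poly p (rat_of_nat m)\<rfloor>"

section \<open>Grassmannian, extensors and Pluecker coordinates\<close>

definition Gr :: "nat \<Rightarrow> nat \<Rightarrow> nat \<Rightarrow> 'a::field spoly set set" where
  "Gr n m q = {V. mp_subspace V \<and> V \<subseteq> forms n m \<and> mp_dim V = q}"

text \<open>
  The extensor \<open>\<tau>_1 \<and> ... \<and> \<tau>_q\<close> of terms with \<open>\<tau>_1 \<succ> ... \<succ> \<tau>_q\<close> is the decreasing list of
  the \<open>\<tau>_i\<close>.
\<close>

definition extensors ::
  "nat \<Rightarrow> (pterm \<Rightarrow> pterm \<Rightarrow> bool) \<Rightarrow> nat \<Rightarrow> nat \<Rightarrow> pterm list set" where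
  "extensors n prec m q =
     {L. length L = q \<and> set L \<subseteq> terms_deg n m \<and> sorted_wrt (\<lambda>s t. prec t s) L}"

definition extensor_less ::
  "(pterm \<Rightarrow> pterm \<Rightarrow> bool) \<Rightarrow> pterm list \<Rightarrow> pterm list \<Rightarrow> bool" where
  "extensor_less prec L M \<longleftrightarrow>
     (\<exists>j<length L. (\<forall>i<j. L ! i = M ! i) \<and> prec (L ! j) (M ! j))"

definition vs :: "pterm list \<Rightarrow> 'a::field spoly set" where
  "vs L = mp_span (of_term ` set L)"

definition basis_list :: "'a::field spoly list \<Rightarrow> 'a spoly set \<Rightarrow> bool" where
  "basis_list B V \<longleftrightarrow> distinct B \<and> \<not> mp_dependent (set B) \<and> mp_span (set B) = V"

text \<open>
  The homogeneous coordinates of \<open>V\<close> in the Pluecker embedding, computed from some basis. Another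
  basis multiplies all of them by the same non-zero scalar.
\<close>

definition pluecker :: "'a::field spoly set \<Rightarrow> pterm list \<Rightarrow> 'a" where
  "pluecker V L = (let B = (SOME B. basis_list B V) in
     det (mat (length L) (length L) (\<lambda>(i, j). Poly_Mapping.lookup (B ! i) (L ! j))))"

definition U_open :: "nat \<Rightarrow> nat \<Rightarrow> nat \<Rightarrow> pterm list \<Rightarrow> 'a::field spoly set set" where
  "U_open n m q L = {V \<in> Gr n m q. pluecker V L \<noteq> 0}"

section \<open>The action of the general linear group\<close>

definition GL :: "'a::field set \<Rightarrow> nat \<Rightarrow> 'a mat set" where
  "GL K n = {g \<in> carrier_mat (n + 1) (n + 1). invertible_mat g
      \<and> (\<forall>i\<le>n. \<forall>j\<le>n. g $$ (i, j) \<in> K)}"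

definition gl_act :: "nat \<Rightarrow> 'a::field mat \<Rightarrow> 'a spoly \<Rightarrow> 'a spoly" where
  "gl_act n g f = insertion const (\<lambda>i. \<Sum>j\<le>n. const (g $$ (i, j)) * var j) f"

definition GL_orbit :: "'a::field set \<Rightarrow> nat \<Rightarrow> 'a spoly set set \<Rightarrow> 'a spoly set set" where
  "GL_orbit K n W = {gl_act n g ` V | g V. V \<in> W \<and> g \<in> GL K n}"

section \<open>Zariski topology and GL-stable subsets\<close>

text \<open>
  The Zariski topology on \<open>hilb n p\<close> given by its embedding in the Grassmannian of \<open>S_m\<close> and the
  Pluecker embedding: closed sets are cut out by homogeneous polynomials with coefficients in \<open>K\<close>
  in the Pluecker coordinates of \<open>I_m\<close>.
\<close>

definition zclosed ::
  "'a::field set \<Rightarrow> nat \<Rightarrow> (pterm \<Rightarrow> pterm \<Rightarrow> bool) \<Rightarrow> rat poly \<Rightarrow> nat \<Rightarrow> 'a spoly set set \<Rightarrow> bool"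
  where
  "zclosed K n prec p m Z \<longleftrightarrow>
     (\<exists>F :: (pterm list, 'a) mpoly set.
        (\<forall>f\<in>F. Poly_Mapping.range f \<subseteq> K
           \<and> (\<exists>k. \<forall>e\<in>Poly_Mapping.keys f.
                expo_deg e = k \<and> Poly_Mapping.keys e \<subseteq> extensors n prec m (hilb_q n p m)))
      \<and> Z = {I \<in> hilb n p. \<forall>f\<in>F. insertion (\<lambda>a. a) (pluecker (graded_part n m I)) f = 0})"

definition GL_stable_subset ::
  "'a::field set \<Rightarrow> nat \<Rightarrow> (pterm \<Rightarrow> pterm \<Rightarrow> bool) \<Rightarrow> rat poly \<Rightarrow> nat \<Rightarrow> 'a spoly set set \<Rightarrow> bool"
  where
  "GL_stable_subset K n prec p m Y \<longleftrightarrow>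
     Y \<noteq> {} \<and> zclosed K n prec p m Y
   \<and> (\<forall>Z1 Z2. zclosed K n prec p m Z1 \<longrightarrow> zclosed K n prec p m Z2 \<longrightarrow> Y \<subseteq> Z1 \<union> Z2
        \<longrightarrow> Y \<subseteq> Z1 \<or> Y \<subseteq> Z2)
   \<and> (\<forall>g\<in>GL K n. \<forall>I\<in>Y. gl_act n g ` I \<in> Y)"

section \<open>The double-generic initial ideal\<close>

definition gin ::
  "'a::field set \<Rightarrow> nat \<Rightarrow> (pterm \<Rightarrow> pterm \<Rightarrow> bool) \<Rightarrow> nat \<Rightarrow> nat \<Rightarrow> 'a spoly set set \<Rightarrow> pterm list"
  where
  "gin K n prec m q W =
     (let A = {L \<in> extensors n prec m q. U_open n m q L \<inter> GL_orbit K n W \<noteq> {}} in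
      THE L. L \<in> A \<and> (\<forall>M\<in>A. M = L \<or> extensor_less prec M L))"

text \<open>
  \<open>m\<close> is the degree of the embedding of \<open>hilb n p\<close> in the Grassmannian of \<open>S_m\<close>; mathematically
  the result does not depend on it for \<open>m\<close> at least the Gotzmann number.
\<close>

definition double_generic_initial_ideal ::
  "'a::field set \<Rightarrow> nat \<Rightarrow> (pterm \<Rightarrow> pterm \<Rightarrow> bool) \<Rightarrow> rat poly \<Rightarrow> nat \<Rightarrow> 'a spoly set set
    \<Rightarrow> 'a spoly set"
  where
  "double_generic_initial_ideal K n prec p m Y =
     saturation n (ideal_gen n (vs (gin K n prec m (hilb_q n p m) (graded_part n m ` Y))))"

definition strongly_prec ::
  "nat \<Rightarrow> (pterm \<Rightarrow> pterm \<Rightarrow> bool) \<Rightarrow> nat \<Rightarrow> nat \<Rightarrow> 'a::field spoly set \<Rightarrow> 'a spoly set \<Rightarrow> bool"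
  where
  "strongly_prec n prec m q V V' \<longleftrightarrow>
     (\<exists>A B \<omega>. A \<subseteq> terms_deg n m \<and> B \<subseteq> terms_deg n m
        \<and> finite A \<and> finite B \<and> card A = q \<and> card B = q
        \<and> V = mp_span (of_term ` A) \<and> V' = mp_span (of_term ` B)
        \<and> bij_betw \<omega> A B \<and> (\<forall>a\<in>A. a = \<omega> a \<or> prec a (\<omega> a)))"

end

theory Submission
  imports Defs "HOL-Library.Function_Algebras"
begin

text \<open>
  By irreducibility, \<open>Y\<close> contains a point \<open>I\<close> that lies in two given non-empty open subsets of \<open>Y\<close>: the
  one where the Pluecker coordinate of \<open>gin(Y)\<close> does not vanish, and a neighbourhood of \<open>J\<close> on which
  no non-zero element of \<open>I_m\<close> is supported on terms outside \<open>J_m\<close>. The first condition and the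
  maximality of \<open>gin(Y)\<close> make \<open>gin(Y)\<close> the extensor of the leading terms of \<open>I_d\<close>. The saturation of the
  initial ideal of \<open>I\<close> has Hilbert polynomial \<open>p\<close>, so by the definition of the Gotzmann number it
  is \<open>r\<close>-regular, it equals the double-generic initial ideal, and in degree \<open>m\<close> it is
  spanned by the leading terms of \<open>I_m\<close>. The second condition bounds, for each term \<open>\<tau>\<close>, the dimension of
  the space of elements of \<open>I_m\<close> with all terms below \<open>\<tau>\<close> by the number of terms of \<open>J_m\<close> below \<open>\<tau>\<close>;
  so there are at most as many leading terms of \<open>I_m\<close> below \<open>\<tau>\<close> as terms of \<open>J_m\<close>, and matching the
  terms in increasing order gives the bijection.
\<close>


text \<open>The maximality of \<open>gin(Y)\<close> is lexicographic and by itself compares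
  extensors only lexicographically, whereas the bijection needs a count below every term; this is
  why the second open set, around \<open>J\<close>, is required. Its condition lives in degree
  \<open>m\<close>, but the topology on \<open>Y\<close> is given by Pluecker coordinates in degree
  \<open>d\<close>, and \<open>m\<close> and \<open>d\<close> are only known to be at least
  \<open>r\<close>. Two different transports result. Upwards, \<open>J_m\<close> is generated by
  \<open>J_d\<close> because \<open>J\<close> is regular. Downwards nothing is generated, and the
  saturation of \<open>J\<close> together with the Pluecker relations of \<open>I_d\<close> takes
  over. In both cases the open set is the locus where a determinant does not vanish whose entries
  are 0 or Pluecker coordinates up to sign, and whose matrix at \<open>J\<close> is a non-zero
  multiple of the identity. Regularity enters through two consequences of the free resolution: the
  Hilbert function is the expected polynomial from \<open>r\<close> on, and from any degree
  \<open>t \<ge> r\<close> on the ideal is generated by its degree \<open>t\<close> part.\<close>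

abbreviation lk where "lk \<equiv> Poly_Mapping.lookup"
abbreviation ks where "ks \<equiv> Poly_Mapping.keys"

section \<open>Polynomials\<close>

lemma poly_mapping_sum_single:
  assumes "finite A" "ks f \<subseteq> A"
  shows "f = (\<Sum>t\<in>A. Poly_Mapping.single t (lk f t))"
proof (rule poly_mapping_eqI)
  fix k
  show "lk f k = lk (\<Sum>t\<in>A. Poly_Mapping.single t (lk f t)) k"
    using assms by (auto simp: lookup_sum lookup_single when_def in_keys_iff)
qed

lemma lookup_single_times:
  "lk (Poly_Mapping.single s c * f) (s + u) = c * lk f (u :: 'v expo)" for f :: "('v, 'a::comm_ring_1) mpoly"
proof -
  have "Poly_Mapping.single s c * f = (\<Sum>t\<in>ks f. Poly_Mapping.single (s + t) (c * lk f t))"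
    by (subst poly_mapping_sum_single[of "ks f" f]) (auto simp: sum_distrib_left mult_single)
  then show ?thesis
    by (simp add: lookup_sum lookup_single when_def in_keys_iff)
qed

lemma keys_single_times: "ks (Poly_Mapping.single s c * f) \<subseteq> (\<lambda>u. s + u) ` ks f"
  for f :: "('v, 'a::comm_ring_1) mpoly"
  using keys_mult[of "Poly_Mapping.single s c" f] by (auto split: if_splits)

lemma lookup_const_mult [simp]: "lk (const c * f) t = c * lk f t" for f :: "'a::comm_ring_1 spoly"
  using lookup_single_times[of 0 c f t] by (simp add: const_def)

lemma lookup_of_term: "lk (of_term t :: 'a::comm_ring_1 spoly) s = (if s = t then 1 else 0)"
  by (simp add: of_term_def lookup_single when_def)

lemma keys_of_term [simp]: "ks (of_term t :: 'a::field spoly) = {t}"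
  by (simp add: of_term_def)

lemma of_term_add: "of_term (s + t) = (of_term s * of_term t :: 'a::comm_ring_1 spoly)"
  by (simp add: of_term_def mult_single)

lemma lookup_of_term_times: "lk (of_term s * f) (s + u) = lk f u" for f :: "'a::comm_ring_1 spoly"
  by (simp add: of_term_def lookup_single_times)

lemma keys_of_term_times: "ks (of_term s * f) \<subseteq> (\<lambda>u. s + u) ` ks f" for f :: "'a::comm_ring_1 spoly"
  unfolding of_term_def by (rule keys_single_times)

lemma single_eq_const_of_term: "Poly_Mapping.single t c = const c * (of_term t :: 'a::comm_ring_1 spoly)"
  by (simp add: const_def of_term_def mult_single)

lemma subspace_keys: "mp_subspace {f :: 'a::field spoly. ks f \<subseteq> A}"
proof (rule mp.subspaceI)
  fix f g :: "'a spoly" assume "f \<in> {f. ks f \<subseteq> A}" "g \<in> {f. ks f \<subseteq> A}"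
  then show "f + g \<in> {f. ks f \<subseteq> A}" using keys_add[of f g] by auto
qed (auto simp: in_keys_iff)

lemma span_of_term: "mp_span (of_term ` A) = {f :: 'a::field spoly. ks f \<subseteq> A}"
proof
  show "mp_span (of_term ` A) \<subseteq> {f :: 'a::field spoly. ks f \<subseteq> A}"
    by (rule mp.span_minimal) (auto simp: subspace_keys)
  show "{f :: 'a::field spoly. ks f \<subseteq> A} \<subseteq> mp_span (of_term ` A)"
  proof
    fix f :: "'a spoly" assume "f \<in> {f. ks f \<subseteq> A}"
    then have "(\<Sum>t\<in>ks f. const (lk f t) * of_term t) \<in> mp_span (of_term ` A)"
      by (intro mp.span_sum mp.span_scale mp.span_base) auto
    then show "f \<in> mp_span (of_term ` A)"
      using poly_mapping_sum_single[of "ks f" f] by (simp add: single_eq_const_of_term)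
  qed
qed

lemma expo_deg_superset:
  assumes "finite A" "ks t \<subseteq> A"
  shows "expo_deg t = (\<Sum>i\<in>A. lk t i)"
  unfolding expo_deg_def using assms
  by (intro sum.mono_neutral_left) (auto simp: in_keys_iff)

lemma expo_deg_add [simp]: "expo_deg (s + t) = expo_deg s + expo_deg t"
proof -
  have "ks (s + t) \<subseteq> ks s \<union> ks t" by (rule keys_add)
  then show ?thesis
    by (simp add: expo_deg_superset[of "ks s \<union> ks t"] lookup_add sum.distrib)
qed

lemma expo_deg_zero [simp]: "expo_deg 0 = 0"
  by (simp add: expo_deg_def)

lemma expo_deg_single [simp]: "expo_deg (Poly_Mapping.single i k) = k"
  by (cases "k = 0") (simp_all add: expo_deg_def)

lemma terms_add [simp]: "s \<in> terms n \<Longrightarrow> t \<in> terms n \<Longrightarrow> s + t \<in> terms n"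
  using keys_add[of s t] by (auto simp: terms_def)

lemma keys_add_nat: "ks (s + t) = ks s \<union> ks (t :: 'v expo)"
  by (auto simp: in_keys_iff lookup_add)

lemma terms_add_iff: "s + t \<in> terms n \<longleftrightarrow> s \<in> terms n \<and> t \<in> terms n"
  by (simp add: terms_def keys_add_nat)

lemma terms_zero [simp]: "0 \<in> terms n"
  by (simp add: terms_def)

lemma terms_deg_subset: "terms_deg n m \<subseteq> terms n"
  by (auto simp: terms_deg_def)

lemma terms_deg_add: "s \<in> terms_deg n a \<Longrightarrow> t \<in> terms_deg n b \<Longrightarrow> s + t \<in> terms_deg n (a + b)"
  by (simp add: terms_deg_def)

lemma forms_alt: "forms n m = mp_span (of_term ` terms_deg n m)"
  by (simp add: span_of_term forms_def)

lemma subspace_forms: "mp_subspace (forms n m :: 'a::field spoly set)"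
  unfolding forms_def by (rule subspace_keys)

section \<open>Homogeneous components\<close>

lemma lookup_hom_comp: "lk (hom_comp m f) t = (if expo_deg t = m then lk f t else 0)"
  by (auto simp: hom_comp_def lookup_sum lookup_single when_def in_keys_iff)

lemma hom_comp_add: "hom_comp m (f + g) = hom_comp m f + hom_comp m g"
  by (rule poly_mapping_eqI) (simp add: lookup_hom_comp lookup_add)

lemma hom_comp_zero [simp]: "hom_comp m 0 = 0"
  by (rule poly_mapping_eqI) (simp add: lookup_hom_comp)

lemma hom_comp_sum: "hom_comp m (\<Sum>i\<in>A. f i) = (\<Sum>i\<in>A. hom_comp m (f i))"
  by (induction A rule: infinite_finite_induct) (simp_all add: hom_comp_add)

lemma keys_hom_comp: "ks (hom_comp m f) = {t \<in> ks f. expo_deg t = m}"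
  by (auto simp: in_keys_iff lookup_hom_comp split: if_splits)

lemma hom_comp_in_forms: "f \<in> polys n \<Longrightarrow> hom_comp m f \<in> forms n m"
  by (auto simp: polys_def forms_def terms_deg_def keys_hom_comp)

lemma hom_comp_form: "f \<in> forms n m \<Longrightarrow> hom_comp k f = (if k = m then f else 0)"
  by (rule poly_mapping_eqI) (force simp: lookup_hom_comp forms_def terms_deg_def in_keys_iff)

lemma sum_hom_comp:
  assumes "finite D" "expo_deg ` ks f \<subseteq> D"
  shows "f = (\<Sum>k\<in>D. hom_comp k f)"
proof (rule poly_mapping_eqI)
  fix t
  show "lk f t = lk (\<Sum>k\<in>D. hom_comp k f) t"
    using assms by (cases "t \<in> ks f") (auto simp: lookup_sum lookup_hom_comp in_keys_iff image_subset_iff)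
qed

lemma forms_subset_polys: "forms n m \<subseteq> polys n"
  by (auto simp: forms_def polys_def terms_deg_def)

lemma polys_add: "f \<in> polys n \<Longrightarrow> g \<in> polys n \<Longrightarrow> f + g \<in> polys n"
  using keys_add[of f g] by (auto simp: polys_def)

lemma polys_mult: "f \<in> polys n \<Longrightarrow> g \<in> polys n \<Longrightarrow> f * g \<in> polys n"
  using keys_mult[of f g] by (fastforce simp: polys_def)

lemma forms_mult: "f \<in> forms n a \<Longrightarrow> g \<in> forms n b \<Longrightarrow> f * g \<in> forms n (a + b)"
  using keys_mult[of f g] by (force simp: forms_def intro: terms_deg_add)

lemma forms_add: "f \<in> forms n a \<Longrightarrow> g \<in> forms n a \<Longrightarrow> f + g \<in> forms n a"
  using keys_add[of f g] by (auto simp: forms_def)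

lemma forms_zero [simp]: "0 \<in> forms n a"
  by (simp add: forms_def)

lemma polys_zero [simp]: "0 \<in> polys n"
  by (simp add: polys_def)

lemma forms_sum: "(\<And>i. i \<in> A \<Longrightarrow> f i \<in> forms n a) \<Longrightarrow> (\<Sum>i\<in>A. f i) \<in> forms n a"
  by (induction A rule: infinite_finite_induct) (auto intro: forms_add)

lemma polys_sum: "(\<And>i. i \<in> A \<Longrightarrow> f i \<in> polys n) \<Longrightarrow> (\<Sum>i\<in>A. f i) \<in> polys n"
  by (induction A rule: infinite_finite_induct) (auto intro: polys_add)

lemma polys_const [simp]: "const c \<in> polys n" 
  by (auto simp: const_def polys_def)

lemma polys_of_term: "t \<in> terms n \<Longrightarrow> (of_term t :: 'a::field spoly) \<in> polys n"
  by (simp add: polys_def)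

lemma hom_comp_form_times:
  fixes g :: "'a::comm_ring_1 spoly"
  assumes g: "g \<in> forms n e" and f: "f \<in> polys n"
  shows "hom_comp k (g * f) = (if e \<le> k then g * hom_comp (k - e) f else 0)"
proof -
  \<comment> \<open>The index \<open>k - e\<close> is inserted so that the final delta sum picks it
    up even when \<open>f\<close> has no term of that degree.\<close>
  let ?D = "insert (k - e) (expo_deg ` ks f)"
  have "g * f = g * (\<Sum>j\<in>?D. hom_comp j f)"
    by (subst sum_hom_comp[of ?D f]) auto
  then have "hom_comp k (g * f) = (\<Sum>j\<in>?D. hom_comp k (g * hom_comp j f))"
    by (simp only: sum_distrib_left hom_comp_sum)
  also have "\<dots> = (\<Sum>j\<in>?D. if e + j = k then g * hom_comp j f else 0)"
    by (intro sum.cong refl hom_comp_form[OF forms_mult[OF g hom_comp_in_forms[OF f]], THEN trans]) auto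
  also have "\<dots> = (\<Sum>j\<in>?D. if j = k - e \<and> e \<le> k then g * hom_comp j f else 0)"
    by (intro sum.cong refl) auto
  also have "\<dots> = (if e \<le> k then \<Sum>j\<in>?D. if j = k - e then g * hom_comp j f else 0 else 0)"
    by simp
  also have "\<dots> = (if e \<le> k then g * hom_comp (k - e) f else 0)"
    by (subst sum.delta) auto
  finally show ?thesis .
qed

text \<open>Exponent vectors are read as lists of length \<open>n + 1\<close>;
  \<open>Poly_Mapping.nth\<close>, which pads a list with zeros, is the inverse. Finiteness and the
  stars-and-bars count of terms thus become statements about lists.\<close>

lemma bij_betw_terms_deg:
  "bij_betw (\<lambda>t. map (lk t) [0..<n + 1]) (terms_deg n m) {l :: nat list. length l = n + 1 \<and> sum_list l = m}"
proof (rule bij_betwI[where g = Poly_Mapping.nth])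
  have deg: "expo_deg t = (\<Sum>i<n + 1. lk t i)" if "t \<in> terms n" for t
    by (rule expo_deg_superset) (use that in \<open>auto simp: terms_def\<close>)
  show "(\<lambda>t. map (lk t) [0..<n + 1]) \<in> terms_deg n m \<rightarrow> {l. length l = n + 1 \<and> sum_list l = m}"
    using deg by (auto simp: terms_deg_def interv_sum_list_conv_sum_set_nat atLeast0LessThan simp del: upt_Suc)
  show "Poly_Mapping.nth \<in> {l. length l = n + 1 \<and> sum_list l = m} \<rightarrow> terms_deg n m"
  proof
    fix l :: "nat list" assume l: "l \<in> {l. length l = n + 1 \<and> sum_list l = m}"
    then have t: "Poly_Mapping.nth l \<in> terms n"
      by (auto simp: terms_def in_keys_iff nth_default_def simp del: keys_nth split: if_splits)
    have "expo_deg (Poly_Mapping.nth l) = m"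
      unfolding deg[OF t] using l
      by (auto simp: sum_list_sum_nth atLeast0LessThan nth_default_def intro!: sum.cong)
    then show "Poly_Mapping.nth l \<in> terms_deg n m" using t by (simp add: terms_deg_def)
  qed
  show "Poly_Mapping.nth (map (lk t) [0..<n + 1]) = t" if "t \<in> terms_deg n m" for t
    by (rule poly_mapping_eqI)
      (use that in \<open>auto simp: nth_default_def terms_deg_def terms_def in_keys_iff subset_iff simp del: upt_Suc\<close>)
  show "map (lk (Poly_Mapping.nth l)) [0..<n + 1] = l" if "l \<in> {l. length l = n + 1 \<and> sum_list l = m}" for l
    by (rule nth_equalityI) (use that in \<open>auto simp: nth_default_def simp del: upt_Suc\<close>)
qed

lemma finite_terms_deg [simp]: "finite (terms_deg n m)"
proof -
  have "{l :: nat list. length l = n + 1 \<and> sum_list l = m} \<subseteq> {l. set l \<subseteq> {..m} \<and> length l = n + 1}"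
    using member_le_sum_list by auto
  then have "finite {l :: nat list. length l = n + 1 \<and> sum_list l = m}"
    by (rule finite_subset) (simp add: finite_lists_length_eq)
  then show ?thesis using bij_betw_finite[OF bij_betw_terms_deg] by blast
qed

lemma card_terms_deg: "card (terms_deg n m) = (n + m) choose n"
  using bij_betw_same_card[OF bij_betw_terms_deg, of n m] card_length_sum_list[of "n + 1" m]
    binomial_symmetric[of m "n + m"]
  by (simp add: add.commute)

text \<open>Variables are split off one at a time. This is the form in which
  \<open>S_(a+b) = S_a S_b\<close> is used, both for generation by a graded piece and for raising
  the exponent in a saturation.\<close>

lemma term_split:
  assumes "t \<in> terms_deg n (a + b)"
  obtains u v where "u \<in> terms_deg n a" "v \<in> terms_deg n b" "t = u + v"
  using assms
proof (induction a arbitrary: t thesis)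
  case 0
  show ?case by (rule "0.prems"(1)[of 0 t]) (use "0.prems"(2) in \<open>auto simp: terms_deg_def\<close>)
next
  case (Suc a)
  have "ks t \<noteq> {}"
  proof
    assume "ks t = {}"
    then have "expo_deg t = 0" by (simp add: expo_deg_def)
    with Suc.prems(2) show False by (simp add: terms_deg_def)
  qed
  then obtain i where i: "lk t i \<noteq> 0" by (meson all_not_in_conv in_keys_iff)
  define s where "s = t - Poly_Mapping.single i 1"
  have t: "t = Poly_Mapping.single i 1 + s"
    by (rule poly_mapping_eqI) (use i in \<open>auto simp: s_def lookup_add lookup_minus lookup_single when_def\<close>)
  have s: "s \<in> terms_deg n (a + b)" and i_le: "Poly_Mapping.single i (1::nat) \<in> terms_deg n 1"
    using Suc.prems(2) by (auto simp: t terms_deg_def terms_add_iff)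
  obtain u v where uv: "u \<in> terms_deg n a" "v \<in> terms_deg n b" "s = u + v"
    by (rule Suc.IH[OF _ s])
  show ?case
  proof (rule Suc.prems(1))
    show "Poly_Mapping.single i 1 + u \<in> terms_deg n (Suc a)"
      using terms_deg_add[OF i_le uv(1)] by simp
  qed (use uv t in \<open>simp_all add: add.assoc\<close>)
qed

section \<open>Dimensions\<close>

text \<open>The coordinates of \<open>x\<close> with respect to \<open>A \<union> B\<close> are its
  coordinates in \<open>A\<close> and also those in \<open>B\<close>, so they vanish outside each of
  two disjoint sets.\<close>

lemma (in vector_space) span_Int_of_independent:
  assumes "independent (A \<union> B)" "A \<inter> B = {}" "x \<in> span A" "x \<in> span B"
  shows "x = 0"
proof -
  have "representation (A \<union> B) x = representation A x" "representation (A \<union> B) x = representation B x"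
    using assms by (auto intro!: representation_extend)
  then have "representation (A \<union> B) x b = 0" for b
    using representation_ne_zero[of A x b] representation_ne_zero[of B x b] assms(2) by auto
  moreover have "x \<in> span (A \<union> B)"
    using assms(3) span_mono[of A "A \<union> B"] by auto
  ultimately show ?thesis
    using sum_nonzero_representation_eq[OF assms(1), of x] by simp
qed

text \<open>Rank-nullity on a subspace of a possibly infinite-dimensional space; \<open>T\<close>
  ensures that \<open>V\<close> has finite dimension. A basis of the kernel is extended to one of
  \<open>V\<close>, and \<open>f\<close> is injective on the span of the added vectors.\<close>

lemma (in vector_space_pair) dim_image_plus_dim_kernel:
  assumes f: "Vector_Spaces.linear s1 s2 f" and V: "vs1.subspace V" and fin: "finite T" "V \<subseteq> vs1.span T"
  shows "vs1.dim V = vs2.dim (f ` V) + vs1.dim {v \<in> V. f v = 0}"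
proof -
  interpret f: Vector_Spaces.linear s1 s2 f by (fact f)
  let ?K = "{v \<in> V. f v = 0}"
  obtain K where K: "K \<subseteq> ?K" "vs1.independent K" "?K \<subseteq> vs1.span K" "card K = vs1.dim ?K"
    by (rule vs1.basis_exists)
  obtain B where B: "K \<subseteq> B" "B \<subseteq> V" "vs1.independent B" "V \<subseteq> vs1.span B"
    using vs1.maximal_independent_subset_extend[of K V] K by blast
  have finB: "finite B"
    using vs1.independent_span_bound[OF fin(1) B(3)] B(2) fin(2) by auto
  have BK: "B - K \<subseteq> V" using B(2) by auto
  have spanBK: "vs1.span (B - K) \<subseteq> V" by (rule vs1.span_minimal[OF BK V])
  have inj: "inj_on f (vs1.span (B - K))"
    unfolding f.inj_on_iff_eq_0[OF vs1.subspace_span]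
  proof (intro ballI impI)
    fix x assume x: "x \<in> vs1.span (B - K)" "f x = 0"
    then have "x \<in> vs1.span K" using spanBK K(3) by auto
    then show "x = 0" by (rule vs1.span_Int_of_independent[rotated 2]) (use x B in \<open>auto simp: Un_absorb1\<close>)
  qed
  have "vs2.independent (f ` (B - K))"
    by (rule f.independent_injective_image) (use B(3) inj vs1.independent_mono in auto)
  moreover have "f ` V \<subseteq> vs2.span (f ` (B - K))"
  proof -
    have "f ` B \<subseteq> vs2.span (f ` (B - K))"
    proof
      fix y assume "y \<in> f ` B"
      then obtain b where b: "b \<in> B" "y = f b" by auto
      show "y \<in> vs2.span (f ` (B - K))"
      proof (cases "b \<in> K")
        case True
        then have "f b = 0" using K(1) by auto
        then show ?thesis using b vs2.span_zero by simp
      qed (use b in \<open>auto intro!: vs2.span_base\<close>)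
    qed
    moreover have "f ` V \<subseteq> vs2.span (f ` B)"
      using B(4) f.span_image[of B] by blast
    ultimately show ?thesis
      using vs2.span_minimal[OF _ vs2.subspace_span] by blast
  qed
  ultimately have "card (f ` (B - K)) = vs2.dim (f ` V)"
    using BK by (intro vs2.basis_card_eq_dim) auto
  moreover have "card (f ` (B - K)) = card (B - K)"
    using inj vs1.span_superset by (intro card_image inj_on_subset[OF inj]) auto
  moreover have "card B = vs1.dim V" by (rule vs1.basis_card_eq_dim) (use B in auto)
  moreover have "card (B - K) + card K = card B"
    using card_Diff_subset[of K B] card_mono[of B K] finite_subset[OF B(1) finB] B(1) finB by simp
  ultimately show ?thesis using K(4) by simp
qed

text \<open>Projection to the coordinates in \<open>X\<close> is injective on \<open>V\<close>.
  Finiteness belongs to the conclusion because an infinite set has \<open>card\<close> 0, so that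
  the bound alone would say nothing about it.\<close>

lemma card_independent_le_card_coordinates:
  fixes V :: "'a::field spoly set"
  assumes V: "mp_subspace V" and X: "finite X"
    and det: "\<And>f. f \<in> V \<Longrightarrow> \<forall>t\<in>X. lk f t = 0 \<Longrightarrow> f = 0"
    and B: "B \<subseteq> V" "\<not> mp_dependent B"
  shows "finite B \<and> card B \<le> card X"
proof -
  let ?s = "\<lambda>(c::'a) (f::'a spoly). const c * f"
  define \<pi> where "\<pi> f = (\<Sum>t\<in>X. Poly_Mapping.single t (lk f t))" for f :: "'a spoly"
  have lk\<pi>: "lk (\<pi> f) t = (if t \<in> X then lk f t else 0)" for f t
    using X by (simp add: \<pi>_def lookup_sum lookup_single when_def)
  interpret vp: vector_space_pair ?s ?s ..
  have lin: "Vector_Spaces.linear ?s ?s \<pi>"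
    unfolding Vector_Spaces.linear_iff using mp.vector_space_axioms
    by (auto intro!: poly_mapping_eqI simp: lk\<pi> lookup_add)
  interpret l: Vector_Spaces.linear ?s ?s \<pi> by (fact lin)
  have spanB: "mp_span B \<subseteq> V" by (rule mp.span_minimal[OF B(1) V])
  have inj: "inj_on \<pi> (mp_span B)"
    unfolding l.inj_on_iff_eq_0[OF mp.subspace_span[unfolded mp_subspace_def]]
  proof (intro ballI impI)
    fix f assume f: "f \<in> mp_span B" "\<pi> f = 0"
    have "lk f t = 0" if "t \<in> X" for t
      using arg_cong[OF f(2), of "\<lambda>g. lk g t"] that by (simp add: lk\<pi>)
    then show "f = 0" using det f(1) spanB by auto
  qed
  have "finite (\<pi> ` B) \<and> card (\<pi> ` B) \<le> card (of_term ` X :: 'a spoly set)"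
  proof (rule mp.independent_span_bound)
    show "\<pi> ` B \<subseteq> mp_span (of_term ` X)"
      by (auto simp: span_of_term in_keys_iff lk\<pi> split: if_splits)
    show "\<not> mp_dependent (\<pi> ` B)" using l.independent_injective_image B(2) inj unfolding mp_dependent_def mp_span_def by blast
  qed (use X in auto)
  moreover have "inj_on \<pi> B" using inj mp.span_superset by (rule inj_on_subset)
  moreover have "card (of_term ` X :: 'a spoly set) \<le> card X" using X by (rule card_image_le)
  ultimately show ?thesis using card_image[of \<pi> B] finite_image_iff[of \<pi> B] by auto
qed

lemma dim_le_card_coordinates:
  fixes V :: "'a::field spoly set"
  assumes V: "mp_subspace V" and X: "finite X"
    and det: "\<And>f. f \<in> V \<Longrightarrow> \<forall>t\<in>X. lk f t = 0 \<Longrightarrow> f = 0"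
  shows "mp_dim V \<le> card X"
proof -
  obtain B where "B \<subseteq> V" "\<not> mp_dependent B" "V \<subseteq> mp_span B" "card B = mp_dim V"
    by (rule mp.basis_exists)
  then show ?thesis using card_independent_le_card_coordinates[OF V X det] by metis
qed

lemma finite_basis_of_forms:
  fixes V :: "'a::field spoly set"
  assumes V: "mp_subspace V" and sub: "V \<subseteq> forms n m"
  obtains B where "B \<subseteq> V" "\<not> mp_dependent B" "mp_span B = V" "card B = mp_dim V" "finite B"
proof -
  obtain B where B: "B \<subseteq> V" "\<not> mp_dependent B" "V \<subseteq> mp_span B" "card B = mp_dim V"
    by (rule mp.basis_exists)
  have "finite B"
  proof (rule conjunct1[OF card_independent_le_card_coordinates[OF V finite_terms_deg[of n m] _ B(1,2)]])
    fix f assume "f \<in> V" "\<forall>t\<in>terms_deg n m. lk f t = 0"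
    then show "f = 0" using sub by (intro poly_mapping_eqI) (force simp: forms_def in_keys_iff)
  qed
  moreover have "mp_span B = V" using mp.span_minimal[OF B(1) V] B(3) by auto
  ultimately show ?thesis using B that by auto
qed

lemma inj_of_term: "inj (of_term :: _ \<Rightarrow> 'a::field spoly)"
  by (rule injI) (metis keys_of_term singleton_inject)

lemma not_dependent_of_term: "\<not> mp_dependent (of_term ` A :: 'a::field spoly set)"
  unfolding mp.independent_explicit_module
proof (intro allI impI)
  fix T :: "'a spoly set" and u f
  assume T: "finite T" "T \<subseteq> of_term ` A" and z: "(\<Sum>v\<in>T. const (u v) * v) = 0" and f: "f \<in> T"
  obtain t where t: "f = of_term t" using f T by auto
  have "0 = lk (\<Sum>v\<in>T. const (u v) * v) t" using z by simp
  also have "\<dots> = (\<Sum>v\<in>T. if v = f then u v else 0)"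
    unfolding lookup_sum
  proof (intro sum.cong refl)
    fix v assume "v \<in> T"
    then obtain s where v: "v = of_term s" using T(2) by auto
    show "lk (const (u v) * v) t = (if v = f then u v else 0)"
      using inj_of_term[where 'a = 'a] by (auto simp: v t lookup_of_term inj_eq)
  qed
  also have "\<dots> = u f" using T f by simp
  finally show "u f = 0" by simp
qed

lemma dim_span_of_term: "mp_dim (mp_span (of_term ` A) :: 'a::field spoly set) = card A"
  using mp.dim_span_eq_card_independent[OF not_dependent_of_term[where 'a = 'a], of A]
    card_image[OF inj_on_subset[OF inj_of_term[where 'a = 'a], of A]] by simp

lemma dim_forms: "mp_dim (forms n m :: 'a::field spoly set) = (n + m) choose n"
  unfolding forms_alt dim_span_of_term card_terms_deg ..

section \<open>Graded free modules\<close>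

text \<open>Elements of free modules are functions on \<open>nat\<close> here: this type has one
  zero and one addition and can carry \<open>vector_space\<close>, whereas the vectors in
  \<open>min_free_resolution\<close> have a separate zero for each length.\<close>

definition fscale :: "'a::field \<Rightarrow> (nat \<Rightarrow> 'a spoly) \<Rightarrow> nat \<Rightarrow> 'a spoly" where
  "fscale c v = (\<lambda>j. const c * v j)"

global_interpretation fv: vector_space fscale
  by unfold_locales
    (auto simp: fscale_def fun_eq_iff distrib_left mp.scale_left_distrib)

global_interpretation fv_mp: vector_space_pair fscale "\<lambda>(c::'a::field) (f::'a spoly). const c * f" ..

global_interpretation fv_fv: vector_space_pair fscale fscale ..

lemma fsum_apply: "(\<Sum>i\<in>A. f i) x = (\<Sum>i\<in>A. f i (x :: nat) :: 'a::comm_monoid_add)"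
  by (induction A rule: infinite_finite_induct) auto

text \<open>The degree \<open>t\<close> part of the direct sum of the \<open>S(- e j)\<close> with
  \<open>j < c\<close>. The test \<open>e j \<le> t\<close> guards the truncated subtraction;
  coordinates from \<open>c\<close> on are fixed to 0, which makes the representing function
  unique.\<close>

definition graded_free :: "nat \<Rightarrow> nat \<Rightarrow> (nat \<Rightarrow> nat) \<Rightarrow> nat \<Rightarrow> (nat \<Rightarrow> 'a::field spoly) set" where
  "graded_free n c e t = {v. \<forall>j. v j \<in> (if j < c \<and> e j \<le> t then forms n (t - e j) else {0})}"

lemma graded_freeD:
  assumes "v \<in> graded_free n c e t"
  shows "j < c \<Longrightarrow> e j \<le> t \<Longrightarrow> v j \<in> forms n (t - e j)" and "\<not> (j < c \<and> e j \<le> t) \<Longrightarrow> v j = 0"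
  using assms[unfolded graded_free_def mem_Collect_eq, THEN spec, of j] by auto

lemma subspace_graded_free: "fv.subspace (graded_free n c e t)"
proof (rule fv.subspaceI)
  fix v w :: "nat \<Rightarrow> 'a spoly" assume "v \<in> graded_free n c e t" "w \<in> graded_free n c e t"
  then show "v + w \<in> graded_free n c e t"
    by (fastforce simp: graded_free_def intro: forms_add split: if_splits)
next
  fix a and v :: "nat \<Rightarrow> 'a spoly" assume "v \<in> graded_free n c e t"
  then show "fscale a v \<in> graded_free n c e t"
    using mp.subspace_scale[OF subspace_forms]
    by (fastforce simp: graded_free_def fscale_def split: if_splits)
qed (auto simp: graded_free_def)

lemma finite_span_graded_free:
  obtains T where "finite T" "graded_free n c e t \<subseteq> fv.span T"
proof -
  define b where "b j u = (\<lambda>k. if k = j then of_term u else 0 :: 'a spoly)" for j :: nat and u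
  define T where "T = (\<Union>j<c. b j ` terms_deg n (t - e j))"
  show ?thesis
  proof (rule that[of T])
    show "graded_free n c e t \<subseteq> fv.span T"
    proof
      fix v :: "nat \<Rightarrow> 'a spoly" assume v: "v \<in> graded_free n c e t"
      let ?w = "\<Sum>j<c. \<Sum>u\<in>terms_deg n (t - e j). fscale (lk (v j) u) (b j u)"
      have "?w \<in> fv.span T"
        by (intro fv.span_sum fv.span_scale fv.span_base) (auto simp: T_def)
      moreover have "v = ?w"
      proof
        fix k
        have "?w k = (\<Sum>j<c. if j = k then \<Sum>u\<in>terms_deg n (t - e j). const (lk (v j) u) * of_term u else 0)"
          unfolding fsum_apply by (intro sum.cong refl) (auto simp: fscale_def b_def)
        also have "\<dots> = (if k < c then \<Sum>u\<in>terms_deg n (t - e k). Poly_Mapping.single u (lk (v k) u) else 0)"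
          by (simp add: single_eq_const_of_term)
        also have "\<dots> = v k"
        proof (cases "k < c \<and> e k \<le> t")
          case True
          then have "v k \<in> forms n (t - e k)" using graded_freeD(1)[OF v] by auto
          then show ?thesis
            using poly_mapping_sum_single[of "terms_deg n (t - e k)" "v k"] True by (simp add: forms_def)
        next
          case False
          then have "v k = 0" by (rule graded_freeD(2)[OF v])
          then show ?thesis by simp
        qed
        finally show "v k = ?w k" by simp
      qed
      ultimately show "v \<in> fv.span T" by simp
    qed
  qed (auto simp: T_def)
qed

text \<open>Induction on the number of summands, with rank-nullity for the last coordinate.\<close>

lemma dim_graded_free:
  "fv.dim (graded_free n c e t :: (nat \<Rightarrow> 'a::field spoly) set)
    = (\<Sum>j<c. if e j \<le> t then (n + (t - e j)) choose n else 0)"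
proof (induction c)
  case 0
  have "(graded_free n 0 e t :: (nat \<Rightarrow> 'a spoly) set) = fv.span {}"
    by (auto simp: graded_free_def fun_eq_iff)
  then show ?case using fv.dim_span_eq_card_independent[OF fv.independent_empty] by simp
next
  case (Suc c)
  let ?V = "graded_free n (Suc c) e t :: (nat \<Rightarrow> 'a spoly) set"
  let ?f = "\<lambda>v :: nat \<Rightarrow> 'a spoly. v c"
  let ?W = "if e c \<le> t then forms n (t - e c) else {0 :: 'a spoly}"
  obtain T where T: "finite T" "?V \<subseteq> fv.span T" by (rule finite_span_graded_free)
  have lin: "Vector_Spaces.linear fscale (\<lambda>(c::'a) (f::'a spoly). const c * f) ?f"
    unfolding Vector_Spaces.linear_iff using fv.vector_space_axioms mp.vector_space_axioms
    by (auto simp: fscale_def)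
  have im: "?f ` ?V = ?W"
  proof
    show "?W \<subseteq> ?f ` ?V"
    proof
      fix g assume g: "g \<in> ?W"
      have "(\<lambda>j. if j = c then g else 0) \<in> ?V" using g by (auto simp: graded_free_def)
      then show "g \<in> ?f ` ?V" by (rule rev_image_eqI) simp
    qed
  qed (auto simp: graded_free_def split: if_splits)
  have ker: "{v \<in> ?V. ?f v = 0} = graded_free n c e t"
    by (auto simp: graded_free_def less_Suc_eq)
  have "mp_dim ?W = (if e c \<le> t then (n + (t - e c)) choose n else 0)"
    using dim_forms[where 'a = 'a] mp.dim_eq_card[of "{}" "{0}"] mp.independent_empty by auto
  then show ?case
    using fv_mp.dim_image_plus_dim_kernel[OF lin subspace_graded_free T] Suc im ker by simp
qed

section \<open>Homogeneous matrices and their degree parts\<close>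

definition mat_act :: "'a::comm_ring_1 spoly mat \<Rightarrow> (nat \<Rightarrow> 'a spoly) \<Rightarrow> nat \<Rightarrow> 'a spoly" where
  "mat_act D v = (\<lambda>k. if k < dim_row D then \<Sum>j<dim_col D. D $$ (k, j) * v j else 0)"

lemma linear_mat_act: "Vector_Spaces.linear fscale fscale (mat_act D)"
  unfolding Vector_Spaces.linear_iff using fv.vector_space_axioms
  by (auto simp: mat_act_def fscale_def fun_eq_iff sum.distrib distrib_left sum_distrib_left
      mult.left_commute)

lemma mult_mat_vec_eq_mat_act:
  assumes "D \<in> carrier_mat r c"
  shows "D *\<^sub>v vec c v = vec r (mat_act D v)"
  using assms by (intro eq_vecI) (auto simp: mat_act_def scalar_prod_def atLeast0LessThan)

definition degree_part :: "nat \<Rightarrow> (nat \<Rightarrow> nat) \<Rightarrow> nat \<Rightarrow> (nat \<Rightarrow> 'a::comm_ring_1 spoly) \<Rightarrow> nat \<Rightarrow> 'a spoly" where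
  "degree_part c e t v = (\<lambda>j. if j < c \<and> e j \<le> t then hom_comp (t - e j) (v j) else 0)"

lemma degree_part_in_graded_free: "(\<And>j. j < c \<Longrightarrow> v j \<in> polys n) \<Longrightarrow> degree_part c e t v \<in> graded_free n c e t"
  by (auto simp: degree_part_def graded_free_def intro: hom_comp_in_forms)

lemma degree_part_graded_free: "v \<in> graded_free n c e t \<Longrightarrow> degree_part c e t v = v"
  by (rule ext) (auto simp: degree_part_def dest: graded_freeD intro: hom_comp_form[THEN trans])

definition graded_mat :: "nat \<Rightarrow> nat \<Rightarrow> nat \<Rightarrow> (nat \<Rightarrow> nat) \<Rightarrow> (nat \<Rightarrow> nat) \<Rightarrow> 'a::comm_ring_1 spoly mat \<Rightarrow> bool" where
  "graded_mat n r c a e D \<longleftrightarrow> D \<in> carrier_mat r c \<and>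
     (\<forall>k<r. \<forall>j<c. if a k \<le> e j then D $$ (k, j) \<in> forms n (e j - a k) else D $$ (k, j) = 0)"

text \<open>Homogeneity of the entries makes the matrix commute with the projection to degree
  \<open>t\<close>. This is what carries exactness of the whole resolution over to each single
  degree.\<close>

lemma mat_act_degree_part:
  assumes D: "graded_mat n r c a e D" and v: "\<And>j. j < c \<Longrightarrow> v j \<in> polys n"
  shows "mat_act D (degree_part c e t v) = degree_part r a t (mat_act D v)"
proof
  fix k
  have dims: "dim_row D = r" "dim_col D = c" using D by (auto simp: graded_mat_def)
  show "mat_act D (degree_part c e t v) k = degree_part r a t (mat_act D v) k"
  proof (cases "k < r")
    case True
    have *: "D $$ (k, j) * degree_part c e t v j
        = (if a k \<le> t then hom_comp (t - a k) (D $$ (k, j) * v j) else 0)" if j: "j < c" for j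
    proof (cases "a k \<le> e j")
      case le: True
      then have "D $$ (k, j) \<in> forms n (e j - a k)" using D True j by (auto simp: graded_mat_def)
      from hom_comp_form_times[OF this v[OF j], of "t - a k"] show ?thesis
        using le j by (auto simp: degree_part_def)
    next
      case False
      then have "D $$ (k, j) = 0" using D True j by (auto simp: graded_mat_def)
      then show ?thesis by simp
    qed
    have "mat_act D (degree_part c e t v) k = (\<Sum>j<c. D $$ (k, j) * degree_part c e t v j)"
      using True by (simp add: mat_act_def dims)
    also have "\<dots> = (\<Sum>j<c. if a k \<le> t then hom_comp (t - a k) (D $$ (k, j) * v j) else 0)"
      using * by (intro sum.cong) auto
    also have "\<dots> = degree_part r a t (mat_act D v) k"
      using True by (simp add: degree_part_def mat_act_def dims hom_comp_sum)
    finally show ?thesis .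
  qed (simp add: mat_act_def degree_part_def dims)
qed

lemma mat_act_graded_free:
  assumes D: "graded_mat n r c a e D" and v: "v \<in> graded_free n c e t"
  shows "mat_act D v \<in> graded_free n r a t"
proof -
  have pv: "v j \<in> polys n" for j
    using v forms_subset_polys by (fastforce simp: graded_free_def split: if_splits)
  have "mat_act D v j \<in> polys n" if "j < r" for j
  proof -
    have "D $$ (j, k) \<in> polys n" if "k < c" for k
      using D that \<open>j < r\<close> forms_subset_polys polys_zero unfolding graded_mat_def by (metis subsetD)
    then show ?thesis using D pv by (auto simp: mat_act_def graded_mat_def intro!: polys_sum polys_mult)
  qed
  then have "degree_part r a t (mat_act D v) \<in> graded_free n r a t" by (rule degree_part_in_graded_free)
  then show ?thesis
    using mat_act_degree_part[OF D, of v t, OF pv] degree_part_graded_free[OF v] by simp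
qed

section \<open>Hilbert functions of regular ideals\<close>

context
  fixes n :: nat and I :: "'a::field spoly set" and c :: "nat \<Rightarrow> nat" and e :: "nat \<Rightarrow> nat \<Rightarrow> nat"
    and D :: "nat \<Rightarrow> 'a spoly mat"
  assumes resolution: "min_free_resolution n I c e D"
begin

lemmas resolution_conjs = resolution[unfolded min_free_resolution_def]

lemmas D0 = resolution_conjs[THEN conjunct1] resolution_conjs[THEN conjunct2, THEN conjunct1, rule_format]

lemmas D_Suc = resolution_conjs[THEN conjunct2, THEN conjunct2, THEN conjunct1, rule_format]
  resolution_conjs[THEN conjunct2, THEN conjunct2, THEN conjunct2, THEN conjunct1, rule_format, THEN conjunct1]

lemmas image_D = resolution_conjs[THEN conjunct2, THEN conjunct2, THEN conjunct2, THEN conjunct2]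

lemmas image_D0 = image_D[THEN conjunct1]

lemmas image_D_Suc = image_D[THEN conjunct2, THEN conjunct1, rule_format]

lemmas c_eq_0 = image_D[THEN conjunct2, THEN conjunct2, rule_format]

lemma graded_mat_D0: "graded_mat n 1 (c 0) (\<lambda>_. 0) (e 0) (D 0)"
  using D0 by (auto simp: graded_mat_def)

lemma graded_mat_D_Suc: "graded_mat n (c i) (c (Suc i)) (e i) (e (Suc i)) (D (Suc i))"
  unfolding graded_mat_def using D_Suc by blast

text \<open>Lets all \<open>D i\<close> be treated alike; \<open>i = 0\<close> is special because
  its target is \<open>S\<close>, with shift 0.\<close>

lemma graded_mat_D: "graded_mat n (dim_row (D i)) (c i) (if i = 0 then \<lambda>_. 0 else e (i - 1)) (e i) (D i)"
proof (cases i)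
  case 0
  then show ?thesis using graded_mat_D0 D0(1) by (metis carrier_matD(1))
next
  case (Suc k)
  have "dim_row (D (Suc k)) = c k" using graded_mat_D_Suc[of k] by (auto simp: graded_mat_def)
  then show ?thesis using graded_mat_D_Suc[of k] Suc by simp
qed

lemma D_carrier: "D i \<in> carrier_mat (dim_row (D i)) (c i)"
  using graded_mat_D by (auto simp: graded_mat_def)

lemma graded_free_polys: "v \<in> graded_free n k a t \<Longrightarrow> v j \<in> polys n"
  using forms_subset_polys graded_freeD[of v n k a t j] polys_zero by (cases "j < k \<and> a j \<le> t") auto

lemma vec_in_free_module: "v \<in> graded_free n k a t \<Longrightarrow> vec k v \<in> free_module n k"
  using graded_free_polys[of v k a t] by (simp add: free_module_def)

lemma vec_eq_on: "vec k v = vec k w \<longleftrightarrow> (\<forall>j<k. v j = w j)"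
  by (auto simp: vec_eq_iff)

text \<open>Exactness provides a lift of \<open>w\<close> through \<open>D (Suc i)\<close> in no
  particular degree. Its degree \<open>t\<close> part is again a lift, since \<open>w\<close> is its
  own degree \<open>t\<close> part.\<close>

lemma exact_degree_part:
  "{w \<in> graded_free n (c i) (e i) t. mat_act (D i) w = 0}
    = mat_act (D (Suc i)) ` graded_free n (c (Suc i)) (e (Suc i)) t" (is "?L = ?R")
proof
  note G = graded_mat_D_Suc[of i]
  have dims: "dim_row (D (Suc i)) = c i" "dim_col (D (Suc i)) = c (Suc i)"
    using G by (auto simp: graded_mat_def)
  have carr: "D (Suc i) \<in> carrier_mat (c i) (c (Suc i))" using dims by auto
  show "?R \<subseteq> ?L"
  proof
    fix w assume "w \<in> ?R"
    then obtain v where v: "v \<in> graded_free n (c (Suc i)) (e (Suc i)) t" "w = mat_act (D (Suc i)) v" by auto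
    have "vec (c i) w = D (Suc i) *\<^sub>v vec (c (Suc i)) v"
      unfolding v(2) by (rule mult_mat_vec_eq_mat_act[OF carr, symmetric])
    moreover have "D (Suc i) *\<^sub>v vec (c (Suc i)) v
        \<in> {w \<in> free_module n (c i). D i *\<^sub>v w = 0\<^sub>v (dim_row (D i))}"
      unfolding image_D_Suc[symmetric] using vec_in_free_module[OF v(1)] by (rule imageI)
    ultimately have "D i *\<^sub>v vec (c i) w = 0\<^sub>v (dim_row (D i))" by simp
    then have "vec (dim_row (D i)) (mat_act (D i) w) = 0\<^sub>v (dim_row (D i))"
      by (simp only: mult_mat_vec_eq_mat_act[OF D_carrier])
    then have "mat_act (D i) w k = 0" for k
      by (cases "k < dim_row (D i)") (metis index_vec index_zero_vec(1), simp add: mat_act_def)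
    then have "mat_act (D i) w = 0" by (intro ext) simp
    then show "w \<in> ?L" using mat_act_graded_free[OF G v(1)] v(2) by simp
  qed
  show "?L \<subseteq> ?R"
  proof
    fix w assume w: "w \<in> ?L"
    then have "mat_act (D i) w = 0" and wf: "w \<in> graded_free n (c i) (e i) t" by auto
    then have "D i *\<^sub>v vec (c i) w = 0\<^sub>v (dim_row (D i))"
      unfolding mult_mat_vec_eq_mat_act[OF D_carrier] by (intro eq_vecI) simp_all
    then have "vec (c i) w \<in> (\<lambda>v. D (Suc i) *\<^sub>v v) ` free_module n (c (Suc i))"
      unfolding image_D_Suc using vec_in_free_module[OF wf] by simp
    then obtain u where u: "u \<in> free_module n (c (Suc i))" "vec (c i) w = D (Suc i) *\<^sub>v u"
      by (rule imageE)
    define v where "v j = (if j < c (Suc i) then u $ j else 0)" for j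
    have uv: "u = vec (c (Suc i)) v" and pv: "v j \<in> polys n" for j
      using u(1) by (auto simp: free_module_def v_def)
    have vec_w: "vec (c i) w = vec (c i) (mat_act (D (Suc i)) v)"
      unfolding u(2) uv by (rule mult_mat_vec_eq_mat_act[OF carr])
    have "w = mat_act (D (Suc i)) v"
    proof
      fix k
      show "w k = mat_act (D (Suc i)) v k"
      proof (cases "k < c i")
        case True
        then show ?thesis using vec_w by (metis index_vec)
      next
        case False
        then have "w k = 0" by (intro graded_freeD(2)[OF wf]) simp
        then show ?thesis using False by (simp add: mat_act_def dims)
      qed
    qed
    then have "w = degree_part (c i) (e i) t (mat_act (D (Suc i)) v)"
      using degree_part_graded_free[OF wf] by simp
    also have "\<dots> = mat_act (D (Suc i)) (degree_part (c (Suc i)) (e (Suc i)) t v)"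
      by (rule mat_act_degree_part[OF G pv, symmetric])
    finally show "w \<in> ?R" using degree_part_in_graded_free[of "c (Suc i)" v n, OF pv] by blast
  qed
qed

lemma image_D0_degree_part:
  "(\<lambda>v. mat_act (D 0) v 0) ` graded_free n (c 0) (e 0) t = graded_part n t I" (is "?L = ?R")
proof
  note G = graded_mat_D0
  have dims: "dim_row (D 0) = 1" "dim_col (D 0) = c 0" using D0 by auto
  have eq: "D 0 *\<^sub>v vec (c 0) v = vec 1 (\<lambda>_. mat_act (D 0) v 0)" for v
    by (subst mult_mat_vec_eq_mat_act[OF D0(1)]) (auto simp: vec_eq_on)
  show "?L \<subseteq> ?R"
  proof
    fix f assume "f \<in> ?L"
    then obtain v where v: "v \<in> graded_free n (c 0) (e 0) t" "f = mat_act (D 0) v 0" by auto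
    have "vec 1 (\<lambda>_. f) \<in> (\<lambda>f. vec 1 (\<lambda>_. f)) ` I"
      unfolding image_D0[symmetric] v(2) eq[symmetric] using vec_in_free_module[OF v(1)] by (rule imageI)
    then obtain g where "g \<in> I" "vec 1 (\<lambda>_. f) = vec 1 (\<lambda>_. g)" by (rule imageE)
    then have "f \<in> I" unfolding vec_eq_on by simp
    moreover have "f \<in> forms n t"
      using graded_freeD(1)[OF mat_act_graded_free[OF G v(1)], of 0] v(2) by simp
    ultimately show "f \<in> ?R" by (simp add: graded_part_def)
  qed
  show "?R \<subseteq> ?L"
  proof
    fix f assume f: "f \<in> ?R"
    then have "vec 1 (\<lambda>_. f) \<in> (\<lambda>v. D 0 *\<^sub>v v) ` free_module n (c 0)"
      unfolding image_D0 graded_part_def by blast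
    then obtain u where u: "u \<in> free_module n (c 0)" "vec 1 (\<lambda>_. f) = D 0 *\<^sub>v u" by (rule imageE)
    define v where "v j = (if j < c 0 then u $ j else 0)" for j
    have uv: "u = vec (c 0) v" and pv: "v j \<in> polys n" for j
      using u(1) by (auto simp: free_module_def v_def)
    have "vec 1 (\<lambda>_. f) = vec 1 (\<lambda>_. mat_act (D 0) v 0)" unfolding u(2) uv by (rule eq)
    then have f': "f = mat_act (D 0) v 0" unfolding vec_eq_on by simp
    have "f = degree_part 1 (\<lambda>_. 0) t (mat_act (D 0) v) 0"
      using f hom_comp_form[of f n t t] by (simp add: degree_part_def graded_part_def flip: f')
    also have "\<dots> = mat_act (D 0) (degree_part (c 0) (e 0) t v) 0"
      using mat_act_degree_part[OF G pv] by simp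
    finally show "f \<in> ?L" using degree_part_in_graded_free[of "c 0" v n, OF pv] by blast
  qed
qed

text \<open>The dimension in degree \<open>t\<close> of the \<open>i\<close>-th syzygy module, the
  image of \<open>D i\<close>; for \<open>i = 0\<close> this module is \<open>I\<close>.\<close>

abbreviation syzygy_dim :: "nat \<Rightarrow> nat \<Rightarrow> nat" where
  "syzygy_dim i t \<equiv> fv.dim (mat_act (D i) ` graded_free n (c i) (e i) t)"

lemma syzygy_dim_Suc:
  "fv.dim (graded_free n (c i) (e i) t :: (nat \<Rightarrow> 'a spoly) set) = syzygy_dim i t + syzygy_dim (Suc i) t"
proof -
  obtain T where "finite T" "(graded_free n (c i) (e i) t :: (nat \<Rightarrow> 'a spoly) set) \<subseteq> fv.span T"
    by (rule finite_span_graded_free)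
  from fv_fv.dim_image_plus_dim_kernel[OF linear_mat_act[of "D i"] subspace_graded_free this]
  show ?thesis unfolding exact_degree_part .
qed

text \<open>\<open>D 0\<close> has one row, so its only coordinate has the same kernel as
  \<open>D 0\<close>, and by rank-nullity both images have the same dimension.\<close>

lemma dim_graded_part_eq: "mp_dim (graded_part n t I) = syzygy_dim 0 t"
proof -
  obtain T where T: "finite T" "(graded_free n (c 0) (e 0) t :: (nat \<Rightarrow> 'a spoly) set) \<subseteq> fv.span T"
    by (rule finite_span_graded_free)
  let ?f = "\<lambda>v. mat_act (D 0) v 0"
  have lin: "Vector_Spaces.linear fscale (\<lambda>(c::'a) (f::'a spoly). const c * f) ?f"
    using linear_mat_act[of "D 0"] mp.vector_space_axioms
    unfolding Vector_Spaces.linear_iff by (auto simp: fscale_def)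
  have "?f v = 0 \<longleftrightarrow> mat_act (D 0) v = 0" for v
    using D0(1) by (auto simp: mat_act_def fun_eq_iff)
  then show ?thesis
    using fv_mp.dim_image_plus_dim_kernel[OF lin subspace_graded_free T] syzygy_dim_Suc[of 0 t]
    unfolding image_D0_degree_part by (simp add: exact_degree_part)
qed

lemma syzygy_dim_eq_0: "n < i \<Longrightarrow> syzygy_dim i t = 0"
  using syzygy_dim_Suc[of i t] dim_graded_free[where 'a = 'a, of n "c i" "e i" t] by (simp add: c_eq_0)

end

text \<open>The polynomial is \<open>(t-a+1)...(t-a+n)/n!\<close>. Its roots
  \<open>a - n, ..., a - 1\<close> reproduce the value 0 below \<open>a\<close>, so the identity
  already starts at \<open>t = a - n\<close>. \<open>regular_hilbert_function_poly\<close> depends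
  on this slack of \<open>n\<close>.\<close>

lemma poly_binomial:
  obtains P :: "rat poly"
  where "\<And>t. a \<le> t + n \<Longrightarrow> poly P (of_nat t) = of_nat (if a \<le> t then (n + (t - a)) choose n else 0)"
proof
  define P :: "rat poly" where "P = smult (1 / fact n) (\<Prod>i\<in>{1..n}. [:of_nat i - of_nat a, 1:])"
  fix t assume t: "a \<le> t + n"
  have P: "poly P (of_nat t) = (\<Prod>i\<in>{1..n}. of_nat i - of_nat a + of_nat t) / fact n"
    by (simp add: P_def poly_prod)
  show "poly P (of_nat t) = of_nat (if a \<le> t then (n + (t - a)) choose n else 0)"
  proof (cases "a \<le> t")
    case True
    define s where "s = t - a"
    have "fact s * (\<Prod>i\<in>{1..n}. of_nat i - of_nat a + of_nat t :: rat) = fact s * (\<Prod>i\<in>{1..n}. of_nat (s + i))"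
      using True by (intro arg_cong[where f = "\<lambda>x. fact s * x"] prod.cong refl) (auto simp: s_def of_nat_diff)
    also have "\<dots> = fact (s + n)"
    proof (induction n)
      case (Suc n)
      have "fact s * (\<Prod>i\<in>{1..Suc n}. of_nat (s + i) :: rat)
          = (fact s * (\<Prod>i\<in>{1..n}. of_nat (s + i))) * of_nat (s + Suc n)"
        by (simp add: mult_ac)
      then show ?case unfolding Suc by (simp add: mult.commute)
    qed simp
    also have "\<dots> = fact s * (fact n * of_nat ((n + s) choose n))"
      using binomial_fact[of n "n + s", where 'a = rat] by (simp add: add.commute field_simps)
    finally have "(\<Prod>i\<in>{1..n}. of_nat i - of_nat a + of_nat t :: rat) = fact n * of_nat ((n + s) choose n)"
      by (rule mult_left_cancel[THEN iffD1, rotated]) simp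
    then show ?thesis using True unfolding P by (simp add: s_def)
  next
    case False
    then have "a - t \<in> {1..n}" "(of_nat (a - t) - of_nat a + of_nat t :: rat) = 0"
      using t by (auto simp: of_nat_diff)
    then have "(\<Prod>i\<in>{1..n}. of_nat i - of_nat a + of_nat t :: rat) = 0"
      by (intro prod_zero) auto
    then show ?thesis using False P by simp
  qed
qed

text \<open>The Hilbert function is the alternating sum of those of the free modules. A shift in
  step \<open>i \<le> n\<close> is at most \<open>r + i \<le> r + n\<close>, so every summand is
  polynomial from \<open>t = r\<close> on.\<close>

lemma regular_hilbert_function_poly:
  fixes I :: "'a::field spoly set"
  assumes "regular n r I"
  obtains P :: "rat poly" where "\<And>t. r \<le> t \<Longrightarrow> of_nat (mp_dim (graded_part n t I)) = poly P (of_nat t)"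
proof -
  obtain c e D where R: "min_free_resolution n I c e D" and reg: "\<And>i j. j < c i \<Longrightarrow> e i j \<le> r + i"
    using assms unfolding regular_def by blast
  let ?Z = "\<lambda>i t. fv.dim (mat_act (D i) ` graded_free n (c i) (e i) t)"
  have free: "\<exists>P :: rat poly. \<forall>t\<ge>r. of_nat (fv.dim (graded_free n (c i) (e i) t :: (nat \<Rightarrow> 'a spoly) set))
      = poly P (of_nat t)" if i: "i \<le> n" for i
  proof -
    have "\<exists>P :: rat poly. \<forall>t\<ge>r. of_nat (if e i j \<le> t then (n + (t - e i j)) choose n else 0)
      = poly P (of_nat t)" if "j < c i" for j
    proof -
      obtain P :: "rat poly" where
        "\<And>t. e i j \<le> t + n \<Longrightarrow> poly P (of_nat t) = of_nat (if e i j \<le> t then (n + (t - e i j)) choose n else 0)"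
        using poly_binomial by blast
      moreover have "e i j \<le> t + n" if "r \<le> t" for t using reg[OF \<open>j < c i\<close>] i that by simp
      ultimately show ?thesis by metis
    qed
    then obtain P :: "nat \<Rightarrow> rat poly" where
      P: "\<And>j t. j < c i \<Longrightarrow> r \<le> t \<Longrightarrow>
        of_nat (if e i j \<le> t then (n + (t - e i j)) choose n else 0) = poly (P j) (of_nat t)"
      by metis
    have "of_nat (fv.dim (graded_free n (c i) (e i) t :: (nat \<Rightarrow> 'a spoly) set))
      = poly (\<Sum>j<c i. P j) (of_nat t)" if "t \<ge> r" for t
      unfolding dim_graded_free poly_sum of_nat_sum using P[OF _ that]
      by (intro sum.cong refl) auto
    then show ?thesis by blast
  qed
  \<comment> \<open>Downwards from \<open>Suc n\<close>, where the length bound of the resolution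
    makes the syzygy dimension 0.\<close>
  have "\<exists>P :: rat poly. \<forall>t\<ge>r. of_nat (?Z i t) = poly P (of_nat t)" if "i \<le> Suc n" for i
    using that
  proof (induction i rule: inc_induct)
    case base
    have "?Z (Suc n) t = 0" for t using syzygy_dim_eq_0[OF R] by simp
    then show ?case by (intro exI[of _ 0]) simp
  next
    case (step i)
    obtain P :: "rat poly" where P: "\<forall>t\<ge>r. of_nat (?Z (Suc i) t) = poly P (of_nat t)"
      using step.IH by blast
    obtain Q :: "rat poly" where Q: "\<forall>t\<ge>r. of_nat (fv.dim (graded_free n (c i) (e i) t :: (nat \<Rightarrow> 'a spoly) set))
      = poly Q (of_nat t)" using free[of i] step.hyps by auto
    have "\<forall>t\<ge>r. of_nat (?Z i t) = poly (Q - P) (of_nat t)"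
    proof (intro allI impI)
      fix t assume t: "r \<le> t"
      have "(of_nat (?Z i t) :: rat) + of_nat (?Z (Suc i) t) = poly Q (of_nat t)"
        using Q t syzygy_dim_Suc[OF R, of i t] by (metis of_nat_add)
      then show "of_nat (?Z i t) = poly (Q - P) (of_nat t)"
        using P t by (simp add: algebra_simps)
    qed
    then show ?case by blast
  qed
  from this[of 0] show ?thesis
    using that dim_graded_part_eq[OF R] by auto
qed

text \<open>The Hilbert polynomial is determined by large \<open>t\<close>; regularity brings a
  polynomial valid from \<open>r\<close> on, and polynomials that agree at infinitely many integers
  are equal.\<close>

lemma dim_graded_part_regular:
  fixes I :: "'a::field spoly set"
  assumes "regular n r I" "has_hilbert_poly n I p" "r \<le> t"
  shows "mp_dim (graded_part n t I) = hilb_q n p t"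
proof -
  obtain P :: "rat poly" where P: "\<And>t. r \<le> t \<Longrightarrow> of_nat (mp_dim (graded_part n t I)) = poly P (of_nat t)"
    using regular_hilbert_function_poly[OF assms(1)] by blast
  obtain C :: "rat poly" where C: "\<And>t. poly C (of_nat t) = of_nat ((n + t) choose n)"
    using poly_binomial[of 0 n] by auto
  obtain N where N: "\<And>t. N \<le> t \<Longrightarrow> poly C (of_nat t) - of_nat (mp_dim (graded_part n t I)) = poly p (of_nat t)"
    using assms(2) unfolding has_hilbert_poly_def eventually_sequentially dim_forms C by blast
  have "C - P - p = 0"
  proof (rule ccontr)
    assume "C - P - p \<noteq> 0"
    then have "finite {x. poly (C - P - p) x = 0}" by (rule poly_roots_finite)
    moreover have "of_nat ` {max N r..} \<subseteq> {x. poly (C - P - p) x = 0}"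
    proof
      fix x :: rat assume "x \<in> of_nat ` {max N r..}"
      then obtain k where "N \<le> k" "r \<le> k" "x = of_nat k" by auto
      then show "x \<in> {x. poly (C - P - p) x = 0}" using N[of k] P[of k] by simp
    qed
    ultimately have "finite (of_nat ` {max N r..} :: rat set)" by (rule finite_subset[rotated])
    then have "finite {max N r..}" by (rule finite_imageD) (auto intro: inj_onI)
    then show False using infinite_Ici by blast
  qed
  then have "poly (C - P - p) (of_nat t) = 0" by simp
  then have "of_nat ((n + t) choose n) - poly p (of_nat t) = rat_of_nat (mp_dim (graded_part n t I))"
    using P[OF assms(3)] C[of t] by (simp add: algebra_simps)
  then show ?thesis unfolding hilb_q_def by simp
qed

section \<open>Generation of a regular ideal by one graded piece\<close>

lemma poly_ideal_mult: "poly_ideal n M \<Longrightarrow> h \<in> polys n \<Longrightarrow> f \<in> M \<Longrightarrow> h * f \<in> M"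
  by (simp add: poly_ideal_def)

lemma poly_ideal_sum: "poly_ideal n M \<Longrightarrow> (\<And>i. i \<in> A \<Longrightarrow> g i \<in> M) \<Longrightarrow> (\<Sum>i\<in>A. g i) \<in> M"
  by (induction A rule: infinite_finite_induct) (auto simp: poly_ideal_def)

text \<open>The generators \<open>D 0 $$ (0, j)\<close> have degree at most
  \<open>r \<le> t\<close>, so each term of their coefficients splits into a factor that lifts the
  generator to degree \<open>t\<close> and a remaining factor. \<open>M\<close> is kept arbitrary:
  it is used both for the ideal generated by a graded piece and for a monomial ideal.\<close>

lemma regular_generated:
  fixes I M :: "'a::field spoly set"
  assumes reg: "regular n r I" and t: "r \<le> t" "t \<le> s" and M: "poly_ideal n M" "graded_part n t I \<subseteq> M"
  shows "graded_part n s I \<subseteq> M"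
proof
  obtain c e D where R: "min_free_resolution n I c e D" and reg: "\<And>i j. j < c i \<Longrightarrow> e i j \<le> r + i"
    using reg unfolding regular_def by blast
  fix f assume "f \<in> graded_part n s I"
  then obtain v where v: "v \<in> graded_free n (c 0) (e 0) s" "f = mat_act (D 0) v 0"
    using image_D0_degree_part[OF R, of s] by auto
  have gen: "D 0 $$ (0, j) * of_term u \<in> M" if j: "j < c 0" and u: "u \<in> terms_deg n (t - e 0 j)" for j u
  proof -
    let ?v = "\<lambda>k. if k = j then of_term u else 0 :: 'a spoly"
    have "?v \<in> graded_free n (c 0) (e 0) t"
      using j u reg[OF j] t(1) by (auto simp: graded_free_def forms_def)
    then have "mat_act (D 0) ?v 0 \<in> graded_part n t I"
      using image_D0_degree_part[OF R, of t] by blast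
    moreover have "mat_act (D 0) ?v 0 = D 0 $$ (0, j) * of_term u"
      using D0(1)[OF R] j by (simp add: mat_act_def if_distrib cong: if_cong)
    ultimately show ?thesis using M(2) by auto
  qed
  have "D 0 $$ (0, j) * v j \<in> M" if j: "j < c 0" for j
  proof -
    have le: "e 0 j \<le> t" using reg[OF j] t(1) by simp
    then have vj: "v j \<in> forms n (s - e 0 j)" using graded_freeD(1)[OF v(1) j] t by simp
    have "D 0 $$ (0, j) * (const (lk (v j) u) * of_term u) \<in> M" if u: "u \<in> ks (v j)" for u
    proof -
      have "u \<in> terms_deg n ((t - e 0 j) + (s - t))" using u vj t le by (auto simp: forms_def)
      then obtain u1 u2 where u12: "u1 \<in> terms_deg n (t - e 0 j)" "u2 \<in> terms_deg n (s - t)" "u = u1 + u2"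
        by (rule term_split)
      have "(const (lk (v j) u) * of_term u2) * (D 0 $$ (0, j) * of_term u1) \<in> M"
        using u12(2) terms_deg_subset by (intro poly_ideal_mult[OF M(1)] polys_mult polys_of_term gen[OF j u12(1)]) auto
      then show ?thesis by (simp add: u12(3) of_term_add mult_ac)
    qed
    then have "(\<Sum>u\<in>ks (v j). D 0 $$ (0, j) * (const (lk (v j) u) * of_term u)) \<in> M"
      by (rule poly_ideal_sum[OF M(1)])
    moreover have "(\<Sum>u\<in>ks (v j). const (lk (v j) u) * of_term u) = v j"
      using poly_mapping_sum_single[of "ks (v j)" "v j"] by (simp add: single_eq_const_of_term)
    ultimately show ?thesis by (simp only: sum_distrib_left[symmetric])
  qed
  then have "(\<Sum>j<c 0. D 0 $$ (0, j) * v j) \<in> M" by (intro poly_ideal_sum[OF M(1)]) auto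
  then show "f \<in> M" using v(2) D0(1)[OF R] by (simp add: mat_act_def)
qed

section \<open>Leading terms\<close>

text \<open>\<open>R\<close> is transitive and total on \<open>A\<close> only, because
  \<open>term_order\<close> restricts \<open>prec\<close> on \<open>terms n\<close> only. The lemma
  also serves for least terms, with the relation reversed, and for extensors.\<close>

lemma ex_greatest:
  assumes "finite A" "A \<noteq> {}"
    and "\<And>x y z. x \<in> A \<Longrightarrow> y \<in> A \<Longrightarrow> z \<in> A \<Longrightarrow> R x y \<Longrightarrow> R y z \<Longrightarrow> R x z"
    and "\<And>x y. x \<in> A \<Longrightarrow> y \<in> A \<Longrightarrow> x \<noteq> y \<Longrightarrow> R x y \<or> R y x"
  shows "\<exists>t\<in>A. \<forall>s\<in>A. s \<noteq> t \<longrightarrow> R s t"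
  using assms
proof (induction A rule: finite_ne_induct)
  case (insert x A)
  obtain t where t: "t \<in> A" "\<forall>s\<in>A. s \<noteq> t \<longrightarrow> R s t"
    using insert.IH insert.prems by (metis insertCI)
  have "x \<noteq> t" using insert.hyps t by auto
  then consider "R x t" | "R t x" using insert.prems(2)[of x t] t(1) by blast
  then show ?case
  proof cases
    case 1
    then show ?thesis using t by (intro bexI[of _ t]) auto
  next
    case 2
    then have "R s x" if "s \<in> A" for s
      using t insert.prems(1)[of s t x] that by (cases "s = t") auto
    then show ?thesis by (intro bexI[of _ x]) auto
  qed
qed auto

locale monomial_order =
  fixes n :: nat and prec :: "pterm \<Rightarrow> pterm \<Rightarrow> bool"
  assumes term_order: "term_order n prec"
begin

lemmas term_order_conjs = term_order[unfolded term_order_def]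

lemmas prec_irrefl = term_order_conjs[THEN conjunct1, rule_format]

lemmas prec_trans = term_order_conjs[THEN conjunct2, THEN conjunct1, rule_format]

lemmas prec_total = term_order_conjs[THEN conjunct2, THEN conjunct2, THEN conjunct1, rule_format]

lemmas prec_add =
  term_order_conjs[THEN conjunct2, THEN conjunct2, THEN conjunct2, THEN conjunct1, rule_format]

lemma prec_asym: "s \<in> terms n \<Longrightarrow> t \<in> terms n \<Longrightarrow> prec s t \<Longrightarrow> \<not> prec t s"
  using prec_irrefl[of s] prec_trans[of s t s] by blast

lemma ex_greatest_term:
  assumes "finite A" "A \<noteq> {}" "A \<subseteq> terms n"
  shows "\<exists>t\<in>A. \<forall>s\<in>A. s \<noteq> t \<longrightarrow> prec s t"
proof (rule ex_greatest[OF assms(1,2)])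
  show "prec x z" if "x \<in> A" "y \<in> A" "z \<in> A" "prec x y" "prec y z" for x y z
    using prec_trans[of x y z] that assms(3) by blast
  show "prec x y \<or> prec y x" if "x \<in> A" "y \<in> A" "x \<noteq> y" for x y
    using prec_total[of x y] that assms(3) by blast
qed

lemma ex_least_term:
  assumes "finite A" "A \<noteq> {}" "A \<subseteq> terms n"
  shows "\<exists>t\<in>A. \<forall>s\<in>A. s \<noteq> t \<longrightarrow> prec t s"
proof (rule ex_greatest[OF assms(1,2), of "\<lambda>s t. prec t s"])
  show "prec z x" if "x \<in> A" "y \<in> A" "z \<in> A" "prec y x" "prec z y" for x y z
    using prec_trans[of z y x] that assms(3) by blast
  show "prec y x \<or> prec x y" if "x \<in> A" "y \<in> A" "x \<noteq> y" for x y
    using prec_total[of x y] that assms(3) by blast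
qed

text \<open>A relation, so that 0 simply has no leading term.\<close>

definition is_lead :: "'a::zero spoly \<Rightarrow> pterm \<Rightarrow> bool" where
  "is_lead f t \<longleftrightarrow> t \<in> ks f \<and> (\<forall>s\<in>ks f. s \<noteq> t \<longrightarrow> prec s t)"

definition lead_terms :: "'a::zero spoly set \<Rightarrow> pterm set" where
  "lead_terms V = {t. \<exists>f\<in>V. is_lead f t}"

lemma ex_lead:
  assumes "f \<in> polys n" "f \<noteq> 0"
  shows "\<exists>t. is_lead f t"
proof -
  have "ks f \<noteq> {}" "ks f \<subseteq> terms n" using assms by (simp_all add: polys_def)
  then show ?thesis using ex_greatest_term[OF finite_keys] unfolding is_lead_def by blast
qed

lemma lead_unique:
  assumes "f \<in> polys n" "is_lead f s" "is_lead f t"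
  shows "s = t"
proof (rule ccontr)
  assume "s \<noteq> t"
  then have "prec s t" "prec t s" "s \<in> ks f" "t \<in> ks f" using assms(2,3) unfolding is_lead_def by auto
  moreover have "ks f \<subseteq> terms n" using assms(1) by (simp add: polys_def)
  ultimately show False using prec_asym[of s t] by auto
qed

lemma lead_terms_forms:
  assumes "V \<subseteq> forms n m"
  shows "lead_terms V \<subseteq> terms_deg n m"
proof
  fix t assume "t \<in> lead_terms V"
  then obtain f where "f \<in> V" "t \<in> ks f" by (auto simp: lead_terms_def is_lead_def)
  moreover have "ks f \<subseteq> terms_deg n m" using \<open>f \<in> V\<close> assms by (auto simp: forms_def)
  ultimately show "t \<in> terms_deg n m" by auto
qed

lemma finite_lead_terms: "V \<subseteq> forms n m \<Longrightarrow> finite (lead_terms V)"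
  by (rule finite_subset[OF lead_terms_forms finite_terms_deg])

text \<open>In a linear relation the greatest leading term with non-zero coefficient occurs in one
  summand only and cannot cancel.\<close>

lemma independent_of_lead_terms:
  fixes V :: "'a::field spoly set"
  assumes S: "finite S" and V: "V \<subseteq> polys n" and lead: "\<And>t. t \<in> S \<Longrightarrow> \<exists>f\<in>V. is_lead f t"
  obtains B where "B \<subseteq> V" "\<not> mp_dependent B" "finite B" "card B = card S"
proof -
  obtain F where F: "\<And>t. t \<in> S \<Longrightarrow> F t \<in> V \<and> is_lead (F t) t" using lead by metis
  have St: "S \<subseteq> terms n"
  proof
    fix t assume "t \<in> S"
    then have "F t \<in> polys n" "t \<in> ks (F t)" using F V by (auto simp: is_lead_def)
    then show "t \<in> terms n" by (auto simp: polys_def)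
  qed
  have inj: "inj_on F S"
  proof (rule inj_onI)
    fix s t assume "s \<in> S" "t \<in> S" "F s = F t"
    then show "s = t" using F[of s] F[of t] V lead_unique[of "F s" s t] by auto
  qed
  have "\<not> mp_dependent (F ` S)"
  proof (rule mp.independent_if_scalars_zero)
    fix u f assume z: "(\<Sum>x\<in>F ` S. const (u x) * x) = 0" and f: "f \<in> F ` S"
    let ?S = "{t \<in> S. u (F t) \<noteq> 0}"
    have "?S = {}"
    proof (rule ccontr)
      assume "?S \<noteq> {}"
      then obtain t where t: "t \<in> ?S" "\<forall>s\<in>?S. s \<noteq> t \<longrightarrow> prec s t"
        using ex_greatest_term[of ?S] S St by auto
      have "0 = lk (\<Sum>x\<in>F ` S. const (u x) * x) t" using z by simp
      also have "\<dots> = (\<Sum>s\<in>S. u (F s) * lk (F s) t)"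
        using inj by (simp add: sum.reindex lookup_sum)
      also have "\<dots> = (\<Sum>s\<in>S. if s = t then u (F t) * lk (F t) t else 0)"
      proof (intro sum.cong refl)
        fix s assume s: "s \<in> S"
        have "lk (F s) t = 0" if "u (F s) \<noteq> 0" "s \<noteq> t"
        proof (rule ccontr)
          assume "lk (F s) t \<noteq> 0"
          then have "prec t s" using F[OF s] that by (auto simp: is_lead_def in_keys_iff)
          moreover have "prec s t" using t s that by auto
          ultimately show False using prec_asym[of s t] St s t by auto
        qed
        then show "u (F s) * lk (F s) t = (if s = t then u (F t) * lk (F t) t else 0)" by auto
      qed
      also have "\<dots> = u (F t) * lk (F t) t" using t S by simp
      finally show False using t F[of t] by (auto simp: is_lead_def in_keys_iff)
    qed
    then show "u f = 0" using f by auto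
  qed (use S in simp)
  then show ?thesis
    using that[of "F ` S"] F S card_image[OF inj] by blast
qed

text \<open>A non-zero element does not vanish at its own leading term, so the coefficients at the
  leading terms determine the elements of \<open>V\<close>. This bounds the dimension from above,
  and independence bounds it from below.\<close>

lemma dim_eq_card_lead_terms:
  fixes V :: "'a::field spoly set"
  assumes V: "mp_subspace V" "V \<subseteq> forms n m"
  shows "mp_dim V = card (lead_terms V)"
proof (rule antisym)
  have "f = 0" if "f \<in> V" "\<forall>t\<in>lead_terms V. lk f t = 0" for f
  proof (rule ccontr)
    assume "f \<noteq> 0"
    moreover have "f \<in> polys n" using that(1) V(2) forms_subset_polys by blast
    ultimately obtain t where "is_lead f t" using ex_lead by blast
    then have "t \<in> lead_terms V" "lk f t \<noteq> 0" using that(1) by (auto simp: lead_terms_def is_lead_def in_keys_iff)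
    then show False using that(2) by simp
  qed
  then show "mp_dim V \<le> card (lead_terms V)"
    by (intro dim_le_card_coordinates V finite_lead_terms[OF V(2)])
  have "V \<subseteq> polys n" using V(2) forms_subset_polys by blast
  moreover have "\<And>t. t \<in> lead_terms V \<Longrightarrow> \<exists>f\<in>V. is_lead f t" by (simp add: lead_terms_def)
  ultimately obtain B where B: "B \<subseteq> V" "\<not> mp_dependent B" "card B = card (lead_terms V)"
    by (rule independent_of_lead_terms[OF finite_lead_terms[OF V(2)]])
  obtain C where C: "mp_span C = V" "card C = mp_dim V" "finite C"
    by (rule finite_basis_of_forms[OF V])
  show "card (lead_terms V) \<le> mp_dim V"
    using mp.independent_span_bound[OF C(3) B(2)] B C by auto
qed

text \<open>An element with all terms below \<open>\<tau>\<close> vanishes at the rest of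
  \<open>A\<close> anyway, so the part of \<open>A\<close> below \<open>\<tau>\<close> determines
  it. Used with the terms of \<open>J_m\<close> for the final count, and with an extensor of
  non-zero Pluecker coordinate to identify \<open>gin\<close>.\<close>

lemma card_lead_terms_below:
  fixes V :: "'a::field spoly set"
  assumes V: "mp_subspace V" "V \<subseteq> forms n m" and A: "finite A"
    and det: "\<And>f. f \<in> V \<Longrightarrow> \<forall>t\<in>A. lk f t = 0 \<Longrightarrow> f = 0" and \<tau>: "\<tau> \<in> terms n"
  shows "card {t \<in> lead_terms V. prec t \<tau>} \<le> card {t \<in> A. prec t \<tau>}"
proof -
  let ?W = "V \<inter> {f. ks f \<subseteq> {s. prec s \<tau>}}"
  have W: "mp_subspace ?W" by (intro mp.subspace_inter V subspace_keys)
  have lead: "\<exists>f\<in>?W. is_lead f t" if t: "t \<in> {t \<in> lead_terms V. prec t \<tau>}" for t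
  proof -
    obtain f where f: "f \<in> V" "is_lead f t" using t by (auto simp: lead_terms_def)
    have "prec s \<tau>" if s: "s \<in> ks f" for s
    proof (cases "s = t")
      case False
      have "s \<in> terms n" "t \<in> terms n"
        using f s V(2) by (auto simp: is_lead_def forms_def terms_deg_def subset_iff)
      then show ?thesis using prec_trans[of s t \<tau>] f(2) s t \<tau> False by (auto simp: is_lead_def)
    qed (use t in auto)
    then show ?thesis using f by auto
  qed
  have "finite {t \<in> lead_terms V. prec t \<tau>}" using finite_lead_terms[OF V(2)] by simp
  moreover have "?W \<subseteq> polys n" using V(2) forms_subset_polys by blast
  ultimately obtain B where B: "B \<subseteq> ?W" "\<not> mp_dependent B" "card B = card {t \<in> lead_terms V. prec t \<tau>}"
    by (rule independent_of_lead_terms[OF _ _ lead])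
  have "finite B \<and> card B \<le> card {t \<in> A. prec t \<tau>}"
  proof (rule card_independent_le_card_coordinates[OF W _ _ B(1,2)])
    fix f assume f: "f \<in> ?W" "\<forall>t\<in>{t \<in> A. prec t \<tau>}. lk f t = 0"
    then have "lk f t = 0" if "t \<in> A" for t
      using that by (cases "prec t \<tau>") (auto simp: in_keys_iff)
    then show "f = 0" using f det by auto
  qed (use A in auto)
  then show ?thesis using B(3) by simp
qed

text \<open>Greedy matching of the least elements \<open>a\<close> and \<open>b\<close>. Removing
  them preserves the hypothesis: if \<open>\<tau>\<close> is above \<open>b\<close>, it is above
  \<open>a\<close> as well and both counts drop by one; otherwise nothing of \<open>B - {b}\<close>
  is below \<open>\<tau>\<close>.\<close>

lemma ex_increasing_bij:
  assumes "finite A" "finite B" "A \<subseteq> terms n" "B \<subseteq> terms n" "card A = card B"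
    and "\<And>\<tau>. \<tau> \<in> terms n \<Longrightarrow> card {t \<in> B. prec t \<tau>} \<le> card {t \<in> A. prec t \<tau>}"
  shows "\<exists>\<omega>. bij_betw \<omega> A B \<and> (\<forall>a\<in>A. a = \<omega> a \<or> prec a (\<omega> a))"
  using assms
proof (induction "card A" arbitrary: A B)
  case 0
  then have "A = {}" "B = {}" by simp_all
  then show ?case by (intro exI[of _ id]) (simp add: bij_betw_def)
next
  case (Suc k)
  have ne: "A \<noteq> {}" "B \<noteq> {}" using Suc.hyps(2) Suc.prems(5) by force+
  obtain a where a: "a \<in> A" "\<forall>s\<in>A. s \<noteq> a \<longrightarrow> prec a s"
    using ex_least_term[OF Suc.prems(1) ne(1) Suc.prems(3)] by blast
  obtain b where b: "b \<in> B" "\<forall>s\<in>B. s \<noteq> b \<longrightarrow> prec b s"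
    using ex_least_term[OF Suc.prems(2) ne(2) Suc.prems(4)] by blast
  have terms: "a \<in> terms n" "b \<in> terms n" using a b Suc.prems by auto
  \<comment> \<open>Otherwise the counts below \<open>a\<close> would be positive for
    \<open>B\<close> and 0 for \<open>A\<close>.\<close>
  have ab: "a = b \<or> prec a b"
  proof (rule ccontr)
    assume "\<not> ?thesis"
    then have "prec b a" using prec_total[OF terms] by auto
    then have "b \<in> {t \<in> B. prec t a}" using b(1) by simp
    moreover have "finite {t \<in> B. prec t a}" using Suc.prems(2) by simp
    ultimately have "0 < card {t \<in> B. prec t a}" using card_gt_0_iff by blast
    moreover have "\<not> prec t a" if "t \<in> A" for t
      using a(2) that Suc.prems(3) prec_asym[of a t] prec_irrefl[of a] terms by (cases "t = a") auto
    then have "{t \<in> A. prec t a} = {}" by blast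
    ultimately show False using Suc.prems(6)[OF terms(1)] by (metis card.empty not_less)
  qed
  have "\<exists>\<omega>. bij_betw \<omega> (A - {a}) (B - {b}) \<and> (\<forall>x\<in>A - {a}. x = \<omega> x \<or> prec x (\<omega> x))"
  proof (rule Suc.hyps(1))
    show "k = card (A - {a})" using Suc.hyps(2) Suc.prems(1) a(1) by simp
    show "card (A - {a}) = card (B - {b})" using Suc.prems a(1) b(1) by simp
    fix \<tau> assume \<tau>: "\<tau> \<in> terms n"
    show "card {t \<in> B - {b}. prec t \<tau>} \<le> card {t \<in> A - {a}. prec t \<tau>}"
    proof (cases "prec b \<tau>")
      case True
      then have a\<tau>: "prec a \<tau>" using ab prec_trans[OF terms \<tau>] by auto
      have "{t \<in> B - {b}. prec t \<tau>} = {t \<in> B. prec t \<tau>} - {b}"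
        and "{t \<in> A - {a}. prec t \<tau>} = {t \<in> A. prec t \<tau>} - {a}" by auto
      then show ?thesis using Suc.prems(6)[OF \<tau>] a b True a\<tau> by simp
    next
      case False
      have "\<not> prec t \<tau>" if "t \<in> B - {b}" for t
        using b(2) that Suc.prems(4) prec_trans[OF terms(2) _ \<tau>, of t] False by auto
      then have "{t \<in> B - {b}. prec t \<tau>} = {}" by auto
      then show ?thesis by (simp only: card.empty)
    qed
  qed (use Suc.prems(1-4) in auto)
  then obtain \<omega> where \<omega>: "bij_betw \<omega> (A - {a}) (B - {b})" "\<forall>x\<in>A - {a}. x = \<omega> x \<or> prec x (\<omega> x)"
    by blast
  have "bij_betw (\<omega>(a := b)) (insert a (A - {a})) (insert b (B - {b}))"
  proof (rule bij_betw_combine[of _ "{a}" "{b}", simplified])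
    show "bij_betw (\<omega>(a := b)) (A - {a}) (B - {b})"
      using \<omega>(1) by (rule bij_betw_cong[THEN iffD1, rotated]) simp
  qed auto
  then have "bij_betw (\<omega>(a := b)) A B" using a(1) b(1) by (simp add: insert_absorb)
  moreover have "\<forall>x\<in>A. x = (\<omega>(a := b)) x \<or> prec x ((\<omega>(a := b)) x)" using \<omega>(2) ab by simp
  ultimately show ?case by blast
qed

end

section \<open>Dickson's lemma\<close>

text \<open>There is a monotone subsequence in one of the two directions; a decreasing one is
  constant from a minimal value on.\<close>

lemma nat_seq_mono_subseq:
  fixes s :: "nat \<Rightarrow> nat"
  obtains \<phi> :: "nat \<Rightarrow> nat" where "strict_mono \<phi>" "mono (s \<circ> \<phi>)"
proof -
  obtain \<phi> where \<phi>: "strict_mono \<phi>" "monoseq (\<lambda>j. s (\<phi> j))" using seq_monosub by blast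
  show ?thesis
  proof (cases "mono (s \<circ> \<phi>)")
    case False
    then have dec: "\<And>i j. i \<le> j \<Longrightarrow> s (\<phi> j) \<le> s (\<phi> i)"
      using \<phi>(2) by (auto simp: monoseq_def mono_def)
    obtain j0 where j0: "\<And>j. s (\<phi> j0) \<le> s (\<phi> j)"
      using ex_has_least_nat[of "\<lambda>_. True" 0 "\<lambda>j. s (\<phi> j)"] by auto
    have "s (\<phi> (j0 + j)) = s (\<phi> j0)" for j using dec[of j0 "j0 + j"] j0[of "j0 + j"] by simp
    then have "mono (s \<circ> (\<lambda>j. \<phi> (j0 + j)))" by (auto simp: mono_def)
    moreover have "strict_mono (\<lambda>j. \<phi> (j0 + j))" using \<phi>(1) by (auto simp: strict_mono_def)
    ultimately show ?thesis by (rule that[rotated])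
  next
    case True
    show ?thesis by (rule that[OF \<phi>(1) True])
  qed
qed

lemma expo_seq_mono_subseq:
  fixes x :: "nat \<Rightarrow> pterm"
  shows "\<exists>\<phi> :: nat \<Rightarrow> nat. strict_mono \<phi> \<and> (\<forall>i<k. mono (\<lambda>j. lk (x (\<phi> j)) i))"
proof (induction k)
  case 0
  show ?case by (intro exI[of _ id]) (auto simp: strict_mono_def)
next
  case (Suc k)
  then obtain \<phi> :: "nat \<Rightarrow> nat" where \<phi>: "strict_mono \<phi>" "\<forall>i<k. mono (\<lambda>j. lk (x (\<phi> j)) i)" by blast
  obtain \<psi> :: "nat \<Rightarrow> nat" where \<psi>: "strict_mono \<psi>" "mono ((\<lambda>j. lk (x (\<phi> j)) k) \<circ> \<psi>)" by (rule nat_seq_mono_subseq)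
  have "mono (\<lambda>j. lk (x ((\<phi> \<circ> \<psi>) j)) i)" if "i < Suc k" for i
    using that \<phi>(2) \<psi> strict_mono_mono[OF \<psi>(1)] by (auto simp: less_Suc_eq mono_def)
  then show ?case using strict_mono_o[OF \<phi>(1) \<psi>(1)] by blast
qed

text \<open>The elements of \<open>U\<close> divisible by no other element of \<open>U\<close>
  generate, by induction on the degree. Infinitely many of them would contain a sequence that is
  non-decreasing in each coordinate, hence two distinct ones of which one divides the other.\<close>

lemma dickson:
  assumes U: "U \<subseteq> terms n"
  obtains F where "finite F" "F \<subseteq> U" "\<And>u. u \<in> U \<Longrightarrow> \<exists>f\<in>F. \<exists>v. u = v + f"
proof
  define F where "F = {u \<in> U. \<forall>w\<in>U. \<forall>v. u = v + w \<longrightarrow> w = u}"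
  show "F \<subseteq> U" by (auto simp: F_def)
  show "\<exists>f\<in>F. \<exists>v. u = v + f" if "u \<in> U" for u
    using that
  proof (induction "expo_deg u" arbitrary: u rule: less_induct)
    case less
    show ?case
    proof (cases "u \<in> F")
      case True
      then show ?thesis by (intro bexI[of _ u] exI[of _ 0]) auto
    next
      case False
      then obtain w v where w: "w \<in> U" "u = v + w" "w \<noteq> u" using less.prems unfolding F_def by blast
      have "v \<noteq> 0" using w by auto
      then obtain i where "lk v i \<noteq> 0" by (metis poly_mapping_eqI lookup_zero)
      then have "expo_deg v \<noteq> 0" by (auto simp: expo_deg_def in_keys_iff)
      then have "expo_deg w < expo_deg u" using w by simp
      then obtain f v' where "f \<in> F" "w = v' + f" using less.hyps[OF _ w(1)] by blast
      then show ?thesis using w(2) by (intro bexI[of _ f] exI[of _ "v + v'"]) (simp_all add: add.assoc)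
    qed
  qed
  show "finite F"
  proof (rule ccontr)
    assume "infinite F"
    then obtain x :: "nat \<Rightarrow> pterm" where x: "inj x" "range x \<subseteq> F"
      using infinite_countable_subset by blast
    obtain \<phi> :: "nat \<Rightarrow> nat" where \<phi>: "strict_mono \<phi>" "\<forall>i<Suc n. mono (\<lambda>j. lk (x (\<phi> j)) i)"
      using expo_seq_mono_subseq by blast
    let ?a = "x (\<phi> 0)" and ?b = "x (\<phi> 1)"
    have F: "?a \<in> F" "?b \<in> F" using x(2) by auto
    have "lk ?a i \<le> lk ?b i" for i
    proof (cases "i < Suc n")
      case True
      then show ?thesis using \<phi>(2) monoD[of "\<lambda>j. lk (x (\<phi> j)) i" 0 1] by simp
    next
      case False
      moreover have "ks ?a \<subseteq> {..n}" using F(1) U by (auto simp: F_def terms_def)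
      ultimately have "i \<notin> ks ?a" by auto
      then show ?thesis by (simp add: in_keys_iff)
    qed
    then have "?b = (?b - ?a) + ?a" by (intro poly_mapping_eqI) (simp add: lookup_add lookup_minus)
    moreover have "?a \<in> U" "\<forall>w\<in>U. \<forall>v. ?b = v + w \<longrightarrow> w = ?b" using F unfolding F_def by fast+
    ultimately have "?a = ?b" by blast
    then have "\<phi> 0 = \<phi> 1" using x(1) by (simp add: inj_eq)
    then show False using \<phi>(1) by (simp add: strict_mono_eq)
  qed
qed

section \<open>Monomial ideals and initial ideals\<close>

definition up_closed :: "nat \<Rightarrow> pterm set \<Rightarrow> bool" where
  "up_closed n T \<longleftrightarrow> T \<subseteq> terms n \<and> (\<forall>t\<in>T. \<forall>u\<in>terms n. u + t \<in> T)"

text \<open>For up-closed \<open>T\<close> this is the monomial ideal with the terms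
  \<open>T\<close>. Every monomial ideal arises so by \<open>monomial_ideal_supported\<close>, which
  turns saturation and graded parts into operations on sets of terms.\<close>

definition supported :: "pterm set \<Rightarrow> 'a::zero spoly set" where
  "supported T = {f. ks f \<subseteq> T}"

lemma homogeneous_ideal_supported:
  assumes "up_closed n T"
  shows "homogeneous_ideal n (supported T :: 'a::field spoly set)"
proof -
  have add: "f + g \<in> supported T" if "f \<in> supported T" "g \<in> supported T" for f g :: "'a spoly"
    using keys_add[of f g] that unfolding supported_def by blast
  have T: "T \<subseteq> terms n" "\<And>t u. t \<in> T \<Longrightarrow> u \<in> terms n \<Longrightarrow> u + t \<in> T"
    using assms by (auto simp: up_closed_def)
  have "h * f \<in> supported T" if "h \<in> polys n" "f \<in> supported T" for h f :: "'a spoly"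
  proof -
    have "ks (h * f) \<subseteq> T"
    proof
      fix t assume "t \<in> ks (h * f)"
      then obtain a b where "t = a + b" "a \<in> ks h" "b \<in> ks f" using keys_mult[of h f] by blast
      then show "t \<in> T" using that T(2) by (auto simp: polys_def supported_def)
    qed
    then show ?thesis by (simp add: supported_def)
  qed
  moreover have "supported T \<subseteq> (polys n :: 'a spoly set)"
    using T(1) unfolding supported_def polys_def by blast
  moreover have "hom_comp k f \<in> supported T" if "f \<in> supported T" for k and f :: "'a spoly"
    using that by (auto simp: supported_def keys_hom_comp)
  moreover have "(0 :: 'a spoly) \<in> supported T" by (simp add: supported_def)
  ultimately show ?thesis
    unfolding homogeneous_ideal_def poly_ideal_def using add by blast
qed

lemma graded_part_supported:
  "T \<subseteq> terms n \<Longrightarrow> graded_part n t (supported T :: 'a::field spoly set) = mp_span (of_term ` (T \<inter> terms_deg n t))"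
  unfolding span_of_term by (auto simp: graded_part_def supported_def forms_def)

definition term_saturation :: "nat \<Rightarrow> pterm set \<Rightarrow> pterm set" where
  "term_saturation n T = {u \<in> terms n. \<exists>k. \<forall>s\<in>terms_deg n k. s + u \<in> T}"

text \<open>A factor of degree \<open>k\<close> is split off \<open>s\<close>. Since exponents can
  be raised, finitely many terms of the saturation have a common one.\<close>

lemma up_closed_deg_mono:
  assumes "up_closed n T" "\<forall>s\<in>terms_deg n k. s + u \<in> T" "k \<le> l" "s \<in> terms_deg n l"
  shows "s + u \<in> T"
proof -
  have "s \<in> terms_deg n ((l - k) + k)" using assms(3,4) by simp
  then obtain a b where ab: "a \<in> terms_deg n (l - k)" "b \<in> terms_deg n k" "s = a + b"
    by (rule term_split)
  then have "a + (b + u) \<in> T"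
    using assms(1,2) terms_deg_subset unfolding up_closed_def by blast
  then show ?thesis using ab(3) by (simp add: add.assoc)
qed

lemma subset_term_saturation: "up_closed n T \<Longrightarrow> T \<subseteq> term_saturation n T"
  unfolding term_saturation_def up_closed_def using terms_deg_subset by blast

lemma up_closed_term_saturation:
  assumes "up_closed n T"
  shows "up_closed n (term_saturation n T)"
  unfolding up_closed_def
proof (intro conjI ballI)
  fix t u assume t: "t \<in> term_saturation n T" and u: "u \<in> terms n"
  then obtain k where k: "\<forall>s\<in>terms_deg n k. s + t \<in> T" by (auto simp: term_saturation_def)
  have "s + (u + t) \<in> T" if "s \<in> terms_deg n k" for s
  proof -
    have "u + (s + t) \<in> T" using k that assms u by (simp add: up_closed_def)
    then show ?thesis by (simp add: add.left_commute)
  qed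
  moreover have "t \<in> terms n" using t by (simp add: term_saturation_def)
  ultimately show "u + t \<in> term_saturation n T" using u by (auto simp: term_saturation_def)
qed (auto simp: term_saturation_def)

lemma finite_common_bound:
  assumes "finite A" "\<And>x. x \<in> A \<Longrightarrow> \<exists>k :: nat. P x k" "\<And>x k l. P x k \<Longrightarrow> k \<le> l \<Longrightarrow> P x l"
  shows "\<exists>k. \<forall>x\<in>A. P x k"
  using assms(1,2)
proof (induction A)
  case (insert x A)
  obtain k where "\<forall>x\<in>A. P x k" using insert.IH insert.prems by auto
  moreover obtain l where "P x l" using insert.prems by auto
  ultimately have "\<forall>y\<in>insert x A. P y (max k l)" 
    using assms(3)[of _ k "max k l"] assms(3)[of x l "max k l"] by auto
  then show ?case by blast
qed simp

lemma term_saturation_common: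
  assumes "up_closed n T" "finite A" "A \<subseteq> term_saturation n T"
  shows "\<exists>k. \<forall>u\<in>A. \<forall>s\<in>terms_deg n k. s + u \<in> T"
proof (rule finite_common_bound[OF assms(2)])
  show "\<exists>k. \<forall>s\<in>terms_deg n k. s + u \<in> T" if "u \<in> A" for u
    using that assms(3) by (auto simp: term_saturation_def)
  show "\<forall>s\<in>terms_deg n l. s + u \<in> T" if "\<forall>s\<in>terms_deg n k. s + u \<in> T" "k \<le> l" for u k l
    using up_closed_deg_mono[OF assms(1) that] by blast
qed

lemma term_saturation_idem:
  assumes "up_closed n T"
  shows "term_saturation n (term_saturation n T) = term_saturation n T"
proof
  show "term_saturation n (term_saturation n T) \<subseteq> term_saturation n T"
  proof
    fix u assume u: "u \<in> term_saturation n (term_saturation n T)"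
    then obtain k where k: "\<forall>s\<in>terms_deg n k. s + u \<in> term_saturation n T"
      unfolding term_saturation_def by blast
    \<comment> \<open>There are finitely many terms of degree \<open>k\<close>, so one exponent
      \<open>l\<close> works for all \<open>s + u\<close>; then \<open>l + k\<close> is an exponent
      for \<open>u\<close>.\<close>
    have "\<exists>l. \<forall>w\<in>(\<lambda>s. s + u) ` terms_deg n k. \<forall>s\<in>terms_deg n l. s + w \<in> T"
      by (rule term_saturation_common[OF assms]) (use k in auto)
    then obtain l where l: "\<And>s s'. s \<in> terms_deg n k \<Longrightarrow> s' \<in> terms_deg n l \<Longrightarrow> s' + (s + u) \<in> T"
      by auto
    have "s + u \<in> T" if s: "s \<in> terms_deg n (l + k)" for s
    proof -
      obtain a b where "a \<in> terms_deg n l" "b \<in> terms_deg n k" "s = a + b"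
        by (rule term_split[OF s])
      then show ?thesis using l[of b a] by (simp add: add.assoc)
    qed
    then show "u \<in> term_saturation n T" using u by (auto simp: term_saturation_def)
  qed
qed (rule subset_term_saturation[OF up_closed_term_saturation[OF assms]])

lemma saturation_supported:
  assumes T: "up_closed n T"
  shows "saturation n (supported T :: 'a::field spoly set) = supported (term_saturation n T)"
proof
  show "saturation n (supported T :: 'a spoly set) \<subseteq> supported (term_saturation n T)"
  proof
    fix f :: "'a spoly" assume f: "f \<in> saturation n (supported T)"
    then obtain k where fp: "f \<in> polys n" and k: "\<And>g. g \<in> forms n k \<Longrightarrow> g * f \<in> supported T"
      unfolding saturation_def by blast
    have "u \<in> term_saturation n T" if u: "u \<in> ks f" for u
    proof -
      have "s + u \<in> T" if s: "s \<in> terms_deg n k" for s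
      proof -
        have "of_term s * f \<in> supported T" by (rule k) (use s in \<open>simp add: forms_def\<close>)
        moreover have "s + u \<in> ks (of_term s * f)" using u by (simp add: in_keys_iff lookup_of_term_times)
        ultimately show ?thesis by (auto simp: supported_def)
      qed
      moreover have "u \<in> terms n" using u fp by (auto simp: polys_def)
      ultimately show ?thesis by (auto simp: term_saturation_def)
    qed
    then show "f \<in> supported (term_saturation n T)" by (auto simp: supported_def)
  qed
  show "supported (term_saturation n T) \<subseteq> saturation n (supported T :: 'a spoly set)"
  proof
    fix f :: "'a spoly" assume "f \<in> supported (term_saturation n T)"
    then have f: "ks f \<subseteq> term_saturation n T" by (simp add: supported_def)
    obtain k where k: "\<forall>u\<in>ks f. \<forall>s\<in>terms_deg n k. s + u \<in> T"
      using term_saturation_common[OF T finite_keys f] by blast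
    have "ks (g * f) \<subseteq> T" if "g \<in> forms n k" for g
    proof
      fix t assume "t \<in> ks (g * f)"
      then obtain a b where "t = a + b" "a \<in> ks g" "b \<in> ks f" using keys_mult[of g f] by blast
      then show "t \<in> T" using that k by (auto simp: forms_def)
    qed
    moreover have "f \<in> polys n" using f by (auto simp: polys_def term_saturation_def)
    ultimately show "f \<in> saturation n (supported T)" by (auto simp: saturation_def supported_def)
  qed
qed

text \<open>Dickson's lemma gives finitely many generators of the saturation. If their degrees are
  at most \<open>M\<close> and \<open>k\<close> is a common exponent, a term of degree at least
  \<open>M + k\<close> is a generator times a term of degree at least \<open>k\<close>.\<close>

lemma term_saturation_eventually:
  assumes T: "up_closed n T"
  obtains N where "\<And>t. N \<le> t \<Longrightarrow> term_saturation n T \<inter> terms_deg n t = T \<inter> terms_deg n t"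
proof -
  have sub: "term_saturation n T \<subseteq> terms n" by (auto simp: term_saturation_def)
  obtain F where F: "finite F" "F \<subseteq> term_saturation n T"
    and gen: "\<And>u. u \<in> term_saturation n T \<Longrightarrow> \<exists>f\<in>F. \<exists>v. u = v + f"
    by (rule dickson[OF sub]) blast
  obtain k where k: "\<forall>u\<in>F. \<forall>s\<in>terms_deg n k. s + u \<in> T"
    using term_saturation_common[OF T F] by blast
  obtain M where M: "\<forall>f\<in>F. expo_deg f \<le> M"
    using F(1) finite_nat_set_iff_bounded_le[of "expo_deg ` F"] by auto
  show ?thesis
  proof (rule that[of "M + k"])
    fix t assume t: "M + k \<le> t"
    have "u \<in> T" if u: "u \<in> term_saturation n T" "u \<in> terms_deg n t" for u
    proof -
      obtain f v where f: "f \<in> F" "u = v + f" using gen u by blast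
      have "u \<in> terms n" "expo_deg u = t" using u(2) by (simp_all add: terms_deg_def)
      moreover have "expo_deg f \<le> M" using M f(1) by blast
      ultimately have "v \<in> terms n" "k \<le> expo_deg v" using f(2) t by (auto simp: terms_add_iff)
      then have "v \<in> terms_deg n (expo_deg v)" "k \<le> expo_deg v" by (auto simp: terms_deg_def)
      then show ?thesis using up_closed_deg_mono[OF T, of k f "expo_deg v" v] k f by auto
    qed
    then show "term_saturation n T \<inter> terms_deg n t = T \<inter> terms_deg n t"
      using subset_term_saturation[OF T] by blast
  qed
qed

section \<open>Graded parts of points of the Hilbert scheme\<close>

lemma subspace_graded_part:
  fixes I :: "'a::field spoly set"
  assumes "poly_ideal n I"
  shows "mp_subspace (graded_part n t I)"
proof -
  have "const c * f \<in> I" if "f \<in> I" for c f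
    using poly_ideal_mult[OF assms polys_const that] .
  moreover have "0 \<in> I" "\<And>f g. f \<in> I \<Longrightarrow> g \<in> I \<Longrightarrow> f + g \<in> I" using assms by (simp_all add: poly_ideal_def)
  ultimately have "mp_subspace I" by (intro mp.subspaceI)
  then show ?thesis unfolding graded_part_def by (rule mp.subspace_inter[OF _ subspace_forms])
qed

lemma poly_ideal_ideal_gen: "B \<subseteq> polys n \<Longrightarrow> poly_ideal n (ideal_gen n (B :: 'a::comm_ring_1 spoly set))"
proof -
  assume B: "B \<subseteq> polys n"
  have "poly_ideal n (polys n :: 'a spoly set)"
    unfolding poly_ideal_def using polys_add polys_mult by auto
  then have "ideal_gen n B \<subseteq> polys n" unfolding ideal_gen_def using B by blast
  then show ?thesis unfolding poly_ideal_def ideal_gen_def by blast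
qed

lemma ideal_gen_superset: "B \<subseteq> ideal_gen n B"
  unfolding ideal_gen_def by blast

lemma ideal_gen_least: "poly_ideal n M \<Longrightarrow> B \<subseteq> M \<Longrightarrow> ideal_gen n B \<subseteq> M"
  unfolding ideal_gen_def by blast

lemma hilb_homogeneous: "I \<in> hilb n p \<Longrightarrow> homogeneous_ideal n I"
  and hilb_poly_ideal: "I \<in> hilb n p \<Longrightarrow> poly_ideal n I"
  by (simp_all add: hilb_def homogeneous_ideal_def)

lemma dim_graded_part_hilb:
  fixes I :: "'a::field spoly set"
  assumes "I \<in> hilb n p" "gotzmann_number TYPE('a) n p r" "r \<le> t"
  shows "mp_dim (graded_part n t I) = hilb_q n p t"
  using assms by (intro dim_graded_part_regular[of n r]) (auto simp: hilb_def gotzmann_number_def)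

text \<open>From degree \<open>d\<close> on, \<open>G\<close> agrees with the ideal generated by
  \<open>G_d\<close>, by regularity. The exponent \<open>d\<close> suffices for the saturation: a
  form of degree \<open>d\<close> moves every homogeneous component of \<open>f\<close> to degree at
  least \<open>d\<close>.\<close>

lemma saturation_ideal_gen_graded_part:
  fixes G :: "'a::field spoly set"
  assumes G: "G \<in> hilb n p" and r: "gotzmann_number TYPE('a) n p r" "r \<le> d"
  shows "saturation n (ideal_gen n (graded_part n d G)) = G"
proof
  let ?M = "ideal_gen n (graded_part n d G)"
  have M: "poly_ideal n ?M"
    by (rule poly_ideal_ideal_gen) (auto simp: graded_part_def intro: forms_subset_polys[THEN subsetD])
  have pG: "poly_ideal n G" by (rule hilb_poly_ideal[OF G])
  have sub: "?M \<subseteq> G" by (rule ideal_gen_least[OF pG]) (auto simp: graded_part_def)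
  then have "saturation n ?M \<subseteq> saturation n G" unfolding saturation_def by blast
  also have "\<dots> = G" using G by (simp add: hilb_def saturated_def)
  finally show "saturation n ?M \<subseteq> G" .
  show "G \<subseteq> saturation n ?M"
  proof
    fix f assume f: "f \<in> G"
    then have fp: "f \<in> polys n" using pG by (auto simp: poly_ideal_def)
    have reg: "regular n r G" using r(1) G by (simp add: gotzmann_number_def)
    have "g * f \<in> ?M" if g: "g \<in> forms n d" for g
    proof -
      have "g * hom_comp k f \<in> ?M" for k
      proof -
        have "hom_comp k f \<in> G" using hilb_homogeneous[OF G] f by (simp add: homogeneous_ideal_def)
        then have "g * hom_comp k f \<in> G"
          using poly_ideal_mult[OF pG] g forms_subset_polys by blast
        moreover have "g * hom_comp k f \<in> forms n (d + k)"
          by (rule forms_mult[OF g hom_comp_in_forms[OF fp]])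
        ultimately have "g * hom_comp k f \<in> graded_part n (d + k) G" by (simp add: graded_part_def)
        then show ?thesis
          using regular_generated[OF reg r(2), of "d + k" ?M] M ideal_gen_superset by auto
      qed
      then have "(\<Sum>k\<in>expo_deg ` ks f. g * hom_comp k f) \<in> ?M" by (intro poly_ideal_sum[OF M])
      moreover have "(\<Sum>k\<in>expo_deg ` ks f. g * hom_comp k f) = g * f"
        using sum_hom_comp[of "expo_deg ` ks f" f] by (simp add: sum_distrib_left[symmetric])
      ultimately show ?thesis by simp
    qed
    then show "f \<in> saturation n ?M" using fp by (auto simp: saturation_def)
  qed
qed

context monomial_order
begin

text \<open>Homogeneous elements suffice: the leading term of any \<open>f \<in> I\<close> is that
  of one of its components, and these lie in \<open>I\<close> when \<open>I\<close> is
  homogeneous.\<close>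

definition initial_terms :: "'a::zero spoly set \<Rightarrow> pterm set" where
  "initial_terms I = (\<Union>t. lead_terms (graded_part n t I))"

lemma lead_terms_graded_part: "lead_terms (graded_part n t I) \<subseteq> terms_deg n t"
  by (rule lead_terms_forms[where m = t]) (auto simp: graded_part_def)

lemma initial_terms_degree: "initial_terms I \<inter> terms_deg n t = lead_terms (graded_part n t I)"
proof -
  have "s = t" if "u \<in> lead_terms (graded_part n s I)" "u \<in> terms_deg n t" for s u
    using that lead_terms_graded_part[of s I] by (auto simp: terms_deg_def)
  then show ?thesis using lead_terms_graded_part[of t I] unfolding initial_terms_def by blast
qed

lemma up_closed_initial_terms:
  fixes I :: "'a::field spoly set"
  assumes I: "poly_ideal n I"
  shows "up_closed n (initial_terms I)"
  unfolding up_closed_def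
proof (intro conjI ballI)
  show "initial_terms I \<subseteq> terms n"
    unfolding initial_terms_def using lead_terms_graded_part terms_deg_subset by blast
  fix t u assume "t \<in> initial_terms I" and u: "u \<in> terms n"
  then obtain k f where f: "f \<in> graded_part n k I" "is_lead f t"
    by (auto simp: initial_terms_def lead_terms_def)
  have u': "(of_term u :: 'a spoly) \<in> forms n (expo_deg u)" using u by (simp add: forms_def terms_deg_def)
  have "of_term u * f \<in> graded_part n (expo_deg u + k) I"
    using f(1) forms_mult[OF u'] poly_ideal_mult[OF I polys_of_term[OF u]] by (simp add: graded_part_def)
  moreover have "is_lead (of_term u * f) (u + t)"
    unfolding is_lead_def
  proof (intro conjI ballI impI)
    show "u + t \<in> ks (of_term u * f)"
      using f(2) by (simp add: is_lead_def in_keys_iff lookup_of_term_times)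
    fix s assume s: "s \<in> ks (of_term u * f)" "s \<noteq> u + t"
    then obtain v where v: "v \<in> ks f" "s = u + v" using keys_of_term_times by blast
    have "ks f \<subseteq> terms n" using f(1) terms_deg_subset by (auto simp: graded_part_def forms_def)
    moreover have "prec v t" using f(2) v s(2) by (auto simp: is_lead_def)
    ultimately show "prec s (u + t)"
      using prec_add[of v t u] v u f(2) by (auto simp: is_lead_def add.commute)
  qed
  ultimately show "u + t \<in> initial_terms I" unfolding initial_terms_def lead_terms_def by blast
qed

text \<open>The saturation of the initial ideal is again a point of the Hilbert scheme. Hence it is
  regular as well, and by dimension count it agrees with the initial ideal itself from the Gotzmann
  number on.\<close>

lemma saturation_lead_terms:
  fixes I :: "'a::field spoly set"
  assumes I: "I \<in> hilb n p" and r: "gotzmann_number TYPE('a) n p r" "r \<le> d" "r \<le> m"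
    and L: "set L = lead_terms (graded_part n d I)"
  shows "graded_part n m (saturation n (ideal_gen n (vs L :: 'a spoly set)))
    = mp_span (of_term ` lead_terms (graded_part n m I))"
proof -
  let ?T = "initial_terms I" and ?S = "term_saturation n (initial_terms I)"
  let ?G = "supported ?S :: 'a spoly set"
  have pI: "poly_ideal n I" by (rule hilb_poly_ideal[OF I])
  have T: "up_closed n ?T" by (rule up_closed_initial_terms[OF pI])
  have S: "up_closed n ?S" by (rule up_closed_term_saturation[OF T])
  have Tn: "?T \<subseteq> terms n" and Sn: "?S \<subseteq> terms n" using S T by (auto simp: up_closed_def)
  have dimI: "mp_dim (graded_part n t I) = card (?T \<inter> terms_deg n t)" for t
    unfolding initial_terms_degree
    by (rule dim_eq_card_lead_terms[where m = t, OF subspace_graded_part[OF pI]]) (auto simp: graded_part_def)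
  have dimG: "mp_dim (graded_part n t ?G) = card (?S \<inter> terms_deg n t)" for t
    unfolding graded_part_supported[OF Sn] by (rule dim_span_of_term)
  have G: "?G \<in> hilb n p"
    unfolding hilb_def
  proof (intro CollectI conjI)
    show "homogeneous_ideal n ?G" by (rule homogeneous_ideal_supported[OF S])
    show "saturated n ?G"
      unfolding saturated_def saturation_supported[OF S] term_saturation_idem[OF T] ..
    obtain N where N: "\<And>t. N \<le> t \<Longrightarrow> ?S \<inter> terms_deg n t = ?T \<inter> terms_deg n t"
      using term_saturation_eventually[OF T] by blast
    have ev: "\<forall>\<^sub>F t in sequentially. mp_dim (graded_part n t ?G) = mp_dim (graded_part n t I)"
      unfolding eventually_sequentially dimI dimG using N by (intro exI[of _ N]) simp
    have "has_hilbert_poly n I p" using I by (simp add: hilb_def)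
    then show "has_hilbert_poly n ?G p"
      unfolding has_hilbert_poly_def by (rule eventually_elim2[OF _ ev]) simp
  qed
  have eq: "?S \<inter> terms_deg n t = ?T \<inter> terms_deg n t" if "r \<le> t" for t
  proof -
    have "card (?S \<inter> terms_deg n t) = card (?T \<inter> terms_deg n t)"
      using dim_graded_part_hilb[OF G r(1) that] dim_graded_part_hilb[OF I r(1) that] dimI dimG by simp
    then show ?thesis
      using card_subset_eq[of "?S \<inter> terms_deg n t" "?T \<inter> terms_deg n t"] subset_term_saturation[OF T] by auto
  qed
  \<comment> \<open>\<open>L\<close> records degree \<open>d\<close> only, but a saturated regular
    ideal is recovered from that degree.\<close>
  have "vs L = graded_part n d ?G"
    unfolding vs_def L graded_part_supported[OF Sn] eq[OF r(2)] initial_terms_degree ..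
  then have "saturation n (ideal_gen n (vs L)) = ?G"
    using saturation_ideal_gen_graded_part[OF G r(1,2)] by simp
  then show ?thesis
    unfolding graded_part_supported[OF Sn] using eq[OF r(3)] graded_part_supported[OF Sn, of m]
    by (simp add: initial_terms_degree)
qed

end

section \<open>Evaluation of polynomials\<close>

definition expo_eval :: "('v \<Rightarrow> 'b::comm_ring_1) \<Rightarrow> 'v expo \<Rightarrow> 'b" where
  "expo_eval x e = (\<Prod>v\<in>ks e. x v ^ lk e v)"

lemma expo_eval_superset:
  assumes "finite A" "ks e \<subseteq> A"
  shows "expo_eval x e = (\<Prod>v\<in>A. x v ^ lk e v)"
  unfolding expo_eval_def using assms by (intro prod.mono_neutral_left) (auto simp: in_keys_iff)

lemma expo_eval_add: "expo_eval x (e + e') = expo_eval x e * expo_eval x e'"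
  by (simp add: expo_eval_superset[of "ks e \<union> ks e'"] keys_add_nat lookup_add power_add prod.distrib)

lemma expo_eval_zero [simp]: "expo_eval x 0 = 1"
  by (simp add: expo_eval_def)

lemma expo_eval_single [simp]: "expo_eval x (Poly_Mapping.single v k) = x v ^ k"
  by (cases "k = 0") (simp_all add: expo_eval_def)

lemma expo_eval_sum: "expo_eval x (\<Sum>i\<in>A. e i) = (\<Prod>i\<in>A. expo_eval x (e i))"
  by (induction A rule: infinite_finite_induct) (simp_all add: expo_eval_add)

lemma insertion_superset:
  assumes "c 0 = 0" "finite A" "ks f \<subseteq> A"
  shows "insertion c x f = (\<Sum>e\<in>A. c (lk f e) * expo_eval x e)"
  unfolding insertion_def expo_eval_def using assms
  by (intro sum.mono_neutral_left) (auto simp: in_keys_iff)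

lemma insertion_add:
  assumes "c 0 = 0" "\<And>a b. c (a + b) = c a + c b"
  shows "insertion c x (f + g) = insertion c x f + insertion c x g"
proof -
  have "ks (f + g) \<subseteq> ks f \<union> ks g" by (rule keys_add)
  then show ?thesis
    by (simp add: insertion_superset[of c, OF assms(1), of "ks f \<union> ks g"] lookup_add assms(2)
        distrib_right sum.distrib)
qed

lemma insertion_zero [simp]: "insertion c x 0 = 0"
  by (simp add: insertion_def)

lemma insertion_sum:
  assumes "c 0 = 0" "\<And>a b. c (a + b) = c a + c b"
  shows "insertion c x (\<Sum>i\<in>A. f i) = (\<Sum>i\<in>A. insertion c x (f i))"
  by (induction A rule: infinite_finite_induct) (simp_all add: insertion_add[OF assms])

lemma insertion_single:
  assumes "c 0 = 0"
  shows "insertion c x (Poly_Mapping.single e a) = c a * expo_eval x e"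
  using insertion_superset[of c, OF assms, of "{e}" "Poly_Mapping.single e a" x] by simp

section \<open>Pluecker coordinates\<close>

lemma basis_list_sum:
  assumes "basis_list B V"
  shows "f \<in> V \<longleftrightarrow> (\<exists>c. f = (\<Sum>i<length B. const (c i) * B ! i))"
    and "(\<Sum>i<length B. const (c i) * B ! i) = 0 \<Longrightarrow> i < length B \<Longrightarrow> c i = 0"
proof -
  have B: "distinct B" "\<not> mp_dependent (set B)" "V = mp_span (set B)"
    using assms by (auto simp: basis_list_def)
  have bij: "bij_betw (\<lambda>i. B ! i) {..<length B} (set B)" using B(1) by (rule bij_betw_nth) auto
  have reindex: "(\<Sum>v\<in>set B. const (u v) * v) = (\<Sum>i<length B. const (u (B ! i)) * B ! i)" for u
    by (rule sum.reindex_bij_betw[OF bij, symmetric])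
  define u where "u c v = c (the_inv_into {..<length B} (\<lambda>i. B ! i) v)" for c :: "nat \<Rightarrow> 'a" and v
  have u2: "u c (B ! i) = c i" if "i < length B" for c i
    using the_inv_into_f_f[OF bij_betw_imp_inj_on[OF bij], of i] that by (simp add: u_def)
  have u1: "(\<Sum>v\<in>set B. const (u c v) * v) = (\<Sum>i<length B. const (c i) * B ! i)" for c
    unfolding reindex by (intro sum.cong refl) (simp add: u2)
  show "f \<in> V \<longleftrightarrow> (\<exists>c. f = (\<Sum>i<length B. const (c i) * B ! i))"
  proof
    assume "f \<in> V"
    then obtain w where "f = (\<Sum>v\<in>set B. const (w v) * v)"
      unfolding B(3) mp.span_finite[OF finite_set] by blast
    then show "\<exists>c. f = (\<Sum>i<length B. const (c i) * B ! i)"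
      unfolding reindex by (rule exI[of _ "\<lambda>i. w (B ! i)"])
  next
    assume "\<exists>c. f = (\<Sum>i<length B. const (c i) * B ! i)"
    then obtain c where "f = (\<Sum>v\<in>set B. const (u c v) * v)" unfolding u1 by blast
    then show "f \<in> V" unfolding B(3) mp.span_finite[OF finite_set] by blast
  qed
  show "c i = 0" if "(\<Sum>i<length B. const (c i) * B ! i) = 0" "i < length B"
  proof -
    have "u c (B ! i) = 0"
      by (rule mp.independentD[OF B(2) finite_set order_refl]) (use that u1 in simp_all)
    then show ?thesis using u2[OF that(2)] by simp
  qed
qed

text \<open>One basis serves all \<open>L\<close>, so identities between different coordinates of
  \<open>V\<close> can be read off a single coefficient matrix.\<close>

lemma pluecker_eq_det:
  fixes V :: "'a::field spoly set"
  assumes "V \<in> Gr n m q"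
  obtains B where "basis_list B V" "length B = q"
    "\<And>L. length L = q \<Longrightarrow> pluecker V L = det (mat q q (\<lambda>(i, j). lk (B ! i) (L ! j)))"
proof -
  have V: "mp_subspace V" "V \<subseteq> forms n m" "mp_dim V = q" using assms by (auto simp: Gr_def)
  obtain S where S: "\<not> mp_dependent S" "mp_span S = V" "finite S"
    by (rule finite_basis_of_forms[OF V(1,2)])
  obtain B where "set B = S" "distinct B" using finite_distinct_list[OF S(3)] by blast
  then have *: "\<exists>B. basis_list B V" using S by (auto simp: basis_list_def)
  define C where "C = (SOME B. basis_list B V)"
  have C: "basis_list C V" unfolding C_def by (rule someI_ex[OF *])
  then have C': "distinct C" "\<not> mp_dependent (set C)" "mp_span (set C) = V" by (simp_all add: basis_list_def)
  have "length C = q"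
    using mp.dim_span_eq_card_independent[OF C'(2)] C'(1,3) V(3) by (simp add: distinct_card)
  then show ?thesis using that[OF C] by (simp add: pluecker_def Let_def C_def)
qed

text \<open>The minor is, up to transposition, the matrix of the map that reads off the coefficients
  at \<open>L\<close>; it is non-singular iff this map is injective on \<open>V\<close>.\<close>

lemma pluecker_nonzero_iff:
  fixes V :: "'a::field spoly set"
  assumes V: "V \<in> Gr n m q" and L: "length L = q"
  shows "pluecker V L \<noteq> 0 \<longleftrightarrow> (\<forall>f\<in>V. (\<forall>t\<in>set L. lk f t = 0) \<longrightarrow> f = 0)"
proof -
  obtain B where B: "basis_list B V" "length B = q"
    and P: "\<And>L. length L = q \<Longrightarrow> pluecker V L = det (mat q q (\<lambda>(i, j). lk (B ! i) (L ! j)))"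
    by (rule pluecker_eq_det[OF V]) blast
  define A where "A = mat q q (\<lambda>(i, j). lk (B ! i) (L ! j))"
  define F where "F v = (\<Sum>i<q. const (v $ i) * B ! i)" for v :: "'a vec"
  have A: "A \<in> carrier_mat q q" "transpose_mat A \<in> carrier_mat q q" by (auto simp: A_def)
  have Fv: "F v \<in> V" for v
    using basis_list_sum(1)[OF B(1), of "F v"] B(2) unfolding F_def by auto
  have surj: "\<exists>v\<in>carrier_vec q. f = F v" if f: "f \<in> V" for f
  proof -
    obtain c where "f = (\<Sum>i<q. const (c i) * B ! i)" using basis_list_sum(1)[OF B(1)] B(2) f by auto
    then have "f = F (vec q c)" by (simp add: F_def)
    then show ?thesis by auto
  qed
  have zero: "v = 0\<^sub>v q \<longleftrightarrow> F v = 0" if "v \<in> carrier_vec q" for v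
  proof
    assume "F v = 0"
    then have "v $ i = 0" if "i < q" for i
      using basis_list_sum(2)[OF B(1), of "\<lambda>i. v $ i" i] B(2) that by (simp add: F_def)
    then show "v = 0\<^sub>v q" using that by (intro eq_vecI) auto
  qed (simp add: F_def const_def)
  have coord: "transpose_mat A *\<^sub>v v = 0\<^sub>v q \<longleftrightarrow> (\<forall>t\<in>set L. lk (F v) t = 0)" if v: "v \<in> carrier_vec q" for v
  proof -
    have "(transpose_mat A *\<^sub>v v) $ j = lk (F v) (L ! j)" if "j < q" for j
      using that v
      by (auto simp: A_def F_def lookup_sum scalar_prod_def atLeast0LessThan intro!: sum.cong)
    moreover have "dim_vec (transpose_mat A *\<^sub>v v) = q" using A(2) by simp
    ultimately have "transpose_mat A *\<^sub>v v = 0\<^sub>v q \<longleftrightarrow> (\<forall>j<q. lk (F v) (L ! j) = 0)"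
      by (simp add: vec_eq_iff)
    also have "\<dots> \<longleftrightarrow> (\<forall>t\<in>set L. lk (F v) t = 0)" using L by (simp add: all_set_conv_all_nth)
    finally show ?thesis .
  qed
  have "pluecker V L = 0 \<longleftrightarrow> det (transpose_mat A) = 0"
    unfolding P[OF L] A_def[symmetric] det_transpose[OF A(1)] ..
  also have "\<dots> \<longleftrightarrow> (\<exists>v\<in>carrier_vec q. F v \<noteq> 0 \<and> (\<forall>t\<in>set L. lk (F v) t = 0))"
    unfolding det_0_iff_vec_prod_zero_field[OF A(2)] using zero coord by blast
  also have "\<dots> \<longleftrightarrow> (\<exists>f\<in>V. f \<noteq> 0 \<and> (\<forall>t\<in>set L. lk f t = 0))"
    using Fv surj by blast
  finally show ?thesis by blast
qed

text \<open>Laplace expansion along column \<open>k\<close>: the cofactors do not depend on that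
  column, and as coefficients of the basis they give a vector whose coefficient at
  \<open>\<sigma>\<close> is the minor with \<open>\<sigma>\<close> in place of
  \<open>L ! k\<close>. It supplies elements of \<open>V\<close> whose coefficients are Pluecker
  coordinates.\<close>

lemma pluecker_column_vector:
  fixes V :: "'a::field spoly set"
  assumes V: "V \<in> Gr n m q" and L: "length L = q" and k: "k < q"
  shows "\<exists>f\<in>V. \<forall>\<sigma>. lk f \<sigma> = pluecker V (L[k := \<sigma>])"
proof -
  obtain B where B: "basis_list B V" "length B = q"
    and P: "\<And>L. length L = q \<Longrightarrow> pluecker V L = det (mat q q (\<lambda>(i, j). lk (B ! i) (L ! j)))"
    by (rule pluecker_eq_det[OF V]) blast
  let ?A = "\<lambda>L. mat q q (\<lambda>(i, j). lk (B ! i) (L ! j)) :: 'a mat"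
  define f where "f = (\<Sum>i<q. const (cofactor (?A L) i k) * B ! i)"
  have "\<exists>c. f = (\<Sum>i<length B. const (c i) * B ! i)" 
    unfolding f_def B(2) by (rule exI[of _ "\<lambda>i. cofactor (?A L) i k"]) (rule refl)
  then have "f \<in> V" using basis_list_sum(1)[OF B(1)] by blast
  moreover have "lk f \<sigma> = pluecker V (L[k := \<sigma>])" for \<sigma>
  proof -
    let ?M = "?A (L[k := \<sigma>])"
    have "cofactor ?M i k = cofactor (?A L) i k" if "i < q" for i
    proof -
      have "mat_delete ?M i k = mat_delete (?A L) i k"
        using that k L by (intro eq_matI) (auto simp: mat_delete_def)
      then show ?thesis by (simp add: cofactor_def)
    qed
    moreover have "?M $$ (i, k) = lk (B ! i) \<sigma>" if "i < q" for i using that k L by simp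
    ultimately have "det ?M = (\<Sum>i<q. lk (B ! i) \<sigma> * cofactor (?A L) i k)"
      using laplace_expansion_column[of ?M q k] k by simp
    also have "\<dots> = lk f \<sigma>"
      unfolding f_def lookup_sum
      by (intro sum.cong refl trans[OF mult.commute lookup_const_mult[symmetric]])
    finally show ?thesis using P[of "L[k := \<sigma>]"] L by simp
  qed
  ultimately show ?thesis by blast
qed

text \<open>Cramer's rule for the minor at \<open>L\<close>, from the product of a matrix with its
  adjugate. It is linear both in \<open>h\<close> and in the Pluecker coordinates.\<close>

lemma pluecker_relation:
  fixes V :: "'a::field spoly set"
  assumes V: "V \<in> Gr n m q" and L: "length L = q" and h: "h \<in> V"
  shows "pluecker V L * lk h \<sigma> = (\<Sum>k<q. pluecker V (L[k := \<sigma>]) * lk h (L ! k))"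
proof -
  obtain B where B: "basis_list B V" "length B = q"
    and P: "\<And>L. length L = q \<Longrightarrow> pluecker V L = det (mat q q (\<lambda>(i, j). lk (B ! i) (L ! j)))"
    by (rule pluecker_eq_det[OF V]) blast
  define A where "A = (mat q q (\<lambda>(i, j). lk (B ! i) (L ! j)) :: 'a mat)"
  have A: "A \<in> carrier_mat q q" by (simp add: A_def)
  obtain c where c: "h = (\<Sum>i<q. const (c i) * B ! i)" using basis_list_sum(1)[OF B(1)] B(2) h by auto
  have col: "pluecker V (L[k := \<sigma>]) = (\<Sum>i<q. lk (B ! i) \<sigma> * cofactor A i k)" if k: "k < q" for k
  proof -
    let ?M = "mat q q (\<lambda>(i, j). lk (B ! i) (L[k := \<sigma>] ! j)) :: 'a mat"
    have "cofactor ?M i k = cofactor A i k" if "i < q" for i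
    proof -
      have "mat_delete ?M i k = mat_delete A i k"
        using that k L by (intro eq_matI) (auto simp: mat_delete_def A_def)
      then show ?thesis by (simp add: cofactor_def)
    qed
    moreover have "?M $$ (i, k) = lk (B ! i) \<sigma>" if "i < q" for i using that k L by simp
    ultimately show ?thesis
      using laplace_expansion_column[of ?M q k] k P[of "L[k := \<sigma>]"] L by simp
  qed
  have adj: "(\<Sum>k<q. A $$ (j, k) * cofactor A i k) = (if i = j then det A else 0)" if ij: "i < q" "j < q" for i j
  proof -
    have "(A * adj_mat A) $$ (j, i) = (\<Sum>k<q. A $$ (j, k) * cofactor A i k)"
      using ij A by (simp add: adj_mat_def scalar_prod_def atLeast0LessThan)
    then show ?thesis using adj_mat(2)[OF A] ij by auto
  qed
  have "(\<Sum>k<q. pluecker V (L[k := \<sigma>]) * lk h (L ! k))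
      = (\<Sum>k<q. (\<Sum>i<q. lk (B ! i) \<sigma> * cofactor A i k) * (\<Sum>j<q. c j * A $$ (j, k)))"
  proof (intro sum.cong refl arg_cong2[where f = times])
    fix k assume "k \<in> {..<q}"
    then show "pluecker V (L[k := \<sigma>]) = (\<Sum>i<q. lk (B ! i) \<sigma> * cofactor A i k)"
      and "lk h (L ! k) = (\<Sum>j<q. c j * A $$ (j, k))"
      using col by (auto simp: c lookup_sum A_def)
  qed
  also have "\<dots> = (\<Sum>k<q. \<Sum>i<q. \<Sum>j<q. lk (B ! i) \<sigma> * c j * (A $$ (j, k) * cofactor A i k))"
    unfolding sum_product by (intro sum.cong refl) (simp add: mult_ac)
  also have "\<dots> = (\<Sum>i<q. \<Sum>k<q. \<Sum>j<q. lk (B ! i) \<sigma> * c j * (A $$ (j, k) * cofactor A i k))"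
    by (rule sum.swap)
  also have "\<dots> = (\<Sum>i<q. \<Sum>j<q. \<Sum>k<q. lk (B ! i) \<sigma> * c j * (A $$ (j, k) * cofactor A i k))"
    by (intro sum.cong refl sum.swap)
  also have "\<dots> = (\<Sum>i<q. \<Sum>j<q. if i = j then lk (B ! i) \<sigma> * c j * det A else 0)"
    using adj by (intro sum.cong refl) (simp flip: sum_distrib_left)
  also have "\<dots> = (\<Sum>i<q. lk (B ! i) \<sigma> * c i * det A)"
    by (intro sum.cong refl) simp
  also have "\<dots> = pluecker V L * lk h \<sigma>"
    using P[OF L] by (simp add: c lookup_sum A_def sum_distrib_left sum_distrib_right mult_ac)
  finally show ?thesis by simp
qed

lemma pluecker_not_distinct:
  fixes V :: "'a::field spoly set"
  assumes V: "V \<in> Gr n m q" and L: "length L = q" "\<not> distinct L"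
  shows "pluecker V L = 0"
proof -
  obtain B where
    P: "\<And>L. length L = q \<Longrightarrow> pluecker V L = det (mat q q (\<lambda>(i, j). lk (B ! i) (L ! j)))"
    by (rule pluecker_eq_det[OF V]) blast
  obtain i j where ij: "i < q" "j < q" "i \<noteq> j" "L ! i = L ! j"
    using L by (auto simp: distinct_conv_nth)
  have "det (mat q q (\<lambda>(i, j). lk (B ! i) (L ! j))) = 0"
    by (rule det_identical_columns[of _ q i j]) (use ij in \<open>auto intro!: eq_vecI\<close>)
  then show ?thesis using P[OF L(1)] by simp
qed

text \<open>The sign is chosen before \<open>V\<close>, because it becomes a coefficient of one
  polynomial that is evaluated at all \<open>V\<close>.\<close>

lemma pluecker_permute:
  assumes "mset L' = mset L"
  obtains \<epsilon> :: "'a::field" where "\<epsilon> \<in> {1, -1}"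
    "\<And>n m q V. V \<in> Gr n m q \<Longrightarrow> length L = q \<Longrightarrow> pluecker V L' = \<epsilon> * pluecker V L"
proof -
  obtain p where p: "p permutes {..<length L}" "permute_list p L = L'"
    using mset_eq_permutation[OF assms] by blast
  show ?thesis
  proof (rule that[of "signof p"])
    show "signof p \<in> {1 :: 'a, -1}" by (auto simp: sign_def)
    fix n m q and V :: "'a spoly set" assume V: "V \<in> Gr n m q" and q: "length L = q"
    have q': "length L' = q" using q p(2) by auto
    obtain B where
      P: "\<And>L. length L = q \<Longrightarrow> pluecker V L = det (mat q q (\<lambda>(i, j). lk (B ! i) (L ! j)))"
      by (rule pluecker_eq_det[OF V]) blast
    let ?A = "\<lambda>L. mat q q (\<lambda>(i, j). lk (B ! i) (L ! j)) :: 'a mat"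
    have p': "p permutes {0..<q}" using p(1) q by (simp add: atLeast0LessThan)
    have "L' ! j = L ! p j" if "j < q" for j
      using p(2) permute_list_nth[OF p(1)] that q by auto
    moreover have "p j < q" if "j < q" for j
      using permutes_in_image[OF p', of j] that by simp
    ultimately have "transpose_mat (?A L') = mat q q (\<lambda>(i, j). transpose_mat (?A L) $$ (p i, j))"
      by (intro eq_matI) auto
    then have "det (transpose_mat (?A L')) = signof p * det (transpose_mat (?A L))"
      using det_permute_rows[of "transpose_mat (?A L)" q p] p' by simp
    then show "pluecker V L' = signof p * pluecker V L"
      using P[OF q] P[OF q'] det_transpose[of "?A L" q] det_transpose[of "?A L'" q] by simp
  qed
qed

section \<open>Closed sets defined by determinants of Pluecker coordinates\<close>

context monomial_order
begin

lemma ex_sorted_list: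
  assumes "finite A" "A \<subseteq> terms n"
  obtains L where "set L = A" "sorted_wrt (\<lambda>s t. prec t s) L" "length L = card A"
  using assms
proof (induction "card A" arbitrary: A thesis)
  case 0
  then show ?case by (intro "0.prems"(1)[of "[]"]) auto
next
  case (Suc k)
  have "A \<noteq> {}" using Suc.hyps(2) by force
  then obtain t where t: "t \<in> A" "\<forall>s\<in>A. s \<noteq> t \<longrightarrow> prec s t"
    using ex_greatest_term[OF Suc.prems(2) _ Suc.prems(3)] by blast
  have k: "k = card (A - {t})" using Suc.hyps(2) Suc.prems(2) t(1) by simp
  obtain L where L: "set L = A - {t}" "sorted_wrt (\<lambda>s t. prec t s) L" "length L = card (A - {t})"
    by (rule Suc.hyps(1)[OF k]) (use Suc.prems(2,3) in auto)
  show ?case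
    by (rule Suc.prems(1)[of "t # L"]) (use L t k Suc.hyps(2) in auto)
qed

lemma distinct_sorted: "sorted_wrt (\<lambda>s t. prec t s) L \<Longrightarrow> set L \<subseteq> terms n \<Longrightarrow> distinct L"
proof (induction L)
  case (Cons t L)
  then show ?case using prec_irrefl[of t] by auto
qed simp

text \<open>\<open>zclosed\<close> admits as variables only sorted extensors and as coefficients
  only elements of \<open>K\<close>; hence a sorted \<open>M\<close> and a sign. The coefficient 0
  gives vanishing entries the same shape, which keeps the Leibniz formula homogeneous.\<close>

definition pluecker_entry :: "nat \<Rightarrow> nat \<Rightarrow> ('a::field spoly set \<Rightarrow> 'a) \<Rightarrow> bool" where
  "pluecker_entry m q \<phi> \<longleftrightarrow>
     (\<exists>\<epsilon>\<in>{0, 1, -1}. \<exists>M\<in>extensors n prec m q. \<forall>V\<in>Gr n m q. \<phi> V = \<epsilon> * pluecker V M)"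

text \<open>Sorting costs a sign, and a repeated term gives the value 0, for which \<open>L0\<close>
  supplies the extensor.\<close>

lemma pluecker_entry_pluecker:
  assumes ext: "L0 \<in> extensors n prec m q" and L: "length L = q" "set L \<subseteq> terms_deg n m"
  shows "pluecker_entry m q (\<lambda>V :: 'a::field spoly set. pluecker V L)"
proof (cases "distinct L")
  case True
  have sub: "set L \<subseteq> terms n" using L(2) terms_deg_subset by blast
  obtain M where M: "set M = set L" "sorted_wrt (\<lambda>s t. prec t s) M" "length M = card (set L)"
    by (rule ex_sorted_list[OF finite_set sub])
  have "distinct M" by (rule distinct_sorted[OF M(2)]) (use M(1) sub in simp)
  then have "mset L = mset M" using True M(1) set_eq_iff_mset_eq_distinct by metis
  then obtain \<epsilon> :: 'a where \<epsilon>: "\<epsilon> \<in> {1, -1}"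
    "\<And>n m q V. V \<in> Gr n m q \<Longrightarrow> length M = q \<Longrightarrow> pluecker V L = \<epsilon> * pluecker V M"
    by (rule pluecker_permute) blast
  have len: "length M = q" using M(3) True L(1) by (simp add: distinct_card)
  have "M \<in> extensors n prec m q" using M L(2) len by (simp add: extensors_def)
  then show ?thesis unfolding pluecker_entry_def using \<epsilon>(1) \<epsilon>(2)[OF _ len] by blast
next
  case False
  have "\<forall>V\<in>Gr n m q. pluecker V L = (0 :: 'a) * pluecker V L0"
    using pluecker_not_distinct[OF _ L(1) False] by auto
  then show ?thesis unfolding pluecker_entry_def using ext by blast
qed

lemma pluecker_entry_zero:
  "L0 \<in> extensors n prec m q \<Longrightarrow> pluecker_entry m q (\<lambda>V. 0)"
  unfolding pluecker_entry_def by (intro bexI[of _ 0] bexI[of _ L0]) auto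

lemma pluecker_entry_uminus:
  assumes "pluecker_entry m q \<phi>"
  shows "pluecker_entry m q (\<lambda>V. - \<phi> V)"
proof -
  obtain \<epsilon> M where *: "\<epsilon> \<in> {0, 1, -1}" "M \<in> extensors n prec m q" "\<forall>V\<in>Gr n m q. \<phi> V = \<epsilon> * pluecker V M"
    using assms unfolding pluecker_entry_def by blast
  then show ?thesis unfolding pluecker_entry_def by (intro bexI[of _ "-\<epsilon>"] bexI[of _ M]) auto
qed

text \<open>By the Leibniz formula the determinant is a single form of degree \<open>N\<close> in
  the Pluecker coordinates, with coefficients in \<open>K\<close>. All closed sets constructed in
  the proof come from here.\<close>

lemma zclosed_det:
  fixes \<phi> :: "nat \<Rightarrow> nat \<Rightarrow> 'a::field spoly set \<Rightarrow> 'a"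
  assumes K: "subfield_set K" and q: "q = hilb_q n p m"
    and gr: "\<And>I :: 'a spoly set. I \<in> hilb n p \<Longrightarrow> graded_part n m I \<in> Gr n m q"
    and \<phi>: "\<And>i j. i < N \<Longrightarrow> j < N \<Longrightarrow> pluecker_entry m q (\<phi> i j)"
  shows "zclosed K n prec p m
    {I \<in> hilb n p. det (mat N N (\<lambda>(i, j). \<phi> i j (graded_part n m I))) = 0}"
proof -
  define Q where "Q i j \<epsilon> M \<longleftrightarrow> \<epsilon> \<in> {0, 1, -1} \<and> M \<in> extensors n prec m q
      \<and> (\<forall>V\<in>Gr n m q. \<phi> i j V = \<epsilon> * pluecker V M)" for i j \<epsilon> M
  have "\<exists>\<epsilon> M. Q i j \<epsilon> M" if "i < N" "j < N" for i j
    using \<phi>[OF that] unfolding pluecker_entry_def Q_def Bex_def by blast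
  then obtain \<epsilon> M where Q: "\<And>i j. i < N \<Longrightarrow> j < N \<Longrightarrow> Q i j (\<epsilon> i j) (M i j)"
    by metis
  note e = Q[unfolded Q_def, THEN conjunct1]
  note M = Q[unfolded Q_def, THEN conjunct2, THEN conjunct1]
  note eM = Q[unfolded Q_def, THEN conjunct2, THEN conjunct2, rule_format]
  let ?P = "{\<pi>. \<pi> permutes {0..<N}}"
  \<comment> \<open>Exponent and coefficient of the summand of \<open>\<pi>\<close>. Different
    permutations may share an exponent, so \<open>f\<close> is a sum of single monomials rather than
    a table of coefficients.\<close>
  define E where "E \<pi> = (\<Sum>i\<in>{0..<N}. Poly_Mapping.single (M i (\<pi> i)) (1::nat))" for \<pi>
  define C :: "_ \<Rightarrow> 'a" where "C \<pi> = signof \<pi> * (\<Prod>i\<in>{0..<N}. \<epsilon> i (\<pi> i))" for \<pi>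
  define f where "f = (\<Sum>\<pi>\<in>?P. Poly_Mapping.single (E \<pi>) (C \<pi>))"
  have \<pi>: "\<pi> i < N" if "\<pi> \<in> ?P" "i < N" for \<pi> i
    using that permutes_in_image[of \<pi> "{0..<N}" i] by simp
  have K01: "0 \<in> K" "1 \<in> K" "-1 \<in> K" and Kadd: "\<And>a b. a \<in> K \<Longrightarrow> b \<in> K \<Longrightarrow> a + b \<in> K"
    and Kmult: "\<And>a b. a \<in> K \<Longrightarrow> b \<in> K \<Longrightarrow> a * b \<in> K"
    using K by (auto simp: subfield_set_def)
  have Ksum: "sum g A \<in> K" if "\<And>i. i \<in> A \<Longrightarrow> g i \<in> K" for A and g :: "(nat \<Rightarrow> nat) \<Rightarrow> 'a"
    using that by (induction A rule: infinite_finite_induct) (auto intro: K01 Kadd)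
  have Kprod: "prod g A \<in> K" if "\<And>i. i \<in> A \<Longrightarrow> g i \<in> K" for A and g :: "nat \<Rightarrow> 'a"
    using that by (induction A rule: infinite_finite_induct) (auto intro: K01 Kmult)
  have CK: "C \<pi> \<in> K" if "\<pi> \<in> ?P" for \<pi>
    unfolding C_def
  proof (intro Kmult Kprod)
    show "signof \<pi> \<in> K" using K01 by (simp add: sign_def)
    fix i assume "i \<in> {0..<N}"
    then show "\<epsilon> i (\<pi> i) \<in> K" using e[of i "\<pi> i"] \<pi>[OF that, of i] K01 by auto
  qed
  have "lk f x \<in> K" for x
    unfolding f_def lookup_sum using CK K01 by (intro Ksum) (auto simp: lookup_single when_def)
  then have range: "Poly_Mapping.range f \<subseteq> K" by (auto simp: range.rep_eq)
  have keysf: "expo_deg x = N \<and> ks x \<subseteq> extensors n prec m q" if "x \<in> ks f" for x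
  proof -
    have "x \<in> (\<Union>\<pi>\<in>?P. ks (Poly_Mapping.single (E \<pi>) (C \<pi>)))"
      by (rule subsetD[OF keys_sum]) (use that in \<open>simp only: f_def\<close>)
    then obtain \<rho> where \<rho>: "\<rho> \<in> ?P" "x \<in> ks (Poly_Mapping.single (E \<rho>) (C \<rho>))" by (rule UN_E)
    then have x: "x = E \<rho>" by (cases "C \<rho> = 0") simp_all
    have deg: "expo_deg (\<Sum>i\<in>A. Poly_Mapping.single (M i (\<rho> i)) (1::nat)) = card A" if "finite A" for A
      using that by (induction A) auto
    have "ks (E \<rho>) \<subseteq> (\<Union>i\<in>{0..<N}. ks (Poly_Mapping.single (M i (\<rho> i)) (1::nat)))"
      unfolding E_def by (rule keys_sum)
    moreover have "ks (Poly_Mapping.single (M i (\<rho> i)) (1::nat)) \<subseteq> extensors n prec m q" if "i \<in> {0..<N}" for i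
      using M[of i "\<rho> i"] \<pi>[OF \<rho>(1), of i] that by simp
    ultimately have "ks x \<subseteq> extensors n prec m q" unfolding x by blast
    moreover have "expo_deg x = N" unfolding x E_def using deg[of "{0..<N}"] by simp
    ultimately show ?thesis by blast
  qed
  have eval: "insertion (\<lambda>a. a) (pluecker V) f = det (mat N N (\<lambda>(i, j). \<phi> i j V))" if V: "V \<in> Gr n m q" for V
  proof -
    have "insertion (\<lambda>a. a) (pluecker V) f = (\<Sum>\<pi>\<in>?P. C \<pi> * (\<Prod>i\<in>{0..<N}. pluecker V (M i (\<pi> i))))"
      unfolding f_def by (simp add: insertion_sum insertion_single E_def expo_eval_sum)
    also have "\<dots> = (\<Sum>\<pi>\<in>?P. signof \<pi> * (\<Prod>i\<in>{0..<N}. \<epsilon> i (\<pi> i) * pluecker V (M i (\<pi> i))))"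
      by (simp add: C_def prod.distrib mult.assoc)
    also have "\<dots> = (\<Sum>\<pi>\<in>?P. signof \<pi> * (\<Prod>i\<in>{0..<N}. mat N N (\<lambda>(i, j). \<phi> i j V) $$ (i, \<pi> i)))"
      using eM[OF _ _ V] \<pi> by (intro sum.cong refl arg_cong2[where f = times] prod.cong) auto
    also have "\<dots> = det (mat N N (\<lambda>(i, j). \<phi> i j V))"
      by (rule det_def'[symmetric]) simp
    finally show ?thesis .
  qed
  show ?thesis
    unfolding zclosed_def q[symmetric]
  proof (intro exI[of _ "{f}"] conjI ballI)
    show "\<exists>k. \<forall>e\<in>ks f'. expo_deg e = k \<and> ks e \<subseteq> extensors n prec m q" if "f' \<in> {f}" for f'
      using that keysf by (intro exI[of _ N]) simp
    show "{I \<in> hilb n p. det (mat N N (\<lambda>(i, j). \<phi> i j (graded_part n m I))) = 0}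
      = {I \<in> hilb n p. \<forall>f\<in>{f}. insertion (\<lambda>a. a) (pluecker (graded_part n m I)) f = 0}"
      using eval[OF gr] by (intro Collect_cong conj_cong refl) simp
  qed (use range in simp)
qed

end

section \<open>Neighbourhoods of a monomial ideal\<close>

lemma det_scalar: "det (mat N N (\<lambda>(i, j). if i = j then a else 0)) = (a :: 'a::comm_ring_1) ^ N"
proof -
  have "mat N N (\<lambda>(i, j). if i = j then a else 0) = a \<cdot>\<^sub>m 1\<^sub>m N" by (intro eq_matI) auto
  then show ?thesis by simp
qed

text \<open>The matrix is the product of the coordinates of the \<open>v i\<close> in a basis with
  the minor at \<open>R\<close>, so the Pluecker coordinate at \<open>R\<close> is not 0.\<close>

lemma nonsingular_coordinates:
  fixes V :: "'a::field spoly set"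
  assumes V: "V \<in> Gr n m N" and R: "length R = N" and v: "\<And>i. i < N \<Longrightarrow> v i \<in> V"
    and det: "det (mat N N (\<lambda>(i, j). lk (v i) (R ! j))) \<noteq> 0"
    and f: "f \<in> V" "\<forall>t\<in>set R. lk f t = 0"
  shows "f = 0"
proof -
  obtain B where B: "basis_list B V" "length B = N"
    and P: "\<And>L. length L = N \<Longrightarrow> pluecker V L = det (mat N N (\<lambda>(i, j). lk (B ! i) (L ! j)))"
    by (rule pluecker_eq_det[OF V]) blast
  let ?A = "mat N N (\<lambda>(i, j). lk (B ! i) (R ! j)) :: 'a mat"
  have "\<exists>c. v i = (\<Sum>k<N. const (c k) * B ! k)" if "i < N" for i
    using basis_list_sum(1)[OF B(1)] v[OF that] B(2) by simp
  then obtain c where c: "\<And>i. i < N \<Longrightarrow> v i = (\<Sum>k<N. const (c i k) * B ! k)" by metis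
  let ?C = "mat N N (\<lambda>(i, k). c i k)"
  have "mat N N (\<lambda>(i, j). lk (v i) (R ! j)) = ?C * ?A"
    by (intro eq_matI) (auto simp: c lookup_sum scalar_prod_def atLeast0LessThan)
  then have "det ?C * det ?A \<noteq> 0" using det det_mult[of ?C N ?A] by simp
  then have "pluecker V R \<noteq> 0" using P[OF R] by simp
  then show ?thesis using pluecker_nonzero_iff[OF V R] f by blast
qed

text \<open>Replacing \<open>L ! k\<close> by another term either repeats a column or gives, by
  \<open>pluecker_column_vector\<close>, the coefficient of an element of \<open>V\<close> at a term
  outside \<open>L\<close>. This is what makes the matrices for the two open conditions scalar at
  \<open>J\<close>.\<close>

lemma pluecker_monomial:
  fixes V :: "'a::field spoly set"
  assumes V: "V \<in> Gr n m q" "V = mp_span (of_term ` set L)" and L: "length L = q" "distinct L"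
  shows "pluecker V L \<noteq> 0"
    and "k < q \<Longrightarrow> pluecker V (L[k := \<sigma>]) = (if \<sigma> = L ! k then pluecker V L else 0)"
proof -
  show "pluecker V L \<noteq> 0"
    unfolding pluecker_nonzero_iff[OF V(1) L(1)]
  proof (intro ballI impI)
    fix f assume "f \<in> V" "\<forall>t\<in>set L. lk f t = 0"
    then show "f = 0" unfolding V(2) span_of_term by (intro poly_mapping_eqI) (auto simp: in_keys_iff)
  qed
  assume k: "k < q"
  consider "\<sigma> = L ! k" | "\<sigma> \<in> set L" "\<sigma> \<noteq> L ! k" | "\<sigma> \<notin> set L" by blast
  then show "pluecker V (L[k := \<sigma>]) = (if \<sigma> = L ! k then pluecker V L else 0)"
  proof cases
    case 2
    then obtain l where l: "l < q" "\<sigma> = L ! l" using L(1) by (metis in_set_conv_nth)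
    then have "l \<noteq> k" using 2 by auto
    then have "L[k := \<sigma>] ! l = L[k := \<sigma>] ! k" using l L(1) k by simp
    then have "\<not> distinct (L[k := \<sigma>])"
      using \<open>l \<noteq> k\<close> l(1) k L(1) by (metis length_list_update nth_eq_iff_index_eq)
    then show ?thesis using pluecker_not_distinct[OF V(1)] L(1) 2 by simp
  next
    case 3
    obtain f where "f \<in> V" "\<forall>\<sigma>. lk f \<sigma> = pluecker V (L[k := \<sigma>])"
      using pluecker_column_vector[OF V(1) L(1) k] by blast
    moreover from this have "lk f \<sigma> = 0" using 3 unfolding V(2) span_of_term by (auto simp: in_keys_iff)
    moreover have "\<sigma> \<noteq> L ! k" using 3 k L(1) by auto
    ultimately show ?thesis by simp
  qed simp
qed

lemma graded_part_in_Gr: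
  fixes I :: "'a::field spoly set"
  assumes "I \<in> hilb n p" "gotzmann_number TYPE('a) n p r" "r \<le> t"
  shows "graded_part n t I \<in> Gr n t (hilb_q n p t)"
  using subspace_graded_part[OF hilb_poly_ideal[OF assms(1)]] dim_graded_part_hilb[OF assms]
  by (simp add: Gr_def graded_part_def)

text \<open>\<open>T'\<close> consists of the multiples of the degree \<open>d\<close> terms of
  \<open>T\<close>; \<open>regular_generated\<close> with \<open>M = supported T'\<close> shows that
  \<open>J_m\<close> has no other terms.\<close>

lemma generated_terms:
  fixes J :: "'a::field spoly set"
  assumes J: "J \<in> hilb n p" "J = supported T" and T: "up_closed n T"
    and r: "gotzmann_number TYPE('a) n p r" "r \<le> d" "d \<le> m" and t: "t \<in> T \<inter> terms_deg n m"
  obtains s u where "s \<in> terms_deg n (m - d)" "u \<in> T \<inter> terms_deg n d" "t = s + u"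
proof -
  have Tn: "T \<subseteq> terms n" using T by (simp add: up_closed_def)
  define T' where "T' = {s + u | s u. s \<in> terms n \<and> u \<in> T \<inter> terms_deg n d}"
  have "up_closed n T'"
    unfolding up_closed_def
  proof (intro conjI ballI)
    show "T' \<subseteq> terms n" using Tn by (auto simp: T'_def)
    fix a b assume "a \<in> T'" "b \<in> terms n"
    then obtain s u where "a = s + u" "s \<in> terms n" "u \<in> T \<inter> terms_deg n d" by (auto simp: T'_def)
    then have "b + a = (b + s) + u" "b + s \<in> terms n" using \<open>b \<in> terms n\<close> by (simp_all add: add.assoc)
    then show "b + a \<in> T'" using \<open>u \<in> T \<inter> terms_deg n d\<close> unfolding T'_def by blast
  qed
  then have "poly_ideal n (supported T' :: 'a spoly set)"
    using homogeneous_ideal_supported homogeneous_ideal_def by blast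
  moreover have "T \<inter> terms_deg n d \<subseteq> T'"
  proof
    fix u assume "u \<in> T \<inter> terms_deg n d"
    then show "u \<in> T'" unfolding T'_def by (intro CollectI exI[of _ 0] exI[of _ u]) simp
  qed
  then have "graded_part n d J \<subseteq> supported T'"
    unfolding J(2) graded_part_supported[OF Tn] span_of_term by (auto simp: supported_def)
  moreover have "regular n r J" using r(1) J(1) by (simp add: gotzmann_number_def)
  ultimately have "graded_part n m J \<subseteq> supported T'" using regular_generated r(2,3) by blast
  moreover have "of_term t \<in> graded_part n m J"
    unfolding J(2) graded_part_supported[OF Tn] span_of_term using t by simp
  ultimately have "(of_term t :: 'a spoly) \<in> supported T'" by blast
  then obtain s u where su: "t = s + u" "s \<in> terms n" "u \<in> T \<inter> terms_deg n d"
    by (auto simp: T'_def supported_def)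
  then have "s \<in> terms_deg n (m - d)" using t by (auto simp: terms_deg_def)
  then show ?thesis using that su by blast
qed

context monomial_order
begin

lemma extensor_of_monomial_ideal:
  fixes J :: "'a::field spoly set"
  assumes J: "J \<in> hilb n p" "J = supported T" and T: "up_closed n T"
    and r: "gotzmann_number TYPE('a) n p r" "r \<le> d"
  obtains L where "L \<in> extensors n prec d (hilb_q n p d)" "set L = T \<inter> terms_deg n d" "distinct L"
    "length L = hilb_q n p d" "graded_part n d J = mp_span (of_term ` set L)"
proof -
  have Tn: "T \<subseteq> terms n" using T by (simp add: up_closed_def)
  obtain L where L: "set L = T \<inter> terms_deg n d" "sorted_wrt (\<lambda>s t. prec t s) L"
      "length L = card (T \<inter> terms_deg n d)"
    by (rule ex_sorted_list[of "T \<inter> terms_deg n d"]) (use Tn in auto)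
  have Jd: "graded_part n d J = mp_span (of_term ` set L)"
    unfolding J(2) L(1) by (rule graded_part_supported[OF Tn])
  have "length L = hilb_q n p d"
    using dim_graded_part_hilb[OF J(1) r] L(1,3) unfolding Jd dim_span_of_term by simp
  moreover have "distinct L" by (rule distinct_sorted[OF L(2)]) (use L(1) Tn in auto)
  ultimately show ?thesis using that[of L] L Jd by (simp add: extensors_def)
qed

text \<open>In degree \<open>m \<ge> d\<close>, the vectors of \<open>J\<close> in degree \<open>d\<close> move polynomially in the Pluecker coordinates
  to vectors of \<open>I\<close>, and suitable multiples of them stay independent modulo the terms outside \<open>J\<close>.\<close>

lemma open_condition_above:
  fixes J :: "'a::field spoly set"
  assumes K: "subfield_set K" and J: "J \<in> hilb n p" "J = supported T" and T: "up_closed n T"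
    and r: "gotzmann_number TYPE('a) n p r" "r \<le> d" "d \<le> m"
  shows "\<exists>Z. zclosed K n prec p d Z \<and> J \<notin> Z \<and> (\<forall>I\<in>hilb n p. I \<notin> Z \<longrightarrow>
    (\<forall>f\<in>graded_part n m I. (\<forall>t\<in>T \<inter> terms_deg n m. lk f t = 0) \<longrightarrow> f = 0))"
proof -
  let ?q = "hilb_q n p d" and ?N = "hilb_q n p m"
  have rm: "r \<le> m" using r by simp
  obtain L where L: "L \<in> extensors n prec d ?q" "set L = T \<inter> terms_deg n d" "distinct L" "length L = ?q"
    and Jd: "graded_part n d J = mp_span (of_term ` set L)"
    by (rule extensor_of_monomial_ideal[OF J T r(1,2)])
  obtain R where R: "set R = T \<inter> terms_deg n m" "distinct R" "length R = ?N"
    by (rule extensor_of_monomial_ideal[OF J T r(1) rm])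
  \<comment> \<open>Each term of \<open>J_m\<close> is a multiple, by some \<open>s i\<close>, of a
    term \<open>L ! k i\<close> of \<open>J_d\<close>.\<close>
  have "\<exists>s k. k < ?q \<and> s \<in> terms_deg n (m - d) \<and> R ! i = s + L ! k" if "i < ?N" for i
  proof -
    have "R ! i \<in> T \<inter> terms_deg n m" using that R by (metis nth_mem)
    then obtain s u where su: "s \<in> terms_deg n (m - d)" "u \<in> T \<inter> terms_deg n d" "R ! i = s + u"
      by (rule generated_terms[OF J T r])
    then obtain k where "k < ?q" "u = L ! k" using L(2,4) by (metis in_set_conv_nth)
    then show ?thesis using su by blast
  qed
  then obtain s k where sk: "\<And>i. i < ?N \<Longrightarrow> k i < ?q \<and> s i \<in> terms_deg n (m - d) \<and> R ! i = s i + L ! k i"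
    by metis
  \<comment> \<open>The coefficient at \<open>R ! j\<close> of \<open>s i\<close> times the vector
    that \<open>pluecker_column_vector\<close> provides for column \<open>k i\<close>; it is 0 when
    \<open>s i\<close> does not divide \<open>R ! j\<close>.\<close>
  define \<phi> where "\<phi> i j V = (if \<exists>u. R ! j = s i + u then pluecker V (L[k i := R ! j - s i]) else 0)"
    for i j and V :: "'a spoly set"
  have \<phi>_entry: "pluecker_entry d ?q (\<phi> i j)" if ij: "i < ?N" "j < ?N" for i j
  proof (cases "\<exists>u. R ! j = s i + u")
    case True
    then obtain u where u: "R ! j = s i + u" by blast
    moreover have "R ! j \<in> terms_deg n m" using ij R by (metis IntD2 nth_mem)
    ultimately have "u \<in> terms_deg n d"
      using sk[OF ij(1)] r(3) by (auto simp: terms_deg_def terms_add_iff)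
    then have "set (L[k i := u]) \<subseteq> terms_deg n d"
      using L(2) set_update_subset_insert[of L "k i" u] by auto
    then have "pluecker_entry d ?q (\<lambda>V :: 'a spoly set. pluecker V (L[k i := u]))"
      using L(4) by (intro pluecker_entry_pluecker[OF L(1)]) auto
    moreover have "\<phi> i j = (\<lambda>V. pluecker V (L[k i := u]))" using u by (auto simp: \<phi>_def)
    ultimately show ?thesis by simp
  next
    case False
    have "\<phi> i j = (\<lambda>V. 0)" unfolding \<phi>_def using False by auto
    then show ?thesis using pluecker_entry_zero[OF L(1), where 'a = 'a] by simp
  qed
  let ?Z = "{I \<in> hilb n p. det (mat ?N ?N (\<lambda>(i, j). \<phi> i j (graded_part n d I))) = 0}"
  have "zclosed K n prec p d ?Z"
    by (rule zclosed_det[OF K refl graded_part_in_Gr[OF _ r(1,2)] \<phi>_entry])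
  moreover have "J \<notin> ?Z"
  proof -
    note JGr = graded_part_in_Gr[OF J(1) r(1,2)]
    let ?\<Delta> = "pluecker (graded_part n d J) L"
    have "\<phi> i j (graded_part n d J) = (if i = j then ?\<Delta> else 0)" if ij: "i < ?N" "j < ?N" for i j
    proof -
      \<comment> \<open>As \<open>R\<close> is distinct, the substituted term is
        \<open>L ! k i\<close> itself only for \<open>i = j\<close>; so the matrix at
        \<open>J\<close> is scalar.\<close>
      have eq: "R ! j = s i + L ! k i \<longleftrightarrow> i = j"
        using sk[OF ij(1)] R(2,3) ij by (metis nth_eq_iff_index_eq)
      show ?thesis
      proof (cases "\<exists>u. R ! j = s i + u")
        case True
        then obtain u where u: "R ! j = s i + u" by blast
        then have "\<phi> i j (graded_part n d J) = (if u = L ! k i then ?\<Delta> else 0)"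
          using pluecker_monomial(2)[OF JGr Jd L(4,3)] sk[OF ij(1)] by (auto simp: \<phi>_def)
        then show ?thesis using eq u by simp
      next
        case False
        then show ?thesis using eq by (auto simp: \<phi>_def)
      qed
    qed
    then have "mat ?N ?N (\<lambda>(i, j). \<phi> i j (graded_part n d J)) = mat ?N ?N (\<lambda>(i, j). if i = j then ?\<Delta> else 0)"
      by (intro eq_matI) auto
    then show ?thesis
      using det_scalar[of ?N ?\<Delta>] pluecker_monomial(1)[OF JGr Jd L(4,3)] by simp
  qed
  moreover have "f = 0" if I: "I \<in> hilb n p" "I \<notin> ?Z"
    and f: "f \<in> graded_part n m I" "\<forall>t\<in>T \<inter> terms_deg n m. lk f t = 0" for I f
  proof -
    note IGr = graded_part_in_Gr[OF I(1) r(1,2)]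
    have "\<exists>g\<in>graded_part n d I. \<forall>\<sigma>. lk g \<sigma> = pluecker (graded_part n d I) (L[k i := \<sigma>])" if "i < ?N" for i
      using pluecker_column_vector[OF IGr L(4)] sk[OF that] by blast
    then obtain g where g: "\<And>i. i < ?N \<Longrightarrow> g i \<in> graded_part n d I"
      "\<And>i \<sigma>. i < ?N \<Longrightarrow> lk (g i) \<sigma> = pluecker (graded_part n d I) (L[k i := \<sigma>])"
      by metis
    have v: "of_term (s i) * g i \<in> graded_part n m I" if i: "i < ?N" for i
    proof -
      have "(of_term (s i) :: 'a spoly) \<in> forms n (m - d)" using sk[OF i] by (simp add: forms_def)
      then have "of_term (s i) * g i \<in> forms n ((m - d) + d)"
        using g(1)[OF i] by (intro forms_mult) (simp_all add: graded_part_def)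
      moreover have "of_term (s i) * g i \<in> I"
        using g(1)[OF i] sk[OF i] terms_deg_subset
        by (intro poly_ideal_mult[OF hilb_poly_ideal[OF I(1)]] polys_of_term) (auto simp: graded_part_def)
      ultimately show ?thesis using r(3) by (simp add: graded_part_def)
    qed
    have coord: "lk (of_term (s i) * g i) (R ! j) = \<phi> i j (graded_part n d I)" if "i < ?N" for i j
    proof (cases "\<exists>u. R ! j = s i + u")
      case True
      then show ?thesis using g(2)[OF that] by (auto simp: \<phi>_def lookup_of_term_times)
    next
      case False
      then have "R ! j \<notin> ks (of_term (s i) * g i)" using keys_of_term_times[of "s i" "g i"] by auto
      then show ?thesis using False by (simp add: \<phi>_def in_keys_iff)
    qed
    have "mat ?N ?N (\<lambda>(i, j). lk (of_term (s i) * g i) (R ! j))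
        = mat ?N ?N (\<lambda>(i, j). \<phi> i j (graded_part n d I))"
      by (intro eq_matI) (auto simp: coord)
    then have "det (mat ?N ?N (\<lambda>(i, j). lk (of_term (s i) * g i) (R ! j))) \<noteq> 0" using I by simp
    then show ?thesis
      using nonsingular_coordinates[OF graded_part_in_Gr[OF I(1) r(1) rm] R(3) v] f R(1) by simp
  qed
  ultimately show ?thesis by blast
qed

text \<open>In degree \<open>m < d\<close>, the Pluecker relations in degree \<open>d\<close> give linear conditions on the
  coordinates outside \<open>J\<close> of an element of \<open>I\<close>, and they are independent near \<open>J\<close> as \<open>J\<close> is saturated.\<close>

lemma open_condition_below:
  fixes J :: "'a::field spoly set"
  assumes K: "subfield_set K" and J: "J \<in> hilb n p" "J = supported T" and T: "up_closed n T"
    and sat: "term_saturation n T = T" and r: "gotzmann_number TYPE('a) n p r" "r \<le> d" "m \<le> d"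
  shows "\<exists>Z. zclosed K n prec p d Z \<and> J \<notin> Z \<and> (\<forall>I\<in>hilb n p. I \<notin> Z \<longrightarrow>
    (\<forall>f\<in>graded_part n m I. (\<forall>t\<in>T \<inter> terms_deg n m. lk f t = 0) \<longrightarrow> f = 0))"
proof -
  let ?q = "hilb_q n p d"
  obtain L where L: "L \<in> extensors n prec d ?q" "set L = T \<inter> terms_deg n d" "distinct L" "length L = ?q"
    and Jd: "graded_part n d J = mp_span (of_term ` set L)"
    by (rule extensor_of_monomial_ideal[OF J T r(1,2)])
  obtain R where R: "set R = terms_deg n m - T" "distinct R"
    using finite_distinct_list[of "terms_deg n m - T"] by auto
  define N where "N = length R"
  \<comment> \<open>\<open>R ! i\<close> is outside the saturated \<open>T\<close>, so
    \<open>d - m\<close> is not an exponent for it: some multiple in degree \<open>d\<close> stays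
    outside \<open>T\<close>.\<close>
  have "\<exists>s. s \<in> terms_deg n (d - m) \<and> s + R ! i \<notin> T" if "i < N" for i
  proof -
    have "R ! i \<in> terms_deg n m" "R ! i \<notin> T" using that R(1) nth_mem[of i R] by (auto simp: N_def)
    then have "R ! i \<in> terms n" "R ! i \<notin> term_saturation n T" using terms_deg_subset sat by auto
    then show ?thesis by (auto simp: term_saturation_def)
  qed
  then obtain s where s: "\<And>i. i < N \<Longrightarrow> s i \<in> terms_deg n (d - m)" "\<And>i. i < N \<Longrightarrow> s i + R ! i \<notin> T"
    by metis
  have R_deg: "R ! i \<in> terms_deg n m" if "i < N" for i using that R(1) nth_mem[of i R] by (auto simp: N_def)
  have sR: "s i + R ! j \<in> terms_deg n d" if "i < N" "j < N" for i j
    using terms_deg_add[OF s(1)[OF that(1)] R_deg[OF that(2)]] r(3) by simp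
  \<comment> \<open>Row \<open>i\<close> is the Pluecker relation for the element
    \<open>s i * f\<close> at the term \<open>s i + R ! i\<close>, collected by the unknown
    coefficients of \<open>f\<close> at the \<open>R ! j\<close>.\<close>
  define \<phi> where "\<phi> i j V = (if i = j then pluecker V L else 0)
      - (\<Sum>k<?q. if L ! k = s i + R ! j then pluecker V (L[k := s i + R ! i]) else 0)"
    for i j and V :: "'a spoly set"
  have not_L: "L ! k \<noteq> s i + R ! i" if "i < N" "k < ?q" for i k
    using s(2)[OF that(1)] nth_mem[of k L] that(2) L(2,4) by auto
  have \<phi>_entry: "pluecker_entry d ?q (\<phi> i j)" if ij: "i < N" "j < N" for i j
  proof -
    \<comment> \<open>Each entry is 0 or one coordinate up to sign. On the diagonal the sum vanishes
      because \<open>s i + R ! i\<close> is not in \<open>T\<close>; elsewhere at most one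
      \<open>k\<close> contributes because \<open>L\<close> is distinct.\<close>
    consider "i = j" | k where "i \<noteq> j" "k < ?q" "L ! k = s i + R ! j"
      | "i \<noteq> j" "\<forall>k<?q. L ! k \<noteq> s i + R ! j" by blast
    then show ?thesis
    proof cases
      case 1
      then have "\<phi> i j = (\<lambda>V. pluecker V L)"
        using not_L[OF ij(1)] by (auto simp: \<phi>_def intro!: sum.neutral)
      then show ?thesis using pluecker_entry_pluecker[OF L(1,4)] L(2) by simp
    next
      case 2
      have "(L ! l = s i + R ! j) = (l = k)" if "l < ?q" for l
        using 2 that L(3,4) by (metis nth_eq_iff_index_eq)
      then have "(\<Sum>l<?q. if L ! l = s i + R ! j then pluecker V (L[l := s i + R ! i]) else 0)
        = (\<Sum>l<?q. if l = k then pluecker V (L[l := s i + R ! i]) else 0)" for V :: "'a spoly set"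
        by (intro sum.cong refl) simp
      then have "\<phi> i j = (\<lambda>V. - pluecker V (L[k := s i + R ! i]))" using 2 by (auto simp: \<phi>_def)
      moreover have "set (L[k := s i + R ! i]) \<subseteq> terms_deg n d"
        using L(2) set_update_subset_insert[of L k "s i + R ! i"] sR[OF ij(1) ij(1)] by auto
      then have "pluecker_entry d ?q (\<lambda>V :: 'a spoly set. pluecker V (L[k := s i + R ! i]))"
        using L(4) by (intro pluecker_entry_pluecker[OF L(1)]) auto
      ultimately show ?thesis using pluecker_entry_uminus by simp
    next
      case 3
      then have "\<phi> i j = (\<lambda>V. 0)" by (auto simp: \<phi>_def intro!: sum.neutral)
      then show ?thesis using pluecker_entry_zero[OF L(1), where 'a = 'a] by simp
    qed
  qed
  let ?Z = "{I \<in> hilb n p. det (mat N N (\<lambda>(i, j). \<phi> i j (graded_part n d I))) = 0}"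
  have "zclosed K n prec p d ?Z"
    by (rule zclosed_det[OF K refl graded_part_in_Gr[OF _ r(1,2)] \<phi>_entry])
  moreover have "J \<notin> ?Z"
  proof -
    note JGr = graded_part_in_Gr[OF J(1) r(1,2)]
    let ?\<Delta> = "pluecker (graded_part n d J) L"
    have "\<phi> i j (graded_part n d J) = (if i = j then ?\<Delta> else 0)" if ij: "i < N" "j < N" for i j
    proof -
      \<comment> \<open>The substituted term lies outside \<open>T\<close>, so at \<open>J\<close>
        only the diagonal \<open>?\<Delta>\<close> is left.\<close>
      have "pluecker (graded_part n d J) (L[k := s i + R ! i]) = 0" if "k < ?q" for k
        using pluecker_monomial(2)[OF JGr Jd L(4,3) that] not_L[OF ij(1) that] by (metis (full_types))
      then show ?thesis by (auto simp: \<phi>_def intro!: sum.neutral)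
    qed
    then have "mat N N (\<lambda>(i, j). \<phi> i j (graded_part n d J)) = mat N N (\<lambda>(i, j). if i = j then ?\<Delta> else 0)"
      by (intro eq_matI) auto
    then show ?thesis
      using det_scalar[of N ?\<Delta>] pluecker_monomial(1)[OF JGr Jd L(4,3)] by simp
  qed
  moreover have "f = 0" if I: "I \<in> hilb n p" "I \<notin> ?Z"
    and f: "f \<in> graded_part n m I" "\<forall>t\<in>T \<inter> terms_deg n m. lk f t = 0" for I f
  proof -
    let ?V = "graded_part n d I"
    note IGr = graded_part_in_Gr[OF I(1) r(1,2)]
    have ff: "f \<in> forms n m" using f(1) by (simp add: graded_part_def)
    have bij: "bij_betw (\<lambda>j. R ! j) {..<N} (set R)" unfolding N_def by (rule bij_betw_nth[OF R(2)]) auto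
    have "ks f \<subseteq> set R"
    proof
      fix t assume t: "t \<in> ks f"
      then have "t \<in> terms_deg n m" "lk f t \<noteq> 0" using ff by (auto simp: forms_def in_keys_iff)
      then show "t \<in> set R" using f(2) R(1) by auto
    qed
    then have "f = (\<Sum>t\<in>set R. Poly_Mapping.single t (lk f t))" by (intro poly_mapping_sum_single) simp_all
    also have "\<dots> = (\<Sum>j<N. Poly_Mapping.single (R ! j) (lk f (R ! j)))"
      by (rule sum.reindex_bij_betw[OF bij, symmetric])
    finally have f_sum: "f = (\<Sum>j<N. Poly_Mapping.single (R ! j) (lk f (R ! j)))" .
    have "(\<Sum>j<N. \<phi> i j ?V * lk f (R ! j)) = 0" if i: "i < N" for i
    proof -
      let ?h = "of_term (s i) * f"
      have "(of_term (s i) :: 'a spoly) \<in> forms n (d - m)" using s(1)[OF i] by (simp add: forms_def)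
      then have "?h \<in> forms n ((d - m) + m)" by (rule forms_mult[OF _ ff])
      moreover have "?h \<in> I"
        using f(1) s(1)[OF i] terms_deg_subset
        by (intro poly_ideal_mult[OF hilb_poly_ideal[OF I(1)]] polys_of_term) (auto simp: graded_part_def)
      ultimately have h: "?h \<in> ?V" using r(3) by (simp add: graded_part_def)
      have h_sum: "?h = (\<Sum>j<N. Poly_Mapping.single (s i + R ! j) (lk f (R ! j)))"
        by (subst f_sum) (simp add: sum_distrib_left of_term_def mult_single)
      have "lk ?h (L ! k) = (\<Sum>j<N. if L ! k = s i + R ! j then lk f (R ! j) else 0)" for k
        unfolding h_sum lookup_sum by (intro sum.cong refl) (auto simp: lookup_single when_def)
      then have "pluecker ?V L * lk f (R ! i)
        = (\<Sum>k<?q. pluecker ?V (L[k := s i + R ! i]) * (\<Sum>j<N. if L ! k = s i + R ! j then lk f (R ! j) else 0))"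
        using pluecker_relation[OF IGr L(4) h, of "s i + R ! i"] by (simp add: lookup_of_term_times)
      also have "\<dots> = (\<Sum>k<?q. \<Sum>j<N.
          (if L ! k = s i + R ! j then pluecker ?V (L[k := s i + R ! i]) else 0) * lk f (R ! j))"
        unfolding sum_distrib_left by (intro sum.cong refl) simp
      also have "\<dots> = (\<Sum>j<N. (\<Sum>k<?q.
          if L ! k = s i + R ! j then pluecker ?V (L[k := s i + R ! i]) else 0) * lk f (R ! j))"
        unfolding sum_distrib_right by (rule sum.swap)
      finally have eq: "pluecker ?V L * lk f (R ! i) = \<dots>" .
      have "(\<Sum>j<N. \<phi> i j ?V * lk f (R ! j)) = (\<Sum>j<N. if i = j then pluecker ?V L * lk f (R ! j) else 0)
        - (\<Sum>j<N. (\<Sum>k<?q. if L ! k = s i + R ! j then pluecker ?V (L[k := s i + R ! i]) else 0) * lk f (R ! j))"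
        unfolding \<phi>_def left_diff_distrib sum_subtractf by (intro arg_cong2[where f = "(-)"] sum.cong refl) simp
      then show ?thesis using eq i by simp
    qed
    \<comment> \<open>The coefficients of \<open>f\<close> outside \<open>T\<close> solve a
      homogeneous linear system that is non-singular away from \<open>?Z\<close>.\<close>
    then have "mat N N (\<lambda>(i, j). \<phi> i j ?V) *\<^sub>v vec N (\<lambda>j. lk f (R ! j)) = 0\<^sub>v N"
      by (intro eq_vecI) (auto simp: scalar_prod_def atLeast0LessThan)
    moreover have "det (mat N N (\<lambda>(i, j). \<phi> i j ?V)) \<noteq> 0" using I by simp
    moreover have "vec N (\<lambda>j. lk f (R ! j)) \<in> carrier_vec N" by simp
    ultimately have "vec N (\<lambda>j. lk f (R ! j)) = 0\<^sub>v N"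
      using det_0_iff_vec_prod_zero_field[OF mat_carrier, of N "\<lambda>(i, j). \<phi> i j ?V"] by blast
    then have "lk f (R ! j) = 0" if "j < N" for j using that by (metis index_vec index_zero_vec(1))
    then show "f = 0" by (subst f_sum) simp
  qed
  ultimately show ?thesis by blast
qed

end

section \<open>The action of the general linear group\<close>

lemma const_zero [simp]: "const 0 = 0"
  by (simp add: const_def)

lemma const_add: "const (a + b) = const a + const b"
  by (simp add: const_def single_add)

lemma gl_act_sum: "gl_act n g (\<Sum>i\<in>A. f i) = (\<Sum>i\<in>A. gl_act n g (f i))"
  unfolding gl_act_def by (rule insertion_sum) (simp_all add: const_add)

lemma forms_power: "f \<in> forms n a \<Longrightarrow> f ^ k \<in> forms n (k * a)" for f :: "'a::comm_ring_1 spoly"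
proof (induction k)
  case 0
  show ?case by (auto simp: forms_def terms_deg_def)
next
  case (Suc k)
  then show ?case using forms_mult[of f n a "f ^ k" "k * a"] by simp
qed

lemma forms_prod:
  "finite A \<Longrightarrow> (\<And>i. i \<in> A \<Longrightarrow> f i \<in> forms n (a i)) \<Longrightarrow> (\<Prod>i\<in>A. f i) \<in> forms n (\<Sum>i\<in>A. a i)"
  for f :: "_ \<Rightarrow> 'a::comm_ring_1 spoly"
proof (induction A rule: finite_induct)
  case empty
  show ?case by (auto simp: forms_def terms_deg_def)
qed (auto intro: forms_mult)

lemma const_in_forms: "const c \<in> forms n 0"
  by (auto simp: const_def forms_def terms_deg_def split: if_splits)

lemma gl_act_forms:
  fixes f :: "'a::field spoly"
  assumes "f \<in> forms n m"
  shows "gl_act n g f \<in> forms n m"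
proof -
  let ?x = "\<lambda>i. \<Sum>j\<le>n. const (g $$ (i, j)) * var j"
  have var: "(var j :: 'a spoly) \<in> forms n 1" if "j \<le> n" for j
    using that by (simp add: var_def forms_def terms_deg_def terms_def)
  have x: "?x i \<in> forms n 1" for i
  proof (rule forms_sum)
    fix j assume "j \<in> {..n}"
    then show "const (g $$ (i, j)) * var j \<in> forms n 1"
      using forms_mult[OF const_in_forms var[of j], of "g $$ (i, j)"] by simp
  qed
  have eval: "expo_eval ?x e \<in> forms n (expo_deg e)" for e
    unfolding expo_eval_def expo_deg_def
    using forms_power[OF x] by (intro forms_prod) simp_all
  have "const (lk f e) * expo_eval ?x e \<in> forms n m" if "e \<in> ks f" for e
  proof -
    have "expo_deg e = m" using that assms by (auto simp: forms_def terms_deg_def)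
    then show ?thesis using forms_mult[OF const_in_forms eval[of e], of "lk f e"] by simp
  qed
  then show ?thesis
    unfolding gl_act_def insertion_superset[of const, OF const_zero finite_keys order_refl]
    by (intro forms_sum)
qed

lemma expo_eval_var: "expo_eval var e = (of_term e :: 'a::comm_ring_1 spoly)"
proof -
  have pow: "var i ^ k = (of_term (Poly_Mapping.single i k) :: 'a spoly)" for i k
  proof (induction k)
    case (Suc k)
    have "Poly_Mapping.single i (Suc k) = Poly_Mapping.single i 1 + Poly_Mapping.single i k"
      by (simp flip: single_add)
    then show ?case using Suc by (simp add: var_def of_term_add)
  qed (simp add: of_term_def)
  have prod: "(\<Prod>i\<in>A. of_term (s i)) = (of_term (\<Sum>i\<in>A. s i) :: 'a spoly)" for A :: "nat set" and s
    by (induction A rule: infinite_finite_induct) (simp_all add: of_term_add, simp_all add: of_term_def)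
  show ?thesis
    unfolding expo_eval_def pow prod poly_mapping_sum_single[OF finite_keys order_refl, symmetric] ..
qed

lemma gl_act_one:
  fixes f :: "'a::field spoly"
  assumes "f \<in> polys n"
  shows "gl_act n (1\<^sub>m (n + 1)) f = f"
proof -
  let ?x = "\<lambda>i. \<Sum>j\<le>n. const (1\<^sub>m (n + 1) $$ (i, j)) * var j :: 'a spoly"
  have x: "?x i = var i" if "i \<le> n" for i
  proof -
    have "?x i = (\<Sum>j\<le>n. if j = i then var j else 0)"
      using that by (intro sum.cong refl) (auto simp: const_def)
    then show ?thesis using that by simp
  qed
  have "expo_eval ?x e = of_term e" if "e \<in> ks f" for e
  proof -
    have "ks e \<subseteq> {..n}" using that assms by (auto simp: polys_def terms_def)
    then have "expo_eval ?x e = expo_eval var e"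
      unfolding expo_eval_def using x by (intro prod.cong refl) auto
    then show ?thesis by (simp add: expo_eval_var)
  qed
  then show ?thesis
    unfolding gl_act_def insertion_superset[of const, OF const_zero finite_keys order_refl]
    using poly_mapping_sum_single[OF finite_keys order_refl, of f]
    by (simp add: single_eq_const_of_term)
qed

text \<open>A form of degree \<open>d\<close> in the image is also the image of the degree
  \<open>d\<close> component of any preimage, because the substitution is additive and preserves
  degrees.\<close>

lemma gl_act_graded_part:
  fixes I :: "'a::field spoly set"
  assumes I: "homogeneous_ideal n I"
  shows "gl_act n g ` graded_part n d I = graded_part n d (gl_act n g ` I)"
proof
  show "gl_act n g ` graded_part n d I \<subseteq> graded_part n d (gl_act n g ` I)"
    using gl_act_forms by (auto simp: graded_part_def)
  show "graded_part n d (gl_act n g ` I) \<subseteq> gl_act n g ` graded_part n d I"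
  proof
    fix h assume "h \<in> graded_part n d (gl_act n g ` I)"
    then obtain f where f: "f \<in> I" "h = gl_act n g f" and h: "h \<in> forms n d" by (auto simp: graded_part_def)
    have fp: "f \<in> polys n" using I f(1) by (auto simp: homogeneous_ideal_def poly_ideal_def)
    let ?D = "insert d (expo_deg ` ks f)"
    have "h = gl_act n g (\<Sum>k\<in>?D. hom_comp k f)"
      unfolding f(2) by (subst sum_hom_comp[of ?D f]) auto
    then have "h = (\<Sum>k\<in>?D. gl_act n g (hom_comp k f))" by (simp only: gl_act_sum)
    then have "hom_comp d h = (\<Sum>k\<in>?D. hom_comp d (gl_act n g (hom_comp k f)))"
      by (simp only: hom_comp_sum)
    also have "\<dots> = (\<Sum>k\<in>?D. if k = d then gl_act n g (hom_comp k f) else 0)"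
      by (intro sum.cong refl trans[OF hom_comp_form[OF gl_act_forms[OF hom_comp_in_forms[OF fp]]]]) auto
    also have "\<dots> = gl_act n g (hom_comp d f)" by (subst sum.delta) auto
    finally have "h = gl_act n g (hom_comp d f)" using hom_comp_form[OF h, of d] by simp
    moreover have "hom_comp d f \<in> graded_part n d I"
      using I f(1) hom_comp_in_forms[OF fp] by (simp add: homogeneous_ideal_def graded_part_def)
    ultimately show "h \<in> gl_act n g ` graded_part n d I" by blast
  qed
qed

lemma one_in_GL: "subfield_set K \<Longrightarrow> 1\<^sub>m (n + 1) \<in> GL K n"
  unfolding GL_def invertible_mat_def inverts_mat_def
  by (auto simp: subfield_set_def intro!: exI[of _ "1\<^sub>m (Suc n)"])

text \<open>Stability removes the group from \<open>gin\<close>: the maximum is taken over the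
  non-zero Pluecker coordinates of the \<open>I_d\<close> with \<open>I \<in> Y\<close>.\<close>

lemma GL_orbit_graded_part:
  fixes Y :: "'a::field spoly set set"
  assumes K: "subfield_set K" and Y: "Y \<subseteq> hilb n p" and stable: "\<forall>g\<in>GL K n. \<forall>I\<in>Y. gl_act n g ` I \<in> Y"
  shows "GL_orbit K n (graded_part n d ` Y) = graded_part n d ` Y"
proof
  show "GL_orbit K n (graded_part n d ` Y) \<subseteq> graded_part n d ` Y"
  proof
    fix V assume "V \<in> GL_orbit K n (graded_part n d ` Y)"
    then obtain g I where gI: "I \<in> Y" "g \<in> GL K n" "V = gl_act n g ` graded_part n d I"
      by (auto simp: GL_orbit_def)
    then have "V = graded_part n d (gl_act n g ` I)"
      using gl_act_graded_part hilb_homogeneous Y by blast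
    then show "V \<in> graded_part n d ` Y" using stable gI by blast
  qed
  show "graded_part n d ` Y \<subseteq> GL_orbit K n (graded_part n d ` Y)"
  proof
    fix V assume V: "V \<in> graded_part n d ` Y"
    then have "V \<subseteq> polys n" using forms_subset_polys by (auto simp: graded_part_def)
    then have "gl_act n (1\<^sub>m (n + 1)) f = f" if "f \<in> V" for f
      by (intro gl_act_one) (use that in blast)
    then have "gl_act n (1\<^sub>m (n + 1)) ` V = V" by (simp cong: image_cong)
    then show "V \<in> GL_orbit K n (graded_part n d ` Y)"
      unfolding GL_orbit_def using V one_in_GL[OF K, of n] by (intro CollectI exI[of _ "1\<^sub>m (n + 1)"] exI[of _ V]) simp
  qed
qed

section \<open>The double-generic initial ideal\<close>

lemma monomial_ideal_supported:
  fixes J :: "'a::field spoly set"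
  assumes "monomial_ideal n J"
  obtains T where "up_closed n T" "J = supported T"
proof -
  obtain A where A: "A \<subseteq> terms n" "J = ideal_gen n (of_term ` A)"
    using assms by (auto simp: monomial_ideal_def)
  define T where "T = {u + a | u a. u \<in> terms n \<and> a \<in> A}"
  have T: "up_closed n T"
    unfolding up_closed_def
  proof (intro conjI ballI)
    show "T \<subseteq> terms n" using A(1) by (auto simp: T_def)
    fix t b assume "t \<in> T" "b \<in> terms n"
    then obtain u a where "t = u + a" "u \<in> terms n" "a \<in> A" by (auto simp: T_def)
    then have "b + t = (b + u) + a" "b + u \<in> terms n" using \<open>b \<in> terms n\<close> by (simp_all add: add.assoc)
    then show "b + t \<in> T" using \<open>a \<in> A\<close> unfolding T_def by blast
  qed
  have "J = supported T"
  proof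
    have "A \<subseteq> T"
    proof
      fix a assume "a \<in> A"
      then show "a \<in> T" unfolding T_def by (intro CollectI exI[of _ 0] exI[of _ a]) simp
    qed
    then show "J \<subseteq> supported T"
      unfolding A(2) using homogeneous_ideal_supported[OF T, where 'a = 'a]
      by (intro ideal_gen_least) (auto simp: homogeneous_ideal_def supported_def)
    have J: "poly_ideal n J"
      unfolding A(2) using A(1) by (intro poly_ideal_ideal_gen) (auto simp: polys_def)
    show "supported T \<subseteq> J"
    proof
      fix f :: "'a spoly" assume f: "f \<in> supported T"
      have "const (lk f t) * of_term t \<in> J" if "t \<in> ks f" for t
      proof -
        have "t \<in> T" using f that by (auto simp: supported_def)
        then obtain u a where ua: "t = u + a" "u \<in> terms n" "a \<in> A" by (auto simp: T_def)
        have "of_term a \<in> J" unfolding A(2) using ideal_gen_superset ua(3) by blast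
        then have "of_term u * of_term a \<in> J" by (rule poly_ideal_mult[OF J polys_of_term[OF ua(2)]])
        then show ?thesis unfolding ua(1) of_term_add by (rule poly_ideal_mult[OF J polys_const])
      qed
      then have "(\<Sum>t\<in>ks f. const (lk f t) * of_term t) \<in> J" by (rule poly_ideal_sum[OF J])
      then show "f \<in> J"
        using poly_mapping_sum_single[OF finite_keys order_refl, of f] by (simp add: single_eq_const_of_term)
    qed
  qed
  then show ?thesis using that T by blast
qed

section \<open>The order on extensors and its maximum\<close>

context monomial_order
begin

lemma extensorsD:
  assumes "L \<in> extensors n prec m q"
  shows "length L = q" "set L \<subseteq> terms_deg n m" "\<And>i. i < q \<Longrightarrow> L ! i \<in> terms n"
    "\<And>i j. i < j \<Longrightarrow> j < q \<Longrightarrow> prec (L ! j) (L ! i)"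
proof -
  show L: "length L = q" "set L \<subseteq> terms_deg n m" using assms by (auto simp: extensors_def)
  show "L ! i \<in> terms n" if "i < q" for i using L that terms_deg_subset nth_mem by blast
  show "prec (L ! j) (L ! i)" if "i < j" "j < q" for i j
    using assms that by (auto simp: extensors_def sorted_wrt_iff_nth_less)
qed

lemma finite_extensors: "finite (extensors n prec m q)"
  by (rule finite_subset[OF _ finite_lists_length_eq[OF finite_terms_deg[of n m], of q]])
    (auto simp: extensors_def)

lemma extensor_less_total:
  assumes L: "L \<in> extensors n prec m q" and M: "M \<in> extensors n prec m q" and ne: "L \<noteq> M"
  shows "extensor_less prec L M \<or> extensor_less prec M L"
proof -
  have "\<exists>j. j < q \<and> L ! j \<noteq> M ! j"
    using ne extensorsD(1)[OF L] extensorsD(1)[OF M] by (auto simp: list_eq_iff_nth_eq)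
  then obtain j where j: "j < q" "L ! j \<noteq> M ! j" "\<forall>i<j. \<not> (i < q \<and> L ! i \<noteq> M ! i)"
    using exists_least_iff[of "\<lambda>j. j < q \<and> L ! j \<noteq> M ! j"] by auto
  then have "\<forall>i<j. L ! i = M ! i" by auto
  moreover have "prec (L ! j) (M ! j) \<or> prec (M ! j) (L ! j)"
    using prec_total extensorsD(3)[OF L j(1)] extensorsD(3)[OF M j(1)] j(2) by blast
  ultimately show ?thesis
    using j(1) extensorsD(1)[OF L] extensorsD(1)[OF M] unfolding extensor_less_def by metis
qed

lemma extensor_less_trans:
  assumes L: "L \<in> extensors n prec m q" "M \<in> extensors n prec m q" "N \<in> extensors n prec m q"
    and less: "extensor_less prec L M" "extensor_less prec M N"
  shows "extensor_less prec L N"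
proof -
  obtain j where j: "j < q" "\<forall>i<j. L ! i = M ! i" "prec (L ! j) (M ! j)"
    using less(1) extensorsD(1)[OF L(1)] by (auto simp: extensor_less_def)
  obtain k where k: "k < q" "\<forall>i<k. M ! i = N ! i" "prec (M ! k) (N ! k)"
    using less(2) extensorsD(1)[OF L(2)] by (auto simp: extensor_less_def)
  have "prec (L ! min j k) (N ! min j k)"
  proof (cases j k rule: linorder_cases)
    case equal
    then show ?thesis
      using j k prec_trans[of "L ! j" "M ! j" "N ! j"] extensorsD(3)[OF L(1) j(1)]
        extensorsD(3)[OF L(2) j(1)] extensorsD(3)[OF L(3) j(1)] by simp
  qed (use j k in \<open>simp_all add: min_def\<close>)
  then show ?thesis
    unfolding extensor_less_def using j k extensorsD(1)[OF L(1)] by (intro exI[of _ "min j k"]) simp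
qed

lemma extensor_less_irrefl: "L \<in> extensors n prec m q \<Longrightarrow> \<not> extensor_less prec L L"
  using prec_irrefl extensorsD(1,3) unfolding extensor_less_def by blast

text \<open>Existence and uniqueness of the greatest element give the \<open>THE\<close> in
  \<open>gin\<close> its intended value.\<close>

lemma gin_greatest:
  assumes A: "A = {L \<in> extensors n prec m q. U_open n m q L \<inter> GL_orbit K n W \<noteq> {}}" "A \<noteq> {}"
  shows "gin K n prec m q W \<in> A"
    "M \<in> A \<Longrightarrow> M = gin K n prec m q W \<or> extensor_less prec M (gin K n prec m q W)"
proof -
  have ext: "A \<subseteq> extensors n prec m q" using A(1) by blast
  have "\<exists>L\<in>A. \<forall>M\<in>A. M \<noteq> L \<longrightarrow> extensor_less prec M L"
  proof (rule ex_greatest[OF finite_subset[OF ext finite_extensors] A(2)])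
    show "extensor_less prec L N"
      if "L \<in> A" "M \<in> A" "N \<in> A" "extensor_less prec L M" "extensor_less prec M N" for L M N
      using that ext extensor_less_trans by blast
    show "extensor_less prec L M \<or> extensor_less prec M L" if "L \<in> A" "M \<in> A" "L \<noteq> M" for L M
      using that ext extensor_less_total by blast
  qed
  then obtain L where L: "L \<in> A" "\<forall>M\<in>A. M = L \<or> extensor_less prec M L" by blast
  have unique: "N = L" if "N \<in> A" "\<forall>M\<in>A. M = N \<or> extensor_less prec M N" for N
  proof (rule ccontr)
    assume "N \<noteq> L"
    then have "extensor_less prec N L" "extensor_less prec L N" using L that by auto
    moreover have "N \<in> extensors n prec m q" "L \<in> extensors n prec m q" using ext that L by auto
    ultimately show False using extensor_less_trans extensor_less_irrefl by blast
  qed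
  have "gin K n prec m q W = L"
    unfolding gin_def A(1)[symmetric] Let_def by (rule the_equality) (use L unique in blast)+
  then show "gin K n prec m q W \<in> A"
    "M \<in> A \<Longrightarrow> M = gin K n prec m q W \<or> extensor_less prec M (gin K n prec m q W)"
    using L by auto
qed

text \<open>The initial extensor of \<open>V\<close> even dominates \<open>L\<close> term by term: compare the numbers of terms below
  the first difference.\<close>

lemma lead_terms_not_extensor_less:
  fixes V :: "'a::field spoly set"
  assumes V: "V \<in> Gr n m q" and L: "L \<in> extensors n prec m q" "pluecker V L \<noteq> 0"
    and M: "M \<in> extensors n prec m q" "set M = lead_terms V"
  shows "\<not> extensor_less prec M L"
proof
  assume "extensor_less prec M L"
  then obtain j where j: "j < q" "prec (M ! j) (L ! j)"
    using extensorsD(1)[OF M(1)] by (auto simp: extensor_less_def)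
  let ?\<tau> = "L ! j"
  have \<tau>: "?\<tau> \<in> terms n" by (rule extensorsD(3)[OF L(1) j(1)])
  have distinct: "distinct M"
    using M(1) terms_deg_subset by (intro distinct_sorted) (auto simp: extensors_def)
  have "card {t \<in> lead_terms V. prec t ?\<tau>} \<le> card {t \<in> set L. prec t ?\<tau>}"
  proof (rule card_lead_terms_below[OF _ _ finite_set _ \<tau>])
    show "mp_subspace V" "V \<subseteq> forms n m" using V by (auto simp: Gr_def)
    show "f = 0" if "f \<in> V" "\<forall>t\<in>set L. lk f t = 0" for f
      using pluecker_nonzero_iff[OF V extensorsD(1)[OF L(1)]] L(2) that by blast
  qed
  \<comment> \<open>\<open>L\<close> decreases, so at most its \<open>q - j - 1\<close> entries
    after \<open>j\<close> are below \<open>L ! j\<close>, while \<open>M ! j\<close> and the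
    entries after it are \<open>q - j\<close> leading terms below \<open>L ! j\<close>.\<close>
  moreover have "{t \<in> set L. prec t ?\<tau>} \<subseteq> (\<lambda>i. L ! i) ` {Suc j..<q}"
  proof
    fix t assume t: "t \<in> {t \<in> set L. prec t ?\<tau>}"
    then obtain i where i: "i < q" "t = L ! i" using extensorsD(1)[OF L(1)] by (auto simp: in_set_conv_nth)
    have "j < i"
    proof (rule ccontr)
      assume "\<not> j < i"
      then have "i = j \<or> prec ?\<tau> t" using extensorsD(4)[OF L(1), of i j] i j \<open>\<not> j < i\<close>
        by (cases i j rule: linorder_cases) auto
      then show False using t i \<tau> extensorsD(3)[OF L(1)] prec_asym[of t ?\<tau>] prec_irrefl by blast
    qed
    then show "t \<in> (\<lambda>i. L ! i) ` {Suc j..<q}" using i by auto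
  qed
  then have "card {t \<in> set L. prec t ?\<tau>} \<le> card {Suc j..<q}"
    by (rule surj_card_le[rotated]) simp
  moreover have "(\<lambda>i. M ! i) ` {j..<q} \<subseteq> {t \<in> lead_terms V. prec t ?\<tau>}"
  proof
    fix t assume "t \<in> (\<lambda>i. M ! i) ` {j..<q}"
    then obtain i where i: "j \<le> i" "i < q" "t = M ! i" by auto
    have "prec t ?\<tau>"
    proof (cases "i = j")
      case False
      then have "prec t (M ! j)" using extensorsD(4)[OF M(1), of j i] i by simp
      then show ?thesis
        using prec_trans[of t "M ! j" ?\<tau>] j \<tau> i extensorsD(3)[OF M(1)] by blast
    qed (use i j in simp)
    then show "t \<in> {t \<in> lead_terms V. prec t ?\<tau>}" using i extensorsD(1)[OF M(1)] M(2) nth_mem by blast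
  qed
  then have "card ((\<lambda>i. M ! i) ` {j..<q}) \<le> card {t \<in> lead_terms V. prec t ?\<tau>}"
    by (intro card_mono) (simp_all flip: M(2))
  moreover have "inj_on (\<lambda>i. M ! i) {j..<q}"
    using distinct extensorsD(1)[OF M(1)] by (intro inj_on_nth) auto
  ultimately show False using j(1) by (simp add: card_image)
qed

lemma zclosed_pluecker_zero:
  fixes K :: "'a::field set"
  assumes K: "subfield_set K" and r: "gotzmann_number TYPE('a) n p r" "r \<le> d"
    and L: "L \<in> extensors n prec d (hilb_q n p d)"
  shows "zclosed K n prec p d {I \<in> hilb n p. pluecker (graded_part n d I) L = 0}"
proof -
  have "pluecker_entry d (hilb_q n p d) (\<lambda>V :: 'a spoly set. pluecker V L)"
    by (rule pluecker_entry_pluecker[OF L extensorsD(1,2)[OF L]])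
  from zclosed_det[OF K refl graded_part_in_Gr[OF _ r] this, of 1]
  show ?thesis by (simp add: det_single)
qed

end

theorem corollary5p6:
  fixes K :: "'a::field set"
    and n r d m :: nat
    and p :: "rat poly"
    and prec :: "pterm \<Rightarrow> pterm \<Rightarrow> bool"
    and Y :: "'a spoly set set"
    and J :: "'a spoly set"
  assumes "subfield_set K" and "infinite K"
    and "term_order n prec"
    and "gotzmann_number TYPE('a) n p r"
    and "r \<le> d" and "GL_stable_subset K n prec p d Y"
    and "saturated n J" and "monomial_ideal n J" and "J \<in> Y"
    and "r \<le> m"
  shows "strongly_prec n prec m (hilb_q n p m)
    (graded_part n m J) (graded_part n m (double_generic_initial_ideal K n prec p d Y))"
proof -
  interpret monomial_order n prec by unfold_locales fact
  let ?q = "hilb_q n p d"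
  note K = \<open>subfield_set K\<close> and r = \<open>gotzmann_number TYPE('a) n p r\<close> \<open>r \<le> d\<close> and rm = \<open>r \<le> m\<close>
  have irreducible: "\<And>Z1 Z2. zclosed K n prec p d Z1 \<Longrightarrow> zclosed K n prec p d Z2 \<Longrightarrow> Y \<subseteq> Z1 \<union> Z2
      \<Longrightarrow> Y \<subseteq> Z1 \<or> Y \<subseteq> Z2"
    and stable: "\<forall>g\<in>GL K n. \<forall>I\<in>Y. gl_act n g ` I \<in> Y" and closed: "zclosed K n prec p d Y"
    using \<open>GL_stable_subset K n prec p d Y\<close> unfolding GL_stable_subset_def by simp_all
  have Y: "Y \<subseteq> hilb n p" using closed unfolding zclosed_def by blast
  have J: "J \<in> hilb n p" using Y \<open>J \<in> Y\<close> by blast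
  obtain T where T: "up_closed n T" and JT: "J = supported T"
    by (rule monomial_ideal_supported[OF \<open>monomial_ideal n J\<close>])
  have Tn: "T \<subseteq> terms n" using T by (simp add: up_closed_def)
  have sat: "term_saturation n T = T"
  proof
    show "term_saturation n T \<subseteq> T"
    proof
      fix t assume "t \<in> term_saturation n T"
      then have "(of_term t :: 'a spoly) \<in> saturation n J"
        unfolding JT saturation_supported[OF T] by (simp add: supported_def)
      then show "t \<in> T" using \<open>saturated n J\<close> by (simp add: saturated_def JT supported_def)
    qed
  qed (rule subset_term_saturation[OF T])
  define L where "L = gin K n prec d ?q (graded_part n d ` Y)"
  define A where "A = {L \<in> extensors n prec d ?q. U_open n d ?q L \<inter> GL_orbit K n (graded_part n d ` Y) \<noteq> {}}"
  have A_iff: "M \<in> A \<longleftrightarrow> M \<in> extensors n prec d ?q \<and> (\<exists>I\<in>Y. pluecker (graded_part n d I) M \<noteq> 0)" for M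
    unfolding A_def GL_orbit_graded_part[OF K Y stable] U_open_def
    using graded_part_in_Gr[OF _ r] Y by blast
  \<comment> \<open>The extensor of leading terms of any \<open>I \<in> Y\<close> competes in the
    maximum that defines \<open>gin\<close>: an element of \<open>I_d\<close> vanishing at all
    leading terms is 0.\<close>
  have lead_in_A: "\<exists>M\<in>A. set M = lead_terms (graded_part n d I) \<and> pluecker (graded_part n d I) M \<noteq> 0"
    if I: "I \<in> Y" for I
  proof -
    let ?V = "graded_part n d I"
    have Gr: "?V \<in> Gr n d ?q" using graded_part_in_Gr[OF _ r] Y I by blast
    then have V: "mp_subspace ?V" "?V \<subseteq> forms n d" "mp_dim ?V = ?q" by (simp_all add: Gr_def)
    have sub: "lead_terms ?V \<subseteq> terms_deg n d" by (rule lead_terms_forms[OF V(2)])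
    obtain M where M: "set M = lead_terms ?V" "sorted_wrt (\<lambda>s t. prec t s) M" "length M = card (lead_terms ?V)"
      by (rule ex_sorted_list[OF finite_lead_terms[OF V(2)]]) (use sub terms_deg_subset in blast)+
    have len: "length M = ?q" using M(3) dim_eq_card_lead_terms[OF V(1,2)] V(3) by simp
    have "f = 0" if f: "f \<in> ?V" "\<forall>t\<in>set M. lk f t = 0" for f
    proof (rule ccontr)
      assume "f \<noteq> 0"
      moreover have "f \<in> polys n" using f(1) V(2) forms_subset_polys by blast
      ultimately obtain t where t: "is_lead f t" using ex_lead by blast
      then have "t \<in> set M" using f(1) unfolding M(1) lead_terms_def by blast
      then show False using f(2) t by (auto simp: is_lead_def in_keys_iff)
    qed
    then have "pluecker ?V M \<noteq> 0" unfolding pluecker_nonzero_iff[OF Gr len] by blast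
    moreover have "M \<in> extensors n prec d ?q" using M sub len by (simp add: extensors_def)
    ultimately show ?thesis using A_iff I M(1) by blast
  qed
  have "A \<noteq> {}" using lead_in_A \<open>J \<in> Y\<close> by blast
  note gin = gin_greatest[OF A_def this, folded L_def]
  have L: "L \<in> extensors n prec d ?q" and "\<exists>I\<in>Y. pluecker (graded_part n d I) L \<noteq> 0"
    using gin(1) A_iff by blast+
  define Z :: "'a spoly set set" where "Z = {I \<in> hilb n p. pluecker (graded_part n d I) L = 0}"
  have Z: "zclosed K n prec p d Z" unfolding Z_def by (rule zclosed_pluecker_zero[OF K r L])
  have YZ: "\<not> Y \<subseteq> Z" using \<open>\<exists>I\<in>Y. pluecker (graded_part n d I) L \<noteq> 0\<close> by (auto simp: Z_def)
  have "\<exists>Z. zclosed K n prec p d Z \<and> J \<notin> Z \<and> (\<forall>I\<in>hilb n p. I \<notin> Z \<longrightarrow>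
    (\<forall>f\<in>graded_part n m I. (\<forall>t\<in>T \<inter> terms_deg n m. lk f t = 0) \<longrightarrow> f = 0))"
  proof (cases "d \<le> m")
    case True
    then show ?thesis by (rule open_condition_above[OF K J JT T r])
  next
    case False
    then have "m \<le> d" by simp
    then show ?thesis by (rule open_condition_below[OF K J JT T sat r])
  qed
  then obtain Z' where Z': "zclosed K n prec p d Z'" "J \<notin> Z'"
    and coord: "\<forall>I\<in>hilb n p. I \<notin> Z' \<longrightarrow>
      (\<forall>f\<in>graded_part n m I. (\<forall>t\<in>T \<inter> terms_deg n m. lk f t = 0) \<longrightarrow> f = 0)"
    by (elim exE conjE)
  have YZ': "\<not> Y \<subseteq> Z'" using Z'(2) \<open>J \<in> Y\<close> by (metis subsetD)
  obtain I where I: "I \<in> Y" "I \<notin> Z" "I \<notin> Z'"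
    using irreducible[OF Z Z'(1)] YZ YZ' by blast
  have I_hilb: "I \<in> hilb n p" using I(1) Y by (rule rev_subsetD)
  then have IL: "pluecker (graded_part n d I) L \<noteq> 0" using I(2) by (simp add: Z_def)
  obtain M where M: "M \<in> A" "set M = lead_terms (graded_part n d I)" using lead_in_A[OF I(1)] by blast
  \<comment> \<open>Maximality leaves \<open>M = L\<close> or \<open>M\<close> below
    \<open>L\<close>; the latter is impossible since \<open>I_d\<close> has a non-zero Pluecker
    coordinate at \<open>L\<close>.\<close>
  have "M = L"
    using gin(2)[OF M(1)] M A_iff
      lead_terms_not_extensor_less[OF graded_part_in_Gr[OF I_hilb r] L IL _ M(2)] by blast
  then have G: "graded_part n m (double_generic_initial_ideal K n prec p d Y)
      = mp_span (of_term ` lead_terms (graded_part n m I))"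
    using saturation_lead_terms[OF I_hilb r(1,2) rm] M(2)
    unfolding double_generic_initial_ideal_def L_def[symmetric] by simp
  let ?A = "T \<inter> terms_deg n m" and ?B = "lead_terms (graded_part n m I)"
  have Jm: "graded_part n m J = mp_span (of_term ` ?A)"
    unfolding JT by (rule graded_part_supported[OF Tn])
  have V: "mp_subspace (graded_part n m I)" "graded_part n m I \<subseteq> forms n m"
    using graded_part_in_Gr[OF I_hilb r(1) rm] by (simp_all add: Gr_def)
  have B: "?B \<subseteq> terms_deg n m" by (rule lead_terms_forms[OF V(2)])
  have card: "card ?A = hilb_q n p m" "card ?B = hilb_q n p m"
    using dim_graded_part_hilb[OF J r(1) rm] dim_graded_part_hilb[OF I_hilb r(1) rm]
    unfolding Jm dim_span_of_term dim_eq_card_lead_terms[OF V] by simp_all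
  have below: "card {t \<in> ?B. prec t \<tau>} \<le> card {t \<in> ?A. prec t \<tau>}" if \<tau>: "\<tau> \<in> terms n" for \<tau>
  proof (rule card_lead_terms_below[OF V _ _ \<tau>])
    show "f = 0" if "f \<in> graded_part n m I" "\<forall>t\<in>?A. lk f t = 0" for f
      using coord I_hilb I(3) that by blast
  qed simp
  have "?B \<subseteq> terms n" by (rule order_trans[OF B terms_deg_subset])
  moreover have "finite ?A" "?A \<subseteq> terms n" using Tn by auto
  ultimately have "\<exists>\<omega>. bij_betw \<omega> ?A ?B \<and> (\<forall>a\<in>?A. a = \<omega> a \<or> prec a (\<omega> a))"
    using finite_lead_terms[OF V(2)] card below by (intro ex_increasing_bij) simp_all
  then obtain \<omega> where \<omega>: "bij_betw \<omega> ?A ?B" "\<forall>a\<in>?A. a = \<omega> a \<or> prec a (\<omega> a)" by blast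
  show ?thesis
    unfolding strongly_prec_def Jm G
    by (rule exI[of _ ?A], rule exI[of _ ?B], rule exI[of _ \<omega>])
      (use \<omega> B card finite_lead_terms[OF V(2)] in simp)
qed

end
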